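(* Let $\mathcal C$ be a category with a proper factorization system $(\mathcal E,\mathcal M)$, pullbacks of pairs of $\mathcal M$-morphisms with common codomain, and pushouts of pairs of $\mathcal E$-morphisms with common domain. Equip the category $\mathbf{Top}$ of topological spaces and continuous maps with the factorization system of continuous surjections and topological embeddings. Then $\mathcal C$ admits a noetherian form inducing $(\mathcal E,\mathcal M)$ if and only if there is a transfer functor $\mathcal C\to\mathbf{Top}$ for these systems.
   Context: Conventions: categories are locally small; "set" is relative to a fixed universe. A conservative functor is one that reflects isomorphisms. A proper factorization system $(\mathcal E,\mathcal M)$ is an orthogonal factorization system with every morphism in $\mathcal E$ an epimorphism and every morphism in $\mathcal M$ a monomorphism. Transfer functors. Let $\mathcal C,\mathcal D$ have specified proper factorization systems $(\mathcal E_{\mathcal C},\mathcal M_{\mathcal C})$, $(\mathcal E_{\mathcal D},\mathcal M_{\mathcal D})$, and suppose both have pullbacks of two right-class morphisms with common codomain and pushouts of two left-class morphisms with common domain. A transfer functor $T:\mathcal C\to\mathcal D$ is a conservative functor with $T(\mathcal E_{\mathcal C})\subseteq\mathcal E_{\mathcal D}$, $T(\mathcal M_{\mathcal C})\subseteq\mathcal M_{\mathcal D}$, preserving pullbacks of two $\mathcal M_{\mathcal C}$-morphisms and pushouts of two $\mathcal E_{\mathcal C}$-morphisms. Forms. An (orean) form $\mathsf F$ on a category $\mathcal C$ assigns to each object $X$ a set-sized bounded lattice $\mathsf F(X)$ (the fibre over $X$; its elements are called clusters) and to each morphism $f:X\to Y$ monotone maps $f_!:\mathsf F(X)\to\mathsf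 F(Y)$ and $f^*:\mathsf F(Y)\to\mathsf F(X)$ with $f_!S\le T\iff S\le f^*T$, such that $(gf)_!=g_!f_!$, $(gf)^*=f^*g^*$, and identities act as identities. Put $\operatorname{Im}f=f_!\top_X$ and $\operatorname{Ker}f=f^*\bot_Y$. A cluster in $\mathsf F(X)$ is conormal if it is the image of some morphism of $\mathcal C$ with codomain $X$, and normal if it is the kernel of some morphism of $\mathcal C$ with domain $X$. An embedding of a conormal $S\in\mathsf F(X)$ is a morphism $\iota$ into $X$ with $\operatorname{Im}\iota=S$ such that every morphism $f$ into $X$ with $\operatorname{Im}f\le S$ factors as $f=\iota h$ for a unique $h$. A quotient of a normal $K\in\mathsf F(X)$ is a morphism $\pi$ out of $X$ with $\operatorname{Ker}\pi=K$ such that every morphism $g$ out of $X$ with $K\le\operatorname{Ker}g$ factors as $g=h\pi$ for a unique $h$. The form is noetherian if: (N1) $f^*f_!S=S\vee\operatorname{Ker}f$ and $f_!f^*T=T\wedge\operatorname{Im}f$ for all $f,S,T$; (N2) every morphism $f$ factors as $f=me$ with $e$ a quotient of $\operatorname{Ker}f$ and $m$ an embedding of $\operatorname{Im}f$; (N3) the join of two normal clusters (in the same fibre) is normal, and the meet of two conormal clusters is conormal. For a noetherian form, the class $\mathcal E$ of all quotients (of normal clusters) and the class $\mathcal M$ of all embeddings (of conormal clusters) form a proper factorization system, the one induced by the form. *)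

theory Defs
  imports "HOL-Analysis.Analysis" "HOL-Algebra.Lattice"
begin

section \<open>The universe of sets\<close>

text \<open>
  The fixed universe is represented by a type \<open>'u\<close>: a set is small if its cardinality is strictly
  less than that of \<open>'u\<close>, and the small sets have to satisfy the closure properties of a
  Grothendieck universe (the cardinality of \<open>'u\<close> is an infinite regular strong limit). A small set
  is thus, up to bijection, a subset of \<open>'u\<close> of smaller cardinality. As in SGA 4, the universe of
  finite sets is not excluded.
\<close>

abbreviation small :: "'u itself \<Rightarrow> 'a set \<Rightarrow> bool" where
  "small U A \<equiv> A \<prec> (UNIV :: 'u set)"

definition set_universe :: "'u itself \<Rightarrow> bool" where
  "set_universe U \<longleftrightarrow>
     infinite (UNIV :: 'u set) \<and>
     (\<forall>A :: 'u set. small U A \<longrightarrow> small U (Pow A)) \<and>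
     (\<forall>(I :: 'u set) (A :: 'u \<Rightarrow> 'u set).
        small U I \<and> (\<forall>i\<in>I. small U (A i)) \<longrightarrow> small U (\<Union>i\<in>I. A i))"

section \<open>Categories\<close>

record ('o, 'm) cat =
  Obj :: "'o set"
  Arr :: "'m set"
  Dom :: "'m \<Rightarrow> 'o"
  Cod :: "'m \<Rightarrow> 'o"
  Idn :: "'o \<Rightarrow> 'm"
  Cmp :: "'m \<Rightarrow> 'm \<Rightarrow> 'm"  (infixr "\<cdot>\<index>" 70)

definition Hom :: "('o, 'm) cat \<Rightarrow> 'o \<Rightarrow> 'o \<Rightarrow> 'm set" where
  "Hom C X Y = {f \<in> Arr C. Dom C f = X \<and> Cod C f = Y}"

locale category =
  fixes C :: "('o, 'm) cat" (structure)
  assumes dom_obj: "f \<in> Arr C \<Longrightarrow> Dom C f \<in> Obj C"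
    and cod_obj: "f \<in> Arr C \<Longrightarrow> Cod C f \<in> Obj C"
    and idn_hom: "X \<in> Obj C \<Longrightarrow> Idn C X \<in> Hom C X X"
    and cmp_hom: "f \<in> Hom C X Y \<Longrightarrow> g \<in> Hom C Y Z \<Longrightarrow> g \<cdot> f \<in> Hom C X Z"
    and idn_right: "f \<in> Hom C X Y \<Longrightarrow> f \<cdot> Idn C X = f"
    and idn_left: "f \<in> Hom C X Y \<Longrightarrow> Idn C Y \<cdot> f = f"
    and cmp_assoc: "f \<in> Hom C W X \<Longrightarrow> g \<in> Hom C X Y \<Longrightarrow> h \<in> Hom C Y Z \<Longrightarrow>
                      (h \<cdot> g) \<cdot> f = h \<cdot> (g \<cdot> f)"

definition locally_small :: "'u itself \<Rightarrow> ('o, 'm) cat \<Rightarrow> bool" where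
  "locally_small U C \<longleftrightarrow> (\<forall>X\<in>Obj C. \<forall>Y\<in>Obj C. small U (Hom C X Y))"

definition is_iso :: "('o, 'm) cat \<Rightarrow> 'm \<Rightarrow> bool" where
  "is_iso C f \<longleftrightarrow> f \<in> Arr C \<and>
     (\<exists>g \<in> Hom C (Cod C f) (Dom C f).
        g \<cdot>\<^bsub>C\<^esub> f = Idn C (Dom C f) \<and> f \<cdot>\<^bsub>C\<^esub> g = Idn C (Cod C f))"

definition is_mono :: "('o, 'm) cat \<Rightarrow> 'm \<Rightarrow> bool" where
  "is_mono C f \<longleftrightarrow> f \<in> Arr C \<and>
     (\<forall>W\<in>Obj C. \<forall>g \<in> Hom C W (Dom C f). \<forall>h \<in> Hom C W (Dom C f).
        f \<cdot>\<^bsub>C\<^esub> g = f \<cdot>\<^bsub>C\<^esub> h \<longrightarrow> g = h)"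

definition is_epi :: "('o, 'm) cat \<Rightarrow> 'm \<Rightarrow> bool" where
  "is_epi C f \<longleftrightarrow> f \<in> Arr C \<and>
     (\<forall>Z\<in>Obj C. \<forall>g \<in> Hom C (Cod C f) Z. \<forall>h \<in> Hom C (Cod C f) Z.
        g \<cdot>\<^bsub>C\<^esub> f = h \<cdot>\<^bsub>C\<^esub> f \<longrightarrow> g = h)"

text \<open>\<open>is_pullback C f g p q\<close>: the span \<open>(p, q)\<close> is a pullback of the cospan \<open>(f, g)\<close>,
  with \<open>f \<cdot> p = g \<cdot> q\<close>.\<close>

definition is_pullback :: "('o, 'm) cat \<Rightarrow> 'm \<Rightarrow> 'm \<Rightarrow> 'm \<Rightarrow> 'm \<Rightarrow> bool" where
  "is_pullback C f g p q \<longleftrightarrow>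
     f \<in> Arr C \<and> g \<in> Arr C \<and> Cod C f = Cod C g \<and>
     (\<exists>P\<in>Obj C.
        p \<in> Hom C P (Dom C f) \<and> q \<in> Hom C P (Dom C g) \<and> f \<cdot>\<^bsub>C\<^esub> p = g \<cdot>\<^bsub>C\<^esub> q \<and>
        (\<forall>W\<in>Obj C. \<forall>a \<in> Hom C W (Dom C f). \<forall>b \<in> Hom C W (Dom C g).
           f \<cdot>\<^bsub>C\<^esub> a = g \<cdot>\<^bsub>C\<^esub> b \<longrightarrow>
           (\<exists>!h. h \<in> Hom C W P \<and> p \<cdot>\<^bsub>C\<^esub> h = a \<and> q \<cdot>\<^bsub>C\<^esub> h = b)))"

text \<open>\<open>is_pushout C f g i j\<close>: the cospan \<open>(i, j)\<close> is a pushout of the span \<open>(f, g)\<close>,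
  with \<open>i \<cdot> f = j \<cdot> g\<close>.\<close>

definition is_pushout :: "('o, 'm) cat \<Rightarrow> 'm \<Rightarrow> 'm \<Rightarrow> 'm \<Rightarrow> 'm \<Rightarrow> bool" where
  "is_pushout C f g i j \<longleftrightarrow>
     f \<in> Arr C \<and> g \<in> Arr C \<and> Dom C f = Dom C g \<and>
     (\<exists>P\<in>Obj C.
        i \<in> Hom C (Cod C f) P \<and> j \<in> Hom C (Cod C g) P \<and> i \<cdot>\<^bsub>C\<^esub> f = j \<cdot>\<^bsub>C\<^esub> g \<and>
        (\<forall>W\<in>Obj C. \<forall>a \<in> Hom C (Cod C f) W. \<forall>b \<in> Hom C (Cod C g) W.
           a \<cdot>\<^bsub>C\<^esub> f = b \<cdot>\<^bsub>C\<^esub> g \<longrightarrow>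
           (\<exists>!h. h \<in> Hom C P W \<and> h \<cdot>\<^bsub>C\<^esub> i = a \<and> h \<cdot>\<^bsub>C\<^esub> j = b)))"

section \<open>Proper factorization systems and transfer functors\<close>

locale proper_factorization_system = category C
  for C :: "('o, 'm) cat" (structure) +
  fixes E M :: "'m set"
  assumes E_arr: "E \<subseteq> Arr C"
    and M_arr: "M \<subseteq> Arr C"
    and iso_E: "is_iso C f \<Longrightarrow> f \<in> E"
    and iso_M: "is_iso C f \<Longrightarrow> f \<in> M"
    and cmp_E: "f \<in> E \<Longrightarrow> g \<in> E \<Longrightarrow> Cod C f = Dom C g \<Longrightarrow> g \<cdot> f \<in> E"
    and cmp_M: "f \<in> M \<Longrightarrow> g \<in> M \<Longrightarrow> Cod C f = Dom C g \<Longrightarrow> g \<cdot> f \<in> M"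
    and factorization: "f \<in> Arr C \<Longrightarrow> \<exists>e\<in>E. \<exists>m\<in>M. Cod C e = Dom C m \<and> f = m \<cdot> e"
    and orthogonality:
      "e \<in> E \<Longrightarrow> m \<in> M \<Longrightarrow>
       u \<in> Hom C (Dom C e) (Dom C m) \<Longrightarrow> v \<in> Hom C (Cod C e) (Cod C m) \<Longrightarrow>
       m \<cdot> u = v \<cdot> e \<Longrightarrow>
       \<exists>!d. d \<in> Hom C (Cod C e) (Dom C m) \<and> d \<cdot> e = u \<and> m \<cdot> d = v"
    and E_epi: "e \<in> E \<Longrightarrow> is_epi C e"
    and M_mono: "m \<in> M \<Longrightarrow> is_mono C m"

locale pfs_category = proper_factorization_system C E M
  for C :: "('o, 'm) cat" (structure) and E M +
  assumes M_pullbacks: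
      "f \<in> M \<Longrightarrow> g \<in> M \<Longrightarrow> Cod C f = Cod C g \<Longrightarrow> \<exists>p q. is_pullback C f g p q"
    and E_pushouts:
      "f \<in> E \<Longrightarrow> g \<in> E \<Longrightarrow> Dom C f = Dom C g \<Longrightarrow> \<exists>i j. is_pushout C f g i j"

definition is_functor ::
  "('o, 'm) cat \<Rightarrow> ('p, 'n) cat \<Rightarrow> ('o \<Rightarrow> 'p) \<Rightarrow> ('m \<Rightarrow> 'n) \<Rightarrow> bool" where
  "is_functor C D To Ta \<longleftrightarrow>
     (\<forall>X\<in>Obj C. To X \<in> Obj D \<and> Ta (Idn C X) = Idn D (To X)) \<and>
     (\<forall>f\<in>Arr C. Ta f \<in> Hom D (To (Dom C f)) (To (Cod C f))) \<and>
     (\<forall>f\<in>Arr C. \<forall>g\<in>Arr C. Cod C f = Dom C g \<longrightarrow> Ta (g \<cdot>\<^bsub>C\<^esub> f) = Ta g \<cdot>\<^bsub>D\<^esub> Ta f)"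

text \<open>\<open>To\<close> and \<open>Ta\<close> are the object part and the arrow part of the functor.\<close>

locale transfer_functor =
  src: pfs_category C EC MC + tgt: pfs_category D ED MD
  for C :: "('o, 'm) cat" and EC MC and D :: "('p, 'n) cat" and ED MD +
  fixes To :: "'o \<Rightarrow> 'p" and Ta :: "'m \<Rightarrow> 'n"
  assumes is_functor: "is_functor C D To Ta"
    and conservative: "f \<in> Arr C \<Longrightarrow> is_iso D (Ta f) \<Longrightarrow> is_iso C f"
    and E_preserved: "Ta ` EC \<subseteq> ED"
    and M_preserved: "Ta ` MC \<subseteq> MD"
    and pullback_preserved:
      "f \<in> MC \<Longrightarrow> g \<in> MC \<Longrightarrow> is_pullback C f g p q \<Longrightarrow>
       is_pullback D (Ta f) (Ta g) (Ta p) (Ta q)"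
    and pushout_preserved:
      "f \<in> EC \<Longrightarrow> g \<in> EC \<Longrightarrow> is_pushout C f g i j \<Longrightarrow>
       is_pushout D (Ta f) (Ta g) (Ta i) (Ta j)"

section \<open>The category of topological spaces\<close>

text \<open>
  The objects are the topological spaces whose underlying set is a small subset of \<open>'u\<close>; up to
  homeomorphism these are all spaces on small sets. An arrow is a triple of a source, a continuous
  map and a target; the map is normalised to be \<open>undefined\<close> outside its source, so that arrows are
  equal exactly if they are equal as continuous maps.
\<close>

type_synonym 'u top_arr = "'u topology \<times> ('u \<Rightarrow> 'u) \<times> 'u topology"

definition Top :: "('u topology, 'u top_arr) cat" where
  "Top =
    \<lparr> Obj = {X. small TYPE('u) (topspace X)},
      Arr = {(X, f, Y). small TYPE('u) (topspace X) \<and> small TYPE('u) (topspace Y) \<and>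
                        continuous_map X Y f \<and> f \<in> extensional (topspace X)},
      Dom = (\<lambda>(X, f, Y). X),
      Cod = (\<lambda>(X, f, Y). Y),
      Idn = (\<lambda>X. (X, \<lambda>x\<in>topspace X. x, X)),
      Cmp = (\<lambda>(Y', g, Z) (X, f, Y). (X, compose (topspace X) g f, Z)) \<rparr>"

definition Top_surjections :: "'u top_arr set" where
  "Top_surjections = {(X, f, Y) \<in> Arr Top. f ` topspace X = topspace Y}"

definition Top_embeddings :: "'u top_arr set" where
  "Top_embeddings = {(X, f, Y) \<in> Arr Top. embedding_map X Y f}"

section \<open>Noetherian forms\<close>

text \<open>\<open>fib F X\<close> is the fibre over \<open>X\<close>, \<open>push F f\<close> is $f_!$ and \<open>pull F f\<close> is $f^*$. The clusters are
  elements of \<open>'u\<close>.\<close>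

record ('o, 'm, 'u) form =
  fib :: "'o \<Rightarrow> 'u gorder"
  push :: "'m \<Rightarrow> 'u \<Rightarrow> 'u"
  pull :: "'m \<Rightarrow> 'u \<Rightarrow> 'u"

locale orean_form = category C for C :: "('o, 'm) cat" (structure) +
  fixes F :: "('o, 'm, 'u) form"
  assumes fib_lattice: "X \<in> Obj C \<Longrightarrow> bounded_lattice (fib F X)"
    and fib_small: "X \<in> Obj C \<Longrightarrow> small TYPE('u) (carrier (fib F X))"
    and push_closed:
      "f \<in> Hom C X Y \<Longrightarrow> S \<in> carrier (fib F X) \<Longrightarrow> push F f S \<in> carrier (fib F Y)"
    and pull_closed:
      "f \<in> Hom C X Y \<Longrightarrow> T \<in> carrier (fib F Y) \<Longrightarrow> pull F f T \<in> carrier (fib F X)"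
    and push_mono: "f \<in> Hom C X Y \<Longrightarrow> isotone (fib F X) (fib F Y) (push F f)"
    and pull_mono: "f \<in> Hom C X Y \<Longrightarrow> isotone (fib F Y) (fib F X) (pull F f)"
    and adjunction:
      "f \<in> Hom C X Y \<Longrightarrow> S \<in> carrier (fib F X) \<Longrightarrow> T \<in> carrier (fib F Y) \<Longrightarrow>
       push F f S \<sqsubseteq>\<^bsub>fib F Y\<^esub> T \<longleftrightarrow> S \<sqsubseteq>\<^bsub>fib F X\<^esub> pull F f T"
    and push_cmp:
      "f \<in> Hom C X Y \<Longrightarrow> g \<in> Hom C Y Z \<Longrightarrow> S \<in> carrier (fib F X) \<Longrightarrow>
       push F (g \<cdot> f) S = push F g (push F f S)"
    and pull_cmp:
      "f \<in> Hom C X Y \<Longrightarrow> g \<in> Hom C Y Z \<Longrightarrow> T \<in> carrier (fib F Z) \<Longrightarrow>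
       pull F (g \<cdot> f) T = pull F f (pull F g T)"
    and push_idn: "X \<in> Obj C \<Longrightarrow> S \<in> carrier (fib F X) \<Longrightarrow> push F (Idn C X) S = S"
    and pull_idn: "X \<in> Obj C \<Longrightarrow> T \<in> carrier (fib F X) \<Longrightarrow> pull F (Idn C X) T = T"

definition Im :: "('o, 'm) cat \<Rightarrow> ('o, 'm, 'u) form \<Rightarrow> 'm \<Rightarrow> 'u" where
  "Im C F f = push F f \<top>\<^bsub>fib F (Dom C f)\<^esub>"

definition Ker :: "('o, 'm) cat \<Rightarrow> ('o, 'm, 'u) form \<Rightarrow> 'm \<Rightarrow> 'u" where
  "Ker C F f = pull F f \<bottom>\<^bsub>fib F (Cod C f)\<^esub>"

definition conormal :: "('o, 'm) cat \<Rightarrow> ('o, 'm, 'u) form \<Rightarrow> 'o \<Rightarrow> 'u \<Rightarrow> bool" where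
  "conormal C F X S \<longleftrightarrow> (\<exists>f\<in>Arr C. Cod C f = X \<and> S = Im C F f)"

definition normal :: "('o, 'm) cat \<Rightarrow> ('o, 'm, 'u) form \<Rightarrow> 'o \<Rightarrow> 'u \<Rightarrow> bool" where
  "normal C F X K \<longleftrightarrow> (\<exists>f\<in>Arr C. Dom C f = X \<and> K = Ker C F f)"

text \<open>\<open>embedding_of C F X S \<iota>\<close>: \<open>\<iota>\<close> is an embedding of the conormal cluster \<open>S\<close> in the fibre
  over \<open>X\<close>.\<close>

definition embedding_of ::
  "('o, 'm) cat \<Rightarrow> ('o, 'm, 'u) form \<Rightarrow> 'o \<Rightarrow> 'u \<Rightarrow> 'm \<Rightarrow> bool" where
  "embedding_of C F X S \<iota> \<longleftrightarrow>
     conormal C F X S \<and> \<iota> \<in> Arr C \<and> Cod C \<iota> = X \<and> Im C F \<iota> = S \<and>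
     (\<forall>f\<in>Arr C. Cod C f = X \<and> Im C F f \<sqsubseteq>\<^bsub>fib F X\<^esub> S \<longrightarrow>
        (\<exists>!h. h \<in> Hom C (Dom C f) (Dom C \<iota>) \<and> f = \<iota> \<cdot>\<^bsub>C\<^esub> h))"

definition quotient_of ::
  "('o, 'm) cat \<Rightarrow> ('o, 'm, 'u) form \<Rightarrow> 'o \<Rightarrow> 'u \<Rightarrow> 'm \<Rightarrow> bool" where
  "quotient_of C F X K \<pi> \<longleftrightarrow>
     normal C F X K \<and> \<pi> \<in> Arr C \<and> Dom C \<pi> = X \<and> Ker C F \<pi> = K \<and>
     (\<forall>g\<in>Arr C. Dom C g = X \<and> K \<sqsubseteq>\<^bsub>fib F X\<^esub> Ker C F g \<longrightarrow>
        (\<exists>!h. h \<in> Hom C (Cod C \<pi>) (Cod C g) \<and> g = h \<cdot>\<^bsub>C\<^esub> \<pi>))"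

locale noetherian_form = orean_form C F
  for C :: "('o, 'm) cat" (structure) and F :: "('o, 'm, 'u) form" +
  assumes pull_push:
      "f \<in> Hom C X Y \<Longrightarrow> S \<in> carrier (fib F X) \<Longrightarrow>
       pull F f (push F f S) = S \<squnion>\<^bsub>fib F X\<^esub> Ker C F f"
    and push_pull:
      "f \<in> Hom C X Y \<Longrightarrow> T \<in> carrier (fib F Y) \<Longrightarrow>
       push F f (pull F f T) = T \<sqinter>\<^bsub>fib F Y\<^esub> Im C F f"
    and form_factorization:
      "f \<in> Hom C X Y \<Longrightarrow>
       \<exists>e m. quotient_of C F X (Ker C F f) e \<and> embedding_of C F Y (Im C F f) m \<and>
             Cod C e = Dom C m \<and> f = m \<cdot> e"
    and normal_join:
      "X \<in> Obj C \<Longrightarrow> normal C F X K \<Longrightarrow> normal C F X L \<Longrightarrow>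
       normal C F X (K \<squnion>\<^bsub>fib F X\<^esub> L)"
    and conormal_meet:
      "X \<in> Obj C \<Longrightarrow> conormal C F X S \<Longrightarrow> conormal C F X T \<Longrightarrow>
       conormal C F X (S \<sqinter>\<^bsub>fib F X\<^esub> T)"

definition form_quotients :: "('o, 'm) cat \<Rightarrow> ('o, 'm, 'u) form \<Rightarrow> 'm set" where
  "form_quotients C F = {\<pi>. \<exists>X\<in>Obj C. \<exists>K. quotient_of C F X K \<pi>}"

definition form_embeddings :: "('o, 'm) cat \<Rightarrow> ('o, 'm, 'u) form \<Rightarrow> 'm set" where
  "form_embeddings C F = {\<iota>. \<exists>X\<in>Obj C. \<exists>S. embedding_of C F X S \<iota>}"

definition induces ::
  "('o, 'm) cat \<Rightarrow> ('o, 'm, 'u) form \<Rightarrow> 'm set \<Rightarrow> 'm set \<Rightarrow> bool" where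
  "induces C F E M \<longleftrightarrow> form_quotients C F = E \<and> form_embeddings C F = M"

end

theory Submission
  imports Defs
begin

text \<open>
  A noetherian form yields the functor that sends an object to its fibre, seen as a discrete space,
  and a morphism \<open>f\<close> to \<open>push F f\<close>: quotients and embeddings identify the fibres of quotients and
  subobjects with the intervals above a kernel and below an image, so pushouts and pullbacks become
  joins of congruences \<open>S \<squnion> Ker e = S' \<squnion> Ker e\<close> and intersections of principal ideals.

  Conversely, consider a pointed set-valued presheaf \<open>H\<close> on a category with a factorization system that
  makes left-class morphisms injective and right-class morphisms surjective, turns pushouts of
  left-class morphisms into intersections of images and pullbacks of right-class morphisms into joins
  of kernels. Then the equivalence relations on \<open>H X\<close>, ordered by reverse inclusion, are the clusters
  over \<open>X\<close> of a noetherian form. On topological spaces the presheaf of pairs (open set, arbitrary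
  set) has all of these properties except the one for pullbacks of embeddings: open sets with the
  same trace on an intersection of subspaces need not be linked by open sets that agree on one of
  the subspaces. If the elements of the presheaf choose such data on every subspace separately, they
  can be altered off a subspace, which supplies the links. A transfer functor pulls the resulting
  presheaf back to the given category.
\<close>

text \<open>Condition (N1) is a fact about maps of sets: for any map, taking preimages of
  equivalence relations and generating a relation from an image are adjoint and satisfy it. The
  properties asked of the presheaf serve (N2), (N3) and the determination of the induced classes.
  Equivalence relations are used because they record both classes at once: the kernel relation of
  the action of a right-class morphism is its image cluster, and collapsing the image of the action
  of a left-class morphism gives its kernel cluster.

  What a presheaf pulled back from spaces detects is a factorization between spaces, and a transfer
  functor need not be full. Conservativity bridges this gap: \<open>e'\<close> factors through the
  epimorphism \<open>e\<close> exactly when the pushout of \<open>e\<close> along \<open>e'\<close>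
  is an isomorphism, and this survives the passage to spaces and back. Pullbacks do the same for
  monomorphisms. In the other direction discrete spaces are enough because every map out of them is
  continuous, so only maps between fibres have to be compared.\<close>

lemma (in lattice) join_eqI:
  assumes "x \<in> carrier L" "y \<in> carrier L" "j \<in> carrier L" "x \<sqsubseteq> j" "y \<sqsubseteq> j"
    "\<And>z. z \<in> carrier L \<Longrightarrow> x \<sqsubseteq> z \<Longrightarrow> y \<sqsubseteq> z \<Longrightarrow> j \<sqsubseteq> z"
  shows "x \<squnion> y = j"
  using assms by (simp add: le_antisym join_le join_left join_right)

lemma (in lattice) meet_eqI:
  assumes "x \<in> carrier L" "y \<in> carrier L" "j \<in> carrier L" "j \<sqsubseteq> x" "j \<sqsubseteq> y"
    "\<And>z. z \<in> carrier L \<Longrightarrow> z \<sqsubseteq> x \<Longrightarrow> z \<sqsubseteq> y \<Longrightarrow> z \<sqsubseteq> j"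
  shows "x \<sqinter> y = j"
  using assms by (simp add: le_antisym meet_le meet_left meet_right)

section \<open>Equivalence relations, their intersections and their generated joins\<close>

lemma equiv_subset: "equiv A r \<Longrightarrow> r \<subseteq> A \<times> A"
  by (simp add: equiv_def)

lemma equiv_reflD: "equiv A r \<Longrightarrow> x \<in> A \<Longrightarrow> (x, x) \<in> r"
  by (auto simp: equiv_def refl_on_def)

lemma equiv_symD: "equiv A r \<Longrightarrow> (x, y) \<in> r \<Longrightarrow> (y, x) \<in> r"
  by (auto simp: equiv_def dest: symD)

lemma equiv_transD: "equiv A r \<Longrightarrow> (x, y) \<in> r \<Longrightarrow> (y, z) \<in> r \<Longrightarrow> (x, z) \<in> r"
  by (meson equiv_def transD)

lemma equiv_Int: "equiv A r \<Longrightarrow> equiv A s \<Longrightarrow> equiv A (r \<inter> s)"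
  by (intro equivI) (auto simp: equiv_def refl_on_def intro: sym_Int trans_Int)

lemma equiv_full: "equiv A (A \<times> A)"
  by (intro equivI refl_onI symI transI) auto

lemma equiv_Id_on: "equiv A (Id_on A)"
  by (intro equivI refl_onI symI transI) auto

text \<open>Both relations contain the diagonal of \<open>A\<close> and are symmetric, so closing
  their union under transitivity already gives the join of equivalence relations.\<close>

lemma equiv_trancl_Un:
  assumes "equiv A r" "equiv A s" shows "equiv A ((r \<union> s)\<^sup>+)"
proof (rule equivI)
  show "(r \<union> s)\<^sup>+ \<subseteq> A \<times> A" using assms by (intro trancl_subset_Sigma) (auto simp: equiv_def)
  show "refl_on A ((r \<union> s)\<^sup>+)" using assms by (auto simp: equiv_def refl_on_def)
  show "sym ((r \<union> s)\<^sup>+)" using assms by (intro sym_trancl sym_Un) (auto simp: equiv_def)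
qed simp

lemma trancl_Un_least: "equiv A t \<Longrightarrow> r \<subseteq> t \<Longrightarrow> s \<subseteq> t \<Longrightarrow> (r \<union> s)\<^sup>+ \<subseteq> t"
  using trancl_mono[of _ "r \<union> s" t] by (auto simp: equiv_def trancl_id)

section \<open>Factorization systems\<close>

context category
begin

lemma arr_hom: "f \<in> Arr C \<Longrightarrow> f \<in> Hom C (Dom C f) (Cod C f)"
  by (simp add: Hom_def)

lemma hom_arr: "f \<in> Hom C X Y \<Longrightarrow> f \<in> Arr C"
  by (simp add: Hom_def)

lemma hom_dom: "f \<in> Hom C X Y \<Longrightarrow> Dom C f = X"
  by (simp add: Hom_def)

lemma hom_cod: "f \<in> Hom C X Y \<Longrightarrow> Cod C f = Y"
  by (simp add: Hom_def)

lemma hom_objs: "f \<in> Hom C X Y \<Longrightarrow> X \<in> Obj C" "f \<in> Hom C X Y \<Longrightarrow> Y \<in> Obj C"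
  using dom_obj cod_obj by (auto simp: Hom_def)

lemma is_isoI:
  "f \<in> Hom C X Y \<Longrightarrow> g \<in> Hom C Y X \<Longrightarrow> g \<cdot> f = Idn C X \<Longrightarrow> f \<cdot> g = Idn C Y \<Longrightarrow> is_iso C f"
  by (auto simp: is_iso_def Hom_def)

lemma is_isoE:
  assumes "is_iso C f" "f \<in> Hom C X Y"
  obtains g where "g \<in> Hom C Y X" "g \<cdot> f = Idn C X" "f \<cdot> g = Idn C Y"
  using assms by (auto simp: is_iso_def Hom_def)

lemma is_iso_cmp:
  assumes "is_iso C f" "is_iso C g" "f \<in> Hom C X Y" "g \<in> Hom C Y Z"
  shows "is_iso C (g \<cdot> f)"
proof -
  obtain f' where f': "f' \<in> Hom C Y X" "f' \<cdot> f = Idn C X" "f \<cdot> f' = Idn C Y"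
    using assms(1,3) by (rule is_isoE)
  obtain g' where g': "g' \<in> Hom C Z Y" "g' \<cdot> g = Idn C Y" "g \<cdot> g' = Idn C Z"
    using assms(2,4) by (rule is_isoE)
  show ?thesis
  proof (rule is_isoI)
    show "g \<cdot> f \<in> Hom C X Z" "f' \<cdot> g' \<in> Hom C Z X"
      using assms f' g' by (auto intro: cmp_hom)
    have "(f' \<cdot> g') \<cdot> (g \<cdot> f) = f' \<cdot> ((g' \<cdot> g) \<cdot> f)"
      using cmp_assoc[OF cmp_hom[OF assms(3,4)] g'(1) f'(1)] cmp_assoc[OF assms(3,4) g'(1)] by simp
    then show "(f' \<cdot> g') \<cdot> (g \<cdot> f) = Idn C X"
      using f' g' assms(3) by (simp add: idn_left)
    have "(g \<cdot> f) \<cdot> (f' \<cdot> g') = g \<cdot> ((f \<cdot> f') \<cdot> g')"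
      using cmp_assoc[OF cmp_hom[OF g'(1) f'(1)] assms(3,4)] cmp_assoc[OF g'(1) f'(1) assms(3)]
      by simp
    then show "(g \<cdot> f) \<cdot> (f' \<cdot> g') = Idn C Z"
      using f' g' by (simp add: idn_left)
  qed
qed

lemma monoD:
  "is_mono C m \<Longrightarrow> m \<in> Hom C X Y \<Longrightarrow> g \<in> Hom C W X \<Longrightarrow> h \<in> Hom C W X \<Longrightarrow> m \<cdot> g = m \<cdot> h \<Longrightarrow> g = h"
  using hom_objs hom_dom unfolding is_mono_def by metis

lemma epiD:
  "is_epi C e \<Longrightarrow> e \<in> Hom C X Y \<Longrightarrow> g \<in> Hom C Y Z \<Longrightarrow> h \<in> Hom C Y Z \<Longrightarrow> g \<cdot> e = h \<cdot> e \<Longrightarrow> g = h"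
  using hom_objs hom_cod unfolding is_epi_def by metis

lemma split_mono_epi_is_iso:
  assumes "is_mono C m" "m \<in> Hom C X Y" "h \<in> Hom C Y X" "m \<cdot> h = Idn C Y"
  shows "is_iso C m"
proof (rule is_isoI[OF assms(2,3) _ assms(4)])
  have "m \<cdot> (h \<cdot> m) = m \<cdot> Idn C X"
    using cmp_assoc[OF assms(2,3,2)] assms(4) idn_left[OF assms(2)] idn_right[OF assms(2)] by simp
  then show "h \<cdot> m = Idn C X"
    using assms monoD by (meson cmp_hom hom_objs(1) idn_hom)
qed

lemma split_epi_mono_is_iso:
  assumes "is_epi C e" "e \<in> Hom C X Y" "h \<in> Hom C Y X" "h \<cdot> e = Idn C X"
  shows "is_iso C e"
proof (rule is_isoI[OF assms(2,3,4)])
  have "(e \<cdot> h) \<cdot> e = Idn C Y \<cdot> e"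
    using cmp_assoc[OF assms(2,3,2)] assms(4) idn_left[OF assms(2)] idn_right[OF assms(2)] by simp
  then show "e \<cdot> h = Idn C Y"
    using assms epiD by (meson cmp_hom hom_objs(2) idn_hom)
qed

section \<open>Universal properties of pullbacks and pushouts, and when their legs are
  invertible\<close>

lemma is_pullbackE:
  assumes "is_pullback C f g p q" "f \<in> Hom C A Z" "g \<in> Hom C B Z"
  obtains P where "P \<in> Obj C" "p \<in> Hom C P A" "q \<in> Hom C P B" "f \<cdot> p = g \<cdot> q"
    "\<And>W a b. a \<in> Hom C W A \<Longrightarrow> b \<in> Hom C W B \<Longrightarrow> f \<cdot> a = g \<cdot> b \<Longrightarrow>
       \<exists>!h. h \<in> Hom C W P \<and> p \<cdot> h = a \<and> q \<cdot> h = b"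
proof -
  from assms obtain P where P: "P \<in> Obj C" "p \<in> Hom C P A" "q \<in> Hom C P B" "f \<cdot> p = g \<cdot> q"
    and univ: "\<forall>W\<in>Obj C. \<forall>a\<in>Hom C W A. \<forall>b\<in>Hom C W B. f \<cdot> a = g \<cdot> b \<longrightarrow>
       (\<exists>!h. h \<in> Hom C W P \<and> p \<cdot> h = a \<and> q \<cdot> h = b)"
    unfolding is_pullback_def hom_dom[OF assms(2)] hom_dom[OF assms(3)] by blast
  show ?thesis by (rule that[OF P]) (use univ hom_objs(1) in blast)
qed

lemma is_pushoutE:
  assumes "is_pushout C f g i j" "f \<in> Hom C Z A" "g \<in> Hom C Z B"
  obtains P where "P \<in> Obj C" "i \<in> Hom C A P" "j \<in> Hom C B P" "i \<cdot> f = j \<cdot> g"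
    "\<And>W a b. a \<in> Hom C A W \<Longrightarrow> b \<in> Hom C B W \<Longrightarrow> a \<cdot> f = b \<cdot> g \<Longrightarrow>
       \<exists>!h. h \<in> Hom C P W \<and> h \<cdot> i = a \<and> h \<cdot> j = b"
proof -
  from assms obtain P where P: "P \<in> Obj C" "i \<in> Hom C A P" "j \<in> Hom C B P" "i \<cdot> f = j \<cdot> g"
    and univ: "\<forall>W\<in>Obj C. \<forall>a\<in>Hom C A W. \<forall>b\<in>Hom C B W. a \<cdot> f = b \<cdot> g \<longrightarrow>
       (\<exists>!h. h \<in> Hom C P W \<and> h \<cdot> i = a \<and> h \<cdot> j = b)"
    unfolding is_pushout_def hom_cod[OF assms(2)] hom_cod[OF assms(3)] by blast
  show ?thesis by (rule that[OF P]) (use univ hom_objs(2) in blast)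
qed

lemma is_pullbackI:
  assumes "f \<in> Hom C A Z" "g \<in> Hom C B Z" "p \<in> Hom C P A" "q \<in> Hom C P B" "f \<cdot> p = g \<cdot> q"
    "\<And>W a b. a \<in> Hom C W A \<Longrightarrow> b \<in> Hom C W B \<Longrightarrow> f \<cdot> a = g \<cdot> b \<Longrightarrow>
       \<exists>!h. h \<in> Hom C W P \<and> p \<cdot> h = a \<and> q \<cdot> h = b"
  shows "is_pullback C f g p q"
  unfolding is_pullback_def hom_dom[OF assms(1)] hom_dom[OF assms(2)] hom_cod[OF assms(1)] hom_cod[OF assms(2)]
  using assms(6) by (intro conjI bexI[of _ P] ballI impI assms hom_arr[OF assms(1)] hom_arr[OF assms(2)]
      hom_objs(1)[OF assms(3)] refl)

lemma is_pushoutI: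
  assumes "f \<in> Hom C Z A" "g \<in> Hom C Z B" "i \<in> Hom C A P" "j \<in> Hom C B P" "i \<cdot> f = j \<cdot> g"
    "\<And>W a b. a \<in> Hom C A W \<Longrightarrow> b \<in> Hom C B W \<Longrightarrow> a \<cdot> f = b \<cdot> g \<Longrightarrow>
       \<exists>!h. h \<in> Hom C P W \<and> h \<cdot> i = a \<and> h \<cdot> j = b"
  shows "is_pushout C f g i j"
  unfolding is_pushout_def hom_dom[OF assms(1)] hom_dom[OF assms(2)] hom_cod[OF assms(1)] hom_cod[OF assms(2)]
  using assms(6) by (intro conjI bexI[of _ P] ballI impI assms hom_arr[OF assms(1)] hom_arr[OF assms(2)]
      hom_objs(2)[OF assms(3)] refl)

text \<open>The pair of \<open>d\<close> and the identity of \<open>B\<close> is a cone, and its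
  mediating arrow inverts \<open>q\<close>. This translates a factorization into an isomorphism,
  which is what a conservative functor can reflect.\<close>

lemma is_pullback_iso:
  assumes pb: "is_pullback C f g p q" and f: "f \<in> Hom C A Z" and g: "g \<in> Hom C B Z"
    and mono: "is_mono C f" and d: "d \<in> Hom C B A" "g = f \<cdot> d"
  shows "is_iso C q"
proof -
  from pb f g obtain P where P: "P \<in> Obj C" "p \<in> Hom C P A" "q \<in> Hom C P B" "f \<cdot> p = g \<cdot> q"
    and univ: "\<And>W a b. a \<in> Hom C W A \<Longrightarrow> b \<in> Hom C W B \<Longrightarrow> f \<cdot> a = g \<cdot> b \<Longrightarrow>
       \<exists>!h. h \<in> Hom C W P \<and> p \<cdot> h = a \<and> q \<cdot> h = b"
    by (rule is_pullbackE) blast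
  have idB: "Idn C B \<in> Hom C B B" using g hom_objs idn_hom by blast
  have "f \<cdot> d = g \<cdot> Idn C B" using d g by (simp add: idn_right)
  then obtain h where h: "h \<in> Hom C B P" "p \<cdot> h = d" "q \<cdot> h = Idn C B"
    using univ[OF d(1) idB] by blast
  have "f \<cdot> (d \<cdot> q) = f \<cdot> p" using cmp_assoc[OF P(3) d(1) f] d(2) P(4) by simp
  then have dq: "d \<cdot> q = p" using monoD[OF mono f] P d(1) cmp_hom by meson
  have idP: "Idn C P \<in> Hom C P P" using P idn_hom by blast
  have "h \<cdot> q = Idn C P"
  proof -
    have 1: "h \<cdot> q \<in> Hom C P P" using h P cmp_hom by blast
    have 2: "p \<cdot> (h \<cdot> q) = p" using cmp_assoc[OF P(3) h(1) P(2)] h dq by simp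
    have 3: "q \<cdot> (h \<cdot> q) = q" using cmp_assoc[OF P(3) h(1) P(3)] h idn_left[OF P(3)] by simp
    show ?thesis
      using univ[OF P(2,3,4)] 1 2 3 idP idn_right[OF P(2)] idn_right[OF P(3)] by blast
  qed
  then show ?thesis using is_isoI[OF P(3) h(1)] h by blast
qed

text \<open>Dual to \<open>is_pullback_iso\<close>: the cocone of \<open>d\<close> and the identity
  of \<open>B\<close> induces the inverse of \<open>j\<close>.\<close>

lemma is_pushout_iso:
  assumes po: "is_pushout C f g i j" and f: "f \<in> Hom C Z A" and g: "g \<in> Hom C Z B"
    and epi: "is_epi C f" and d: "d \<in> Hom C A B" "g = d \<cdot> f"
  shows "is_iso C j"
proof -
  from po f g obtain P where P: "P \<in> Obj C" "i \<in> Hom C A P" "j \<in> Hom C B P" "i \<cdot> f = j \<cdot> g"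
    and univ: "\<And>W a b. a \<in> Hom C A W \<Longrightarrow> b \<in> Hom C B W \<Longrightarrow> a \<cdot> f = b \<cdot> g \<Longrightarrow>
       \<exists>!h. h \<in> Hom C P W \<and> h \<cdot> i = a \<and> h \<cdot> j = b"
    by (rule is_pushoutE) blast
  have idB: "Idn C B \<in> Hom C B B" using g hom_objs idn_hom by blast
  have "d \<cdot> f = Idn C B \<cdot> g" using d g by (simp add: idn_left)
  then obtain h where h: "h \<in> Hom C P B" "h \<cdot> i = d" "h \<cdot> j = Idn C B"
    using univ[OF d(1) idB] by blast
  have "(j \<cdot> d) \<cdot> f = i \<cdot> f" using cmp_assoc[OF f d(1) P(3)] d(2) P(4) by simp
  then have jd: "j \<cdot> d = i" using epiD[OF epi f] P d(1) cmp_hom by meson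
  have idP: "Idn C P \<in> Hom C P P" using P idn_hom by blast
  have "j \<cdot> h = Idn C P"
  proof -
    have 1: "j \<cdot> h \<in> Hom C P P" using h P cmp_hom by blast
    have 2: "(j \<cdot> h) \<cdot> i = i" using cmp_assoc[OF P(2) h(1) P(3)] h jd by simp
    have 3: "(j \<cdot> h) \<cdot> j = j" using cmp_assoc[OF P(3) h(1) P(3)] h idn_right[OF P(3)] by simp
    show ?thesis
      using univ[OF P(2,3,4)] 1 2 3 idP idn_left[OF P(2)] idn_left[OF P(3)] by blast
  qed
  then show ?thesis using is_isoI[OF P(3) h(1)] h by blast
qed

end

section \<open>Proper factorization systems: stability under pullback and pushout\<close>

context proper_factorization_system
begin

lemma factorizationE:
  assumes "f \<in> Hom C X Y"
  obtains Q e m where "e \<in> E" "m \<in> M" "e \<in> Hom C X Q" "m \<in> Hom C Q Y" "f = m \<cdot> e"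
proof -
  obtain e m where em: "e \<in> E" "m \<in> M" "Cod C e = Dom C m" "f = m \<cdot> e"
    using factorization hom_arr[OF assms] by blast
  have e: "e \<in> Hom C (Dom C e) (Dom C m)" using em E_arr arr_hom by (metis subsetD)
  have m: "m \<in> Hom C (Dom C m) (Cod C m)" using em M_arr arr_hom by blast
  have "f \<in> Hom C (Dom C e) (Cod C m)" using e m em cmp_hom by blast
  then have "Dom C e = X" "Cod C m = Y" using assms by (auto simp: Hom_def)
  with e m em that show ?thesis by blast
qed

lemma E_hom: "e \<in> E \<Longrightarrow> e \<in> Hom C (Dom C e) (Cod C e)"
  using E_arr arr_hom by blast

lemma M_hom: "m \<in> M \<Longrightarrow> m \<in> Hom C (Dom C m) (Cod C m)"
  using M_arr arr_hom by blast

lemma orthogonalE: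
  assumes "e \<in> E" "m \<in> M" "e \<in> Hom C W X" "m \<in> Hom C Y Z" "u \<in> Hom C W Y" "v \<in> Hom C X Z"
    "m \<cdot> u = v \<cdot> e"
  obtains d where "d \<in> Hom C X Y" "d \<cdot> e = u" "m \<cdot> d = v"
  using orthogonality[of e m u v] assms by (auto simp: Hom_def)

lemma E_cmp_hom: "f \<in> E \<Longrightarrow> g \<in> E \<Longrightarrow> f \<in> Hom C X Y \<Longrightarrow> g \<in> Hom C Y Z \<Longrightarrow> g \<cdot> f \<in> E"
  using cmp_E by (simp add: Hom_def)

lemma M_cmp_hom: "f \<in> M \<Longrightarrow> g \<in> M \<Longrightarrow> f \<in> Hom C X Y \<Longrightarrow> g \<in> Hom C Y Z \<Longrightarrow> g \<cdot> f \<in> M"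
  using cmp_M by (simp add: Hom_def)

text \<open>Factor \<open>p = m \<cdot> e\<close>. Orthogonality of \<open>e\<close> against
  \<open>g\<close> extends \<open>q\<close> along \<open>e\<close>, so \<open>m\<close> becomes one
  side of a cone on the middle object. Its mediating arrow is a left inverse of the epimorphism
  \<open>e\<close>, which is therefore an isomorphism.\<close>

lemma pullback_M:
  assumes pb: "is_pullback C f g p q" and g: "g \<in> M"
  shows "p \<in> M"
proof -
  have fh: "f \<in> Hom C (Dom C f) (Cod C f)" and gh: "g \<in> Hom C (Dom C g) (Cod C f)"
    using pb by (auto simp: is_pullback_def Hom_def)
  from pb fh gh obtain P where P: "P \<in> Obj C" "p \<in> Hom C P (Dom C f)" "q \<in> Hom C P (Dom C g)"
      "f \<cdot> p = g \<cdot> q"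
    and univ: "\<And>W a b. a \<in> Hom C W (Dom C f) \<Longrightarrow> b \<in> Hom C W (Dom C g) \<Longrightarrow> f \<cdot> a = g \<cdot> b \<Longrightarrow>
       \<exists>!h. h \<in> Hom C W P \<and> p \<cdot> h = a \<and> q \<cdot> h = b"
    by (rule is_pullbackE) blast
  obtain Q e m where em: "e \<in> E" "m \<in> M" "e \<in> Hom C P Q" "m \<in> Hom C Q (Dom C f)" "p = m \<cdot> e"
    using P(2) by (rule factorizationE)
  have fm: "f \<cdot> m \<in> Hom C Q (Cod C f)" using em fh cmp_hom by blast
  have "g \<cdot> q = (f \<cdot> m) \<cdot> e" using P(4) em(5) cmp_assoc[OF em(3,4) fh] by simp
  then obtain d where d: "d \<in> Hom C Q (Dom C g)" "d \<cdot> e = q" "g \<cdot> d = f \<cdot> m"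
    using orthogonalE[OF em(1) g em(3) gh P(3) fm] by blast
  then obtain h where h: "h \<in> Hom C Q P" "p \<cdot> h = m" "q \<cdot> h = d"
    using univ[OF em(4) d(1)] by metis
  have "h \<cdot> e = Idn C P"
  proof -
    have 1: "h \<cdot> e \<in> Hom C P P" using h em cmp_hom by blast
    have 2: "p \<cdot> (h \<cdot> e) = p" using cmp_assoc[OF em(3) h(1) P(2)] h em by simp
    have 3: "q \<cdot> (h \<cdot> e) = q" using cmp_assoc[OF em(3) h(1) P(3)] h d by simp
    show ?thesis
      using univ[OF P(2,3,4)] 1 2 3 idn_hom[OF P(1)] idn_right[OF P(2)] idn_right[OF P(3)] by blast
  qed
  then have "is_iso C e" using split_epi_mono_is_iso[OF E_epi] em h by blast
  then show ?thesis using iso_M M_cmp_hom em by metis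
qed

text \<open>Dual to \<open>pullback_M\<close>: orthogonality of \<open>g\<close> against the right
  factor \<open>m\<close> of \<open>i\<close> produces a cocone whose mediating arrow is a right
  inverse of \<open>m\<close>.\<close>

lemma pushout_E:
  assumes po: "is_pushout C f g i j" and g: "g \<in> E"
  shows "i \<in> E"
proof -
  have fh: "f \<in> Hom C (Dom C f) (Cod C f)" and gh: "g \<in> Hom C (Dom C f) (Cod C g)"
    using po by (auto simp: is_pushout_def Hom_def)
  from po fh gh obtain P where P: "P \<in> Obj C" "i \<in> Hom C (Cod C f) P" "j \<in> Hom C (Cod C g) P"
      "i \<cdot> f = j \<cdot> g"
    and univ: "\<And>W a b. a \<in> Hom C (Cod C f) W \<Longrightarrow> b \<in> Hom C (Cod C g) W \<Longrightarrow> a \<cdot> f = b \<cdot> g \<Longrightarrow>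
       \<exists>!h. h \<in> Hom C P W \<and> h \<cdot> i = a \<and> h \<cdot> j = b"
    by (rule is_pushoutE) blast
  obtain Q e m where em: "e \<in> E" "m \<in> M" "e \<in> Hom C (Cod C f) Q" "m \<in> Hom C Q P" "i = m \<cdot> e"
    using P(2) by (rule factorizationE)
  have ef: "e \<cdot> f \<in> Hom C (Dom C f) Q" using em fh cmp_hom by blast
  have "m \<cdot> (e \<cdot> f) = j \<cdot> g" using P(4) em(5) cmp_assoc[OF fh em(3,4)] by simp
  then obtain d where d: "d \<in> Hom C (Cod C g) Q" "d \<cdot> g = e \<cdot> f" "m \<cdot> d = j"
    using orthogonalE[OF g em(2) gh em(4) ef P(3)] by blast
  then obtain h where h: "h \<in> Hom C P Q" "h \<cdot> i = e" "h \<cdot> j = d"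
    using univ[OF em(3) d(1)] by metis
  have "m \<cdot> h = Idn C P"
  proof -
    have 1: "m \<cdot> h \<in> Hom C P P" using h em cmp_hom by blast
    have 2: "(m \<cdot> h) \<cdot> i = i" using cmp_assoc[OF P(2) h(1) em(4)] h em by simp
    have 3: "(m \<cdot> h) \<cdot> j = j" using cmp_assoc[OF P(3) h(1) em(4)] h d by simp
    show ?thesis
      using univ[OF P(2,3,4)] 1 2 3 idn_hom[OF P(1)] idn_left[OF P(2)] idn_left[OF P(3)] by blast
  qed
  then have "is_iso C m" using split_mono_epi_is_iso[OF M_mono] em h by blast
  then show ?thesis using iso_E E_cmp_hom em by metis
qed

end

section \<open>Noetherian forms from presheaves\<close>

text \<open>
  The base point \<open>b\<close> makes the image of \<open>R f\<close> recoverable from the equivalence relation that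
  collapses it; \<open>code X\<close> encodes the equivalence relations on \<open>H X\<close> as clusters.
\<close>

locale detecting_presheaf = pfs_category C E M
  for C :: "('o, 'm) cat" (structure) and E M +
  fixes H :: "'o \<Rightarrow> 'h set" and R :: "'m \<Rightarrow> 'h \<Rightarrow> 'h" and b :: 'h
    and code :: "'o \<Rightarrow> ('h \<times> 'h) set \<Rightarrow> 'u"
  assumes R_closed: "f \<in> Hom C X Y \<Longrightarrow> x \<in> H Y \<Longrightarrow> R f x \<in> H X"
    and R_idn: "X \<in> Obj C \<Longrightarrow> x \<in> H X \<Longrightarrow> R (Idn C X) x = x"
    and R_cmp: "f \<in> Hom C X Y \<Longrightarrow> g \<in> Hom C Y Z \<Longrightarrow> x \<in> H Z \<Longrightarrow> R (g \<cdot> f) x = R f (R g x)"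
    and base_closed: "X \<in> Obj C \<Longrightarrow> b \<in> H X"
    and R_base: "f \<in> Hom C X Y \<Longrightarrow> R f b = b"
    and R_E: "e \<in> E \<Longrightarrow> inj_on (R e) (H (Cod C e))"
    and R_M: "m \<in> M \<Longrightarrow> H (Dom C m) \<subseteq> R m ` H (Cod C m)"
    and R_pushout:
      "e \<in> E \<Longrightarrow> e' \<in> E \<Longrightarrow> is_pushout C e e' i j \<Longrightarrow>
       R e ` H (Cod C e) \<inter> R e' ` H (Cod C e') \<subseteq> R (i \<cdot> e) ` H (Cod C i)"
    and R_pullback:
      "m \<in> M \<Longrightarrow> m' \<in> M \<Longrightarrow> is_pullback C m m' p q \<Longrightarrow> x \<in> H (Cod C m) \<Longrightarrow> y \<in> H (Cod C m) \<Longrightarrow>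
       R (m \<cdot> p) x = R (m \<cdot> p) y \<Longrightarrow>
       \<exists>z\<in>H (Cod C m). \<exists>w\<in>H (Cod C m). R m x = R m z \<and> R m' z = R m' w \<and> R m w = R m y"
    and detect_E:
      "e \<in> E \<Longrightarrow> e' \<in> E \<Longrightarrow> Dom C e = Dom C e' \<Longrightarrow> R e' ` H (Cod C e') \<subseteq> R e ` H (Cod C e) \<Longrightarrow>
       \<exists>d\<in>Hom C (Cod C e) (Cod C e'). e' = d \<cdot> e"
    and detect_M:
      "m \<in> M \<Longrightarrow> m' \<in> M \<Longrightarrow> Cod C m = Cod C m' \<Longrightarrow>
       (\<And>x y. x \<in> H (Cod C m) \<Longrightarrow> y \<in> H (Cod C m) \<Longrightarrow> R m x = R m y \<Longrightarrow> R m' x = R m' y) \<Longrightarrow>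
       \<exists>d\<in>Hom C (Dom C m') (Dom C m). m' = m \<cdot> d"
    and code_inj: "X \<in> Obj C \<Longrightarrow> inj_on (code X) {r. equiv (H X) r}"
    and code_small: "X \<in> Obj C \<Longrightarrow> small TYPE('u) (code X ` {r. equiv (H X) r})"
begin

abbreviation Eqv :: "'o \<Rightarrow> ('h \<times> 'h) set set" where
  "Eqv X \<equiv> {r. equiv (H X) r}"

definition dec :: "'o \<Rightarrow> 'u \<Rightarrow> ('h \<times> 'h) set" where
  "dec X = inv_into (Eqv X) (code X)"

definition pre_rel :: "'m \<Rightarrow> ('h \<times> 'h) set \<Rightarrow> ('h \<times> 'h) set" where
  "pre_rel f r = {(x, y) \<in> H (Cod C f) \<times> H (Cod C f). (R f x, R f y) \<in> r}"

text \<open>The equivalence relation generated by the image of \<open>r\<close>: for an equivalence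
  relation \<open>r\<close> the image is symmetric and the diagonal is added, so only transitivity
  has to be enforced.\<close>

definition gen_rel :: "'m \<Rightarrow> ('h \<times> 'h) set \<Rightarrow> ('h \<times> 'h) set" where
  "gen_rel f r = (Id_on (H (Dom C f)) \<union> map_prod (R f) (R f) ` r)\<^sup>+"

text \<open>Preimage is the right adjoint of generation for inclusion. Reversing the order makes it
  the left adjoint, as \<open>push\<close> has to be.\<close>

definition eqf :: "('o, 'm, 'u) form" where
  "eqf =
    \<lparr> fib = (\<lambda>X. \<lparr> carrier = code X ` Eqv X, eq = (=), le = (\<lambda>s t. dec X t \<subseteq> dec X s) \<rparr>),
      push = (\<lambda>f s. code (Cod C f) (pre_rel f (dec (Dom C f) s))),
      pull = (\<lambda>f t. code (Dom C f) (gen_rel f (dec (Cod C f) t))) \<rparr>"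

abbreviation L :: "'o \<Rightarrow> 'u gorder" where
  "L X \<equiv> fib eqf X"

lemma dec_code: "X \<in> Obj C \<Longrightarrow> equiv (H X) r \<Longrightarrow> dec X (code X r) = r"
  unfolding dec_def using code_inj by simp

lemma carrier_L: "carrier (L X) = code X ` Eqv X"
  by (simp add: eqf_def)

lemma eq_L: "(.=\<^bsub>L X\<^esub>) = (=)"
  by (simp add: eqf_def)

lemma le_L:
  "X \<in> Obj C \<Longrightarrow> equiv (H X) r \<Longrightarrow> equiv (H X) r' \<Longrightarrow> code X r \<sqsubseteq>\<^bsub>L X\<^esub> code X r' \<longleftrightarrow> r' \<subseteq> r"
  by (simp add: eqf_def dec_code)

lemma push_L:
  "f \<in> Hom C X Y \<Longrightarrow> equiv (H X) r \<Longrightarrow> push eqf f (code X r) = code Y (pre_rel f r)"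
  using hom_objs by (auto simp: eqf_def dec_code hom_dom hom_cod)

lemma pull_L:
  "f \<in> Hom C X Y \<Longrightarrow> equiv (H Y) r \<Longrightarrow> pull eqf f (code Y r) = code X (gen_rel f r)"
  using hom_objs by (auto simp: eqf_def dec_code hom_dom hom_cod)

lemma pre_rel_equiv: "f \<in> Hom C X Y \<Longrightarrow> equiv (H X) r \<Longrightarrow> equiv (H Y) (pre_rel f r)"
  by (intro equivI refl_onI symI transI)
     (auto simp: pre_rel_def hom_cod R_closed
       intro: equiv_reflD dest: equiv_symD intro: equiv_transD)

lemma gen_rel_equiv:
  assumes f: "f \<in> Hom C X Y" and r: "equiv (H Y) r"
  shows "equiv (H X) (gen_rel f r)"
proof (rule equivI)
  have "map_prod (R f) (R f) ` r \<subseteq> H X \<times> H X"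
    using R_closed[OF f] equiv_subset[OF r] by auto
  then show "gen_rel f r \<subseteq> H X \<times> H X"
    unfolding gen_rel_def hom_dom[OF f] by (intro trancl_subset_Sigma) auto
  show "refl_on (H X) (gen_rel f r)" by (auto simp: gen_rel_def hom_dom[OF f] refl_on_def)
  have "sym (map_prod (R f) (R f) ` r)" using equiv_symD[OF r] by (auto intro!: symI)
  then show "sym (gen_rel f r)" unfolding gen_rel_def by (intro sym_trancl sym_Un) (auto simp: sym_Id_on)
qed (simp add: gen_rel_def)

lemma gen_rel_mono: "r \<subseteq> s \<Longrightarrow> gen_rel f r \<subseteq> gen_rel f s"
  unfolding gen_rel_def by (intro trancl_mono_subset) auto

text \<open>This is the adjunction of \<open>push\<close> and \<open>pull\<close> in terms of
  relations. The functoriality of \<open>pull\<close> is deduced from it rather than computed with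
  transitive closures.\<close>

lemma gen_rel_least:
  assumes f: "f \<in> Hom C X Y" and "equiv (H X) s" "equiv (H Y) r"
  shows "gen_rel f r \<subseteq> s \<longleftrightarrow> r \<subseteq> pre_rel f s"
proof
  assume "gen_rel f r \<subseteq> s"
  then have "map_prod (R f) (R f) ` r \<subseteq> s" unfolding gen_rel_def by auto
  then show "r \<subseteq> pre_rel f s"
    using equiv_subset[OF assms(3)] by (auto simp: pre_rel_def hom_cod[OF f])
next
  assume "r \<subseteq> pre_rel f s"
  then have "map_prod (R f) (R f) ` r \<subseteq> s" by (auto simp: pre_rel_def)
  moreover have "Id_on (H X) \<subseteq> s" using assms(2) by (auto simp: equiv_def refl_on_def)
  ultimately show "gen_rel f r \<subseteq> s"
    unfolding gen_rel_def hom_dom[OF f] by (intro trancl_Un_least[OF assms(2)])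
qed

text \<open>Under the reversed order intersections are joins and generated relations are meets; the
  full relation is the bottom and the diagonal is the top.\<close>

lemma bounded_lattice_L:
  assumes X: "X \<in> Obj C"
  shows "bounded_lattice (L X)"
proof -
  have po: "partial_order (L X)"
    by unfold_locales (auto simp: eq_L carrier_L le_L[OF X] elem_def set_eq_def)
  interpret partial_order "L X" by (rule po)
  show ?thesis
  proof unfold_locales
    fix s t assume "s \<in> carrier (L X)" "t \<in> carrier (L X)"
    then obtain p q where pq: "equiv (H X) p" "equiv (H X) q" "s = code X p" "t = code X q"
      by (auto simp: carrier_L)
    have "least (L X) (code X (p \<inter> q)) (Upper (L X) {s, t})"
      using pq equiv_Int[OF pq(1,2)] by (auto simp: least_def Upper_def carrier_L le_L[OF X])
    then show "\<exists>u. least (L X) u (Upper (L X) {s, t})" by blast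
    have "greatest (L X) (code X ((p \<union> q)\<^sup>+)) (Lower (L X) {s, t})"
      using pq equiv_trancl_Un[OF pq(1,2)] trancl_Un_least[of "H X" _ p q]
      by (auto simp: greatest_def Lower_def carrier_L le_L[OF X])
    then show "\<exists>u. greatest (L X) u (Lower (L X) {s, t})" by blast
  next
    have "least (L X) (code X (H X \<times> H X)) (carrier (L X))"
      using equiv_full[of "H X"]
      by (auto simp: least_def carrier_L le_L[OF X] dest: equiv_subset[THEN subsetD])
    then show "\<exists>x. least (L X) x (carrier (L X))" by blast
    have "greatest (L X) (code X (Id_on (H X))) (carrier (L X))"
      using equiv_Id_on[of "H X"]
      by (auto simp: greatest_def carrier_L le_L[OF X] intro: equiv_reflD)
    then show "\<exists>x. greatest (L X) x (carrier (L X))" by blast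
  qed
qed

lemma join_L:
  assumes X: "X \<in> Obj C" and pq: "equiv (H X) p" "equiv (H X) q"
  shows "code X p \<squnion>\<^bsub>L X\<^esub> code X q = code X (p \<inter> q)"
proof -
  interpret bounded_lattice "L X" by (rule bounded_lattice_L[OF X])
  show ?thesis
    using pq equiv_Int[OF pq] by (intro join_eqI) (auto simp: carrier_L le_L[OF X])
qed

lemma meet_L:
  assumes X: "X \<in> Obj C" and pq: "equiv (H X) p" "equiv (H X) q"
  shows "code X p \<sqinter>\<^bsub>L X\<^esub> code X q = code X ((p \<union> q)\<^sup>+)"
proof -
  interpret bounded_lattice "L X" by (rule bounded_lattice_L[OF X])
  show ?thesis
    using pq equiv_trancl_Un[OF pq] trancl_Un_least[of "H X" _ p q]
    by (intro meet_eqI) (auto simp: carrier_L le_L[OF X])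
qed

lemma bottom_L:
  assumes X: "X \<in> Obj C" shows "\<bottom>\<^bsub>L X\<^esub> = code X (H X \<times> H X)"
proof -
  interpret bounded_lattice "L X" by (rule bounded_lattice_L[OF X])
  show ?thesis
    using equiv_full[of "H X"] by (intro bottom_eq[symmetric]) (auto simp: carrier_L le_L[OF X] dest: equiv_subset[THEN subsetD])
qed

lemma top_L:
  assumes X: "X \<in> Obj C" shows "\<top>\<^bsub>L X\<^esub> = code X (Id_on (H X))"
proof -
  interpret bounded_lattice "L X" by (rule bounded_lattice_L[OF X])
  show ?thesis
    using equiv_Id_on[of "H X"]
    by (intro top_eq[symmetric]) (auto simp: carrier_L le_L[OF X] intro: equiv_reflD)
qed

text \<open>The names refer to the map \<open>R f\<close>. Contravariance swaps the roles in the
  form: \<open>ker_rel f\<close> is the cluster \<open>Im f\<close>, and \<open>im_rel f\<close> is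
  the cluster \<open>Ker f\<close>.\<close>

definition ker_rel :: "'m \<Rightarrow> ('h \<times> 'h) set" where
  "ker_rel f = {(x, y) \<in> H (Cod C f) \<times> H (Cod C f). R f x = R f y}"

definition im_rel :: "'m \<Rightarrow> ('h \<times> 'h) set" where
  "im_rel f = Id_on (H (Dom C f)) \<union> R f ` H (Cod C f) \<times> R f ` H (Cod C f)"

lemma ker_rel_equiv: "f \<in> Hom C X Y \<Longrightarrow> equiv (H Y) (ker_rel f)"
  by (intro equivI refl_onI symI transI) (auto simp: ker_rel_def hom_cod)

lemma im_rel_equiv: "f \<in> Hom C X Y \<Longrightarrow> equiv (H X) (im_rel f)"
  by (intro equivI refl_onI symI transI) (auto simp: im_rel_def hom_cod hom_dom R_closed)

lemma Im_eqv:
  assumes f: "f \<in> Hom C X Y" shows "Im C eqf f = code Y (ker_rel f)"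
proof -
  have "pre_rel f (Id_on (H X)) = ker_rel f"
    using R_closed[OF f] by (auto simp: pre_rel_def ker_rel_def hom_cod[OF f])
  then show ?thesis
    using hom_objs[OF f] by (simp add: Im_def hom_dom[OF f] top_L push_L[OF f] equiv_Id_on)
qed

lemma gen_rel_eq:
  assumes f: "f \<in> Hom C X Y" and t: "trans (Id_on (H X) \<union> map_prod (R f) (R f) ` r)"
  shows "gen_rel f r = Id_on (H X) \<union> map_prod (R f) (R f) ` r"
  unfolding gen_rel_def hom_dom[OF f] by (rule trancl_id[OF t])

lemma Ker_eqv:
  assumes f: "f \<in> Hom C X Y" shows "Ker C eqf f = code X (im_rel f)"
proof -
  have eq: "Id_on (H X) \<union> map_prod (R f) (R f) ` (H Y \<times> H Y) = im_rel f"
    by (auto simp: im_rel_def hom_cod[OF f] hom_dom[OF f])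
  have "gen_rel f (H Y \<times> H Y) = im_rel f"
    using im_rel_equiv[OF f] gen_rel_eq[OF f, of "H Y \<times> H Y"] unfolding eq by (simp add: equiv_def)
  then show ?thesis
    using hom_objs[OF f] by (simp add: Ker_def hom_cod[OF f] bottom_L pull_L[OF f] equiv_full)
qed

text \<open>One half of (N1). The pairs of \<open>r\<close> with both entries in the image of
  \<open>R f\<close>, together with the diagonal, are an intersection of two equivalence relations,
  so the transitive closure in \<open>gen_rel\<close> adds nothing.\<close>

lemma pull_push_L:
  assumes f: "f \<in> Hom C X Y" and r: "equiv (H X) r"
  shows "gen_rel f (pre_rel f r) = r \<inter> im_rel f"
proof -
  have eq: "Id_on (H X) \<union> map_prod (R f) (R f) ` pre_rel f r = r \<inter> im_rel f"
  proof
    show "Id_on (H X) \<union> map_prod (R f) (R f) ` pre_rel f r \<subseteq> r \<inter> im_rel f"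
      using equiv_reflD[OF r] by (auto simp: im_rel_def pre_rel_def hom_cod[OF f] hom_dom[OF f])
    show "r \<inter> im_rel f \<subseteq> Id_on (H X) \<union> map_prod (R f) (R f) ` pre_rel f r"
      by (force simp: im_rel_def pre_rel_def hom_cod[OF f] hom_dom[OF f])
  qed
  have "trans (r \<inter> im_rel f)"
    using equiv_Int[OF r im_rel_equiv[OF f]] by (simp add: equiv_def)
  then show ?thesis using gen_rel_eq[OF f] eq by metis
qed

text \<open>The other half of (N1). A relation that contains the kernel of \<open>R f\<close> can be
  carried along \<open>R f\<close> and pulled back again without growing.\<close>

lemma push_pull_L:
  assumes f: "f \<in> Hom C X Y" and r: "equiv (H Y) r"
  shows "pre_rel f (gen_rel f r) = (r \<union> ker_rel f)\<^sup>+"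
proof
  let ?J = "(r \<union> ker_rel f)\<^sup>+"
  define J where "J = ?J"
  have J: "equiv (H Y) J" unfolding J_def by (rule equiv_trancl_Un[OF r ker_rel_equiv[OF f]])
  have ker: "ker_rel f \<subseteq> J" "r \<subseteq> J" unfolding J_def by auto
  \<comment> \<open>The image of \<open>J\<close> along \<open>R f\<close> with the diagonal added.
    It is transitive because \<open>J\<close> contains the kernel of \<open>R f\<close>: if the
    images of two pairs of \<open>J\<close> share a middle term, a kernel pair links the two middle
    elements.\<close>
  define s where "s = Id_on (H X) \<union> {(R f x, R f y) | x y. (x, y) \<in> J}"
  have JY: "x \<in> H Y" "y \<in> H Y" if "(x, y) \<in> J" for x y
    using equiv_subset[OF J] that by auto
  have JR: "(x, y) \<in> J" if "x \<in> H Y" "y \<in> H Y" "R f x = R f y" for x y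
    using ker(1) that by (auto simp: ker_rel_def hom_cod[OF f])
  have Jtrans: "(x, z) \<in> J" if "(x, y) \<in> J" "(y, z) \<in> J" for x y z
    using equiv_transD[OF J] that by blast
  have "trans s"
  proof (rule transI)
    fix u v w assume uv: "(u, v) \<in> s" and vw: "(v, w) \<in> s"
    show "(u, w) \<in> s"
    proof (cases "u = v \<or> v = w")
      case False
      then obtain x y y' z where "(x, y) \<in> J" "(y', z) \<in> J" and eqs: "u = R f x" "v = R f y" "v = R f y'" "w = R f z"
        using uv vw by (auto simp: s_def)
      then have "(x, z) \<in> J" using JR[of y y'] JY Jtrans by metis
      then show ?thesis using eqs by (auto simp: s_def)
    qed (use uv vw in auto)
  qed
  moreover have "Id_on (H X) \<union> map_prod (R f) (R f) ` r \<subseteq> s"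
    using ker(2) by (auto simp: s_def)
  ultimately have "gen_rel f r \<subseteq> s"
    unfolding gen_rel_def hom_dom[OF f] by (metis trancl_id trancl_mono_subset)
  moreover have "pre_rel f s \<subseteq> J"
  proof
    fix p assume "p \<in> pre_rel f s"
    then obtain x y where p: "p = (x, y)" "x \<in> H Y" "y \<in> H Y" "(R f x, R f y) \<in> s"
      by (auto simp: pre_rel_def hom_cod[OF f])
    show "p \<in> J"
    proof (cases "R f x = R f y")
      case False
      then obtain x' y' where "(x', y') \<in> J" "R f x = R f x'" "R f y = R f y'"
        using p(4) by (auto simp: s_def)
      then show ?thesis using JR Jtrans JY p by metis
    qed (use JR p in simp)
  qed
  ultimately show "pre_rel f (gen_rel f r) \<subseteq> ?J" unfolding J_def by (auto simp: pre_rel_def)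
next
  show "(r \<union> ker_rel f)\<^sup>+ \<subseteq> pre_rel f (gen_rel f r)"
  proof (rule trancl_Un_least)
    show eq: "equiv (H Y) (pre_rel f (gen_rel f r))"
      using pre_rel_equiv[OF f gen_rel_equiv[OF f r]] .
    show "r \<subseteq> pre_rel f (gen_rel f r)"
      using gen_rel_least[OF f gen_rel_equiv[OF f r] r] by blast
    show "ker_rel f \<subseteq> pre_rel f (gen_rel f r)"
      using R_closed[OF f] equiv_reflD[OF gen_rel_equiv[OF f r]]
      by (auto simp: ker_rel_def pre_rel_def hom_cod[OF f])
  qed
qed

lemma orean_form_eqv: "orean_form C eqf"
proof (intro orean_form.intro orean_form_axioms.intro category_axioms)
  show "bounded_lattice (L X)" if "X \<in> Obj C" for X using that by (rule bounded_lattice_L)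
  show "small TYPE('u) (carrier (L X))" if "X \<in> Obj C" for X using that by (simp add: carrier_L code_small)
  show "push eqf f S \<in> carrier (L Y)" if "f \<in> Hom C X Y" "S \<in> carrier (L X)" for f X Y S
    using that by (auto simp: carrier_L push_L pre_rel_equiv)
  show "pull eqf f S \<in> carrier (L X)" if "f \<in> Hom C X Y" "S \<in> carrier (L Y)" for f X Y S
    using that by (auto simp: carrier_L pull_L gen_rel_equiv)
  have wpo: "weak_partial_order (L X)" if "X \<in> Obj C" for X
    using bounded_lattice_L[OF that]
    by (simp add: bounded_lattice_def weak_partial_order_top_def)
  show adj: "push eqf f S \<sqsubseteq>\<^bsub>L Y\<^esub> T \<longleftrightarrow> S \<sqsubseteq>\<^bsub>L X\<^esub> pull eqf f T"
    if f: "f \<in> Hom C X Y" and ST: "S \<in> carrier (L X)" "T \<in> carrier (L Y)" for f X Y S T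
    using ST hom_objs[OF f] pre_rel_equiv[OF f] gen_rel_equiv[OF f]
    by (auto simp: carrier_L pull_L[OF f] push_L[OF f] le_L gen_rel_least[OF f])
  show "isotone (L X) (L Y) (push eqf f)" if f: "f \<in> Hom C X Y" for f X Y
    using hom_objs[OF f] pre_rel_equiv[OF f]
    by (intro isotoneI wpo) (auto simp: carrier_L push_L[OF f] le_L pre_rel_def)
  show "isotone (L Y) (L X) (pull eqf f)" if f: "f \<in> Hom C X Y" for f X Y
    using hom_objs[OF f] gen_rel_equiv[OF f]
    by (intro isotoneI wpo) (auto simp: carrier_L pull_L[OF f] le_L gen_rel_mono)
  show "push eqf (Idn C X) S = S" if X: "X \<in> Obj C" and S: "S \<in> carrier (L X)" for X S
  proof -
    obtain r where r: "equiv (H X) r" "S = code X r" using S by (auto simp: carrier_L)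
    have i: "Idn C X \<in> Hom C X X" using X by (rule idn_hom)
    have "pre_rel (Idn C X) r = r"
      using equiv_subset[OF r(1)] by (auto simp: pre_rel_def hom_cod[OF i] R_idn[OF X])
    then show ?thesis using r by (simp add: push_L[OF i])
  qed
  show "pull eqf (Idn C X) S = S" if X: "X \<in> Obj C" and S: "S \<in> carrier (L X)" for X S
  proof -
    obtain r where r: "equiv (H X) r" "S = code X r" using S by (auto simp: carrier_L)
    have i: "Idn C X \<in> Hom C X X" using X by (rule idn_hom)
    have p: "pre_rel (Idn C X) s = s" if "equiv (H X) s" for s
      using equiv_subset[OF that] by (auto simp: pre_rel_def hom_cod[OF i] R_idn[OF X])
    have "gen_rel (Idn C X) r = r"
      using gen_rel_least[OF i _ r(1)] p gen_rel_equiv[OF i r(1)] r(1) by blast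
    then show ?thesis using r by (simp add: pull_L[OF i])
  qed
  have pre_cmp: "pre_rel (g \<cdot> f) r = pre_rel g (pre_rel f r)"
    if f: "f \<in> Hom C X Y" and g: "g \<in> Hom C Y Z" for f g X Y Z r
    using R_closed[OF g] by (auto simp: pre_rel_def hom_cod[OF f] hom_cod[OF g]
        hom_cod[OF cmp_hom[OF f g]] R_cmp[OF f g])
  show "push eqf (g \<cdot> f) S = push eqf g (push eqf f S)"
    if f: "f \<in> Hom C X Y" and g: "g \<in> Hom C Y Z" and S: "S \<in> carrier (L X)" for f g X Y Z S
    using S pre_rel_equiv[OF f]
    by (auto simp: carrier_L push_L[OF f] push_L[OF g] push_L[OF cmp_hom[OF f g]] pre_cmp[OF f g])
  show "pull eqf (g \<cdot> f) T = pull eqf f (pull eqf g T)"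
    if f: "f \<in> Hom C X Y" and g: "g \<in> Hom C Y Z" and T: "T \<in> carrier (L Z)" for f g X Y Z T
  proof -
    obtain r where r: "equiv (H Z) r" "T = code Z r" using T by (auto simp: carrier_L)
    note gf = cmp_hom[OF f g]
    have gg: "equiv (H Y) (gen_rel g r)" using gen_rel_equiv[OF g r(1)] .
    \<comment> \<open>Both sides are least for the same condition on \<open>s\<close>, since
      preimages compose strictly; testing against all equivalence relations \<open>s\<close>
      identifies them.\<close>
    have "gen_rel (g \<cdot> f) r \<subseteq> s \<longleftrightarrow> gen_rel f (gen_rel g r) \<subseteq> s" if "equiv (H X) s" for s
      using gen_rel_least[OF gf that r(1)] gen_rel_least[OF f that gg]
        gen_rel_least[OF g pre_rel_equiv[OF f that] r(1)] by (simp add: pre_cmp[OF f g])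
    then have "gen_rel (g \<cdot> f) r = gen_rel f (gen_rel g r)"
      using gen_rel_equiv[OF gf r(1)] gen_rel_equiv[OF f gg] by blast
    then show ?thesis using r gg by (simp add: pull_L[OF f] pull_L[OF g] pull_L[OF gf])
  qed
qed

section \<open>Kernel and image clusters of factored morphisms, quotients and embeddings\<close>

lemma im_rel_subsetD:
  assumes sub: "im_rel f \<subseteq> im_rel g" and f: "f \<in> Hom C X Y" and g: "g \<in> Hom C X Z"
  shows "R f ` H Y \<subseteq> R g ` H Z"
proof
  fix u assume u: "u \<in> R f ` H Y"
  have b: "b \<in> R f ` H Y" "b \<in> R g ` H Z"
    using R_base[OF f] R_base[OF g] base_closed hom_objs(2)[OF f] hom_objs(2)[OF g]
    by (metis imageI)+
  have "(u, b) \<in> im_rel g"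
    using u b(1) sub unfolding im_rel_def hom_cod[OF f] by blast
  then show "u \<in> R g ` H Z"
    using b(2) by (auto simp: im_rel_def hom_cod[OF g])
qed

lemma R_surj_M:
  assumes "m \<in> M" "m \<in> Hom C X Y" shows "R m ` H Y = H X"
  using R_M[OF assms(1)] R_closed[OF assms(2)] by (auto simp: hom_dom[OF assms(2)] hom_cod[OF assms(2)])

lemma image_factored:
  assumes e: "e \<in> Hom C X Q" and m: "m \<in> M" "m \<in> Hom C Q Y"
  shows "R (m \<cdot> e) ` H Y = R e ` H Q"
proof -
  have "R (m \<cdot> e) ` H Y = R e ` R m ` H Y"
    unfolding image_image by (intro image_cong refl R_cmp[OF e m(2)])
  then show ?thesis using R_surj_M[OF m] by simp
qed

lemma ker_factored:
  assumes e: "e \<in> E" "e \<in> Hom C X Q" and m: "m \<in> Hom C Q Y"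
  shows "ker_rel (m \<cdot> e) = ker_rel m"
  using R_E[OF e(1)] R_closed[OF m]
  by (auto simp: ker_rel_def hom_cod[OF m] hom_cod[OF e(2)] hom_cod[OF cmp_hom[OF e(2) m]]
      R_cmp[OF e(2) m] inj_on_def)

text \<open>Right-class morphisms act surjectively, so the kernel of a morphism depends only on its
  left factor.\<close>

lemma Ker_factored:
  assumes "e \<in> Hom C X Q" "m \<in> M" "m \<in> Hom C Q Y"
  shows "Ker C eqf (m \<cdot> e) = Ker C eqf e"
  using assms image_factored[OF assms] cmp_hom[OF assms(1,3)]
  by (simp add: Ker_eqv im_rel_def hom_cod hom_dom)

text \<open>Left-class morphisms act injectively, so the image of a morphism depends only on its
  right factor.\<close>

lemma Im_factored:
  assumes "e \<in> E" "e \<in> Hom C X Q" "m \<in> Hom C Q Y"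
  shows "Im C eqf (m \<cdot> e) = Im C eqf m"
  using assms ker_factored[OF assms] cmp_hom[OF assms(2,3)] by (simp add: Im_eqv)

text \<open>A competitor \<open>g\<close> may be replaced by its left factor, which has the same
  kernel. Between left-class morphisms the comparison of kernels is an inclusion of images under
  \<open>R\<close>, thanks to the base point, and \<open>detect_E\<close> turns it into a
  factorization.\<close>

lemma E_quotient:
  assumes e: "e \<in> E" "e \<in> Hom C X Q"
  shows "quotient_of C eqf X (Ker C eqf e) e"
  unfolding quotient_of_def
proof (intro conjI ballI impI)
  show "normal C eqf X (Ker C eqf e)"
    using e by (auto simp: normal_def Hom_def)
  fix g assume g: "g \<in> Arr C" and le: "Dom C g = X \<and> Ker C eqf e \<sqsubseteq>\<^bsub>L X\<^esub> Ker C eqf g"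
  define Z where "Z = Cod C g"
  have gh: "g \<in> Hom C X Z" using g le by (simp add: Hom_def Z_def)
  obtain P e' m where em: "e' \<in> E" "m \<in> M" "e' \<in> Hom C X P" "m \<in> Hom C P Z" "g = m \<cdot> e'"
    using gh by (rule factorizationE)
  have "Ker C eqf g = Ker C eqf e'" using em Ker_factored by simp
  then have "code X (im_rel e) \<sqsubseteq>\<^bsub>L X\<^esub> code X (im_rel e')"
    using le by (simp add: Ker_eqv[OF em(3)] Ker_eqv[OF e(2)])
  then have "im_rel e' \<subseteq> im_rel e"
    using le_L im_rel_equiv[OF e(2)] im_rel_equiv[OF em(3)] hom_objs(1)[OF gh] by simp
  then have "R e' ` H P \<subseteq> R e ` H Q" using em(3) e(2) by (rule im_rel_subsetD)
  then obtain d where d: "d \<in> Hom C Q P" "e' = d \<cdot> e"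
    using detect_E[OF e(1) em(1)] by (auto simp: hom_cod[OF e(2)] hom_cod[OF em(3)] hom_dom[OF e(2)] hom_dom[OF em(3)])
  have "m \<cdot> d \<in> Hom C Q Z" "g = (m \<cdot> d) \<cdot> e"
    using cmp_hom[OF d(1) em(4)] cmp_assoc[OF e(2) d(1) em(4)] d(2) em(5) by auto
  moreover have "h = h'" if "h \<in> Hom C Q Z" "h' \<in> Hom C Q Z" "g = h \<cdot> e" "g = h' \<cdot> e" for h h'
    using epiD[OF E_epi[OF e(1)] e(2) that(1,2)] that by simp
  ultimately show "\<exists>!h. h \<in> Hom C (Cod C e) (Cod C g) \<and> g = h \<cdot> e"
    unfolding hom_cod[OF e(2)] Z_def[symmetric] by blast
qed (use e in \<open>auto simp: Hom_def\<close>)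

text \<open>A competitor is replaced by its right factor, which has the same image; the comparison
  of images is then an inclusion of kernel relations, the hypothesis of
  \<open>detect_M\<close>.\<close>

lemma M_embedding:
  assumes m: "m \<in> M" "m \<in> Hom C Q Y"
  shows "embedding_of C eqf Y (Im C eqf m) m"
  unfolding embedding_of_def
proof (intro conjI ballI impI)
  show "conormal C eqf Y (Im C eqf m)"
    using m by (auto simp: conormal_def Hom_def)
  fix g assume g: "g \<in> Arr C" and le: "Cod C g = Y \<and> Im C eqf g \<sqsubseteq>\<^bsub>L Y\<^esub> Im C eqf m"
  define Z where "Z = Dom C g"
  have gh: "g \<in> Hom C Z Y" using g le by (simp add: Hom_def Z_def)
  obtain P e m' where em: "e \<in> E" "m' \<in> M" "e \<in> Hom C Z P" "m' \<in> Hom C P Y" "g = m' \<cdot> e"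
    using gh by (rule factorizationE)
  have "Im C eqf g = Im C eqf m'" using em Im_factored by simp
  then have "code Y (ker_rel m') \<sqsubseteq>\<^bsub>L Y\<^esub> code Y (ker_rel m)"
    using le by (simp add: Im_eqv[OF em(4)] Im_eqv[OF m(2)])
  then have sub: "ker_rel m \<subseteq> ker_rel m'"
    using le_L ker_rel_equiv[OF m(2)] ker_rel_equiv[OF em(4)] hom_objs(2)[OF gh] by simp
  have "\<exists>d\<in>Hom C (Dom C m') (Dom C m). m' = m \<cdot> d"
  proof (rule detect_M[OF m(1) em(2)])
    fix x y assume "x \<in> H (Cod C m)" "y \<in> H (Cod C m)" "R m x = R m y"
    then show "R m' x = R m' y" using sub by (auto simp: ker_rel_def)
  qed (simp add: hom_cod[OF m(2)] hom_cod[OF em(4)])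
  then obtain d where d: "d \<in> Hom C P Q" "m' = m \<cdot> d"
    by (auto simp: hom_dom[OF m(2)] hom_dom[OF em(4)])
  have "d \<cdot> e \<in> Hom C Z Q" "g = m \<cdot> (d \<cdot> e)"
    using cmp_hom[OF em(3) d(1)] cmp_assoc[OF em(3) d(1) m(2)] d(2) em(5) by auto
  moreover have "h = h'" if "h \<in> Hom C Z Q" "h' \<in> Hom C Z Q" "g = m \<cdot> h" "g = m \<cdot> h'" for h h'
    using monoD[OF M_mono[OF m(1)] m(2) that(1,2)] that by simp
  ultimately show "\<exists>!h. h \<in> Hom C (Dom C g) (Dom C m) \<and> g = m \<cdot> h"
    unfolding hom_dom[OF m(2)] Z_def[symmetric] by blast
qed (use m in \<open>auto simp: Hom_def\<close>)

text \<open>Passing to left factors lets joins of arbitrary normal clusters be treated with pushouts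
  of left-class morphisms, which exist. \<open>conormal_M\<close> plays the same part for
  pullbacks.\<close>

lemma normal_E:
  assumes "X \<in> Obj C" "normal C eqf X K"
  obtains e where "e \<in> E" "e \<in> Hom C X (Cod C e)" "K = code X (im_rel e)"
proof -
  obtain f where f: "f \<in> Arr C" "Dom C f = X" "K = Ker C eqf f"
    using assms(2) by (auto simp: normal_def)
  then have fh: "f \<in> Hom C X (Cod C f)" by (simp add: Hom_def)
  obtain P e m where em: "e \<in> E" "m \<in> M" "e \<in> Hom C X P" "m \<in> Hom C P (Cod C f)" "f = m \<cdot> e"
    using fh by (rule factorizationE)
  then show ?thesis
    using that[of e] f(3) Ker_factored[of e X P m] Ker_eqv[OF em(3)] hom_cod[OF em(3)] by simp
qed

lemma conormal_M:
  assumes "X \<in> Obj C" "conormal C eqf X S"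
  obtains m where "m \<in> M" "m \<in> Hom C (Dom C m) X" "S = code X (ker_rel m)"
proof -
  obtain f where f: "f \<in> Arr C" "Cod C f = X" "S = Im C eqf f"
    using assms(2) by (auto simp: conormal_def)
  then have fh: "f \<in> Hom C (Dom C f) X" by (simp add: Hom_def)
  obtain P e m where em: "e \<in> E" "m \<in> M" "e \<in> Hom C (Dom C f) P" "m \<in> Hom C P X" "f = m \<cdot> e"
    using fh by (rule factorizationE)
  then show ?thesis
    using that[of m] f(3) Im_factored[of e _ P m] Im_eqv[OF em(4)] hom_dom[OF em(4)] by simp
qed

text \<open>The join is an intersection of two relations, each collapsing the image of a left-class
  morphism. It collapses the intersection of the two images, which by \<open>R_pushout\<close> is
  the image of the diagonal of the pushout.\<close>

lemma normal_join_eqv: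
  assumes X: "X \<in> Obj C" and "normal C eqf X K" "normal C eqf X K'"
  shows "normal C eqf X (K \<squnion>\<^bsub>L X\<^esub> K')"
proof -
  obtain e where e: "e \<in> E" "e \<in> Hom C X (Cod C e)" "K = code X (im_rel e)"
    using X assms(2) by (rule normal_E)
  obtain e' where e': "e' \<in> E" "e' \<in> Hom C X (Cod C e')" "K' = code X (im_rel e')"
    using X assms(3) by (rule normal_E)
  have dom: "Dom C e = Dom C e'" using hom_dom e e' by metis
  obtain i j where po: "is_pushout C e e' i j" using E_pushouts e(1) e'(1) dom by blast
  obtain P where P: "i \<in> Hom C (Cod C e) P" "j \<in> Hom C (Cod C e') P" "i \<cdot> e = j \<cdot> e'"
    using po e(2) e'(2) by (rule is_pushoutE) blast
  have ie: "i \<cdot> e \<in> Hom C X P" using cmp_hom[OF e(2) P(1)] .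
  have "R (i \<cdot> e) ` H P = R e ` H (Cod C e) \<inter> R e' ` H (Cod C e')"
  proof
    show "R e ` H (Cod C e) \<inter> R e' ` H (Cod C e') \<subseteq> R (i \<cdot> e) ` H P"
      using R_pushout[OF e(1) e'(1) po] hom_cod[OF P(1)] by simp
    show "R (i \<cdot> e) ` H P \<subseteq> R e ` H (Cod C e) \<inter> R e' ` H (Cod C e')"
      using R_closed[OF P(1)] R_closed[OF P(2)] R_cmp[OF e(2) P(1)] R_cmp[OF e'(2) P(2)] P(3)
      by (auto simp: image_iff) metis+
  qed
  then have "im_rel (i \<cdot> e) = im_rel e \<inter> im_rel e'"
    unfolding im_rel_def hom_dom[OF ie] hom_cod[OF ie] hom_dom[OF e(2)] hom_dom[OF e'(2)] by auto
  then have "K \<squnion>\<^bsub>L X\<^esub> K' = Ker C eqf (i \<cdot> e)"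
    using e(3) e'(3) join_L[OF X im_rel_equiv[OF e(2)] im_rel_equiv[OF e'(2)]] Ker_eqv[OF ie] by simp
  then show ?thesis using ie by (auto simp: normal_def Hom_def)
qed

text \<open>The meet is a transitive closure of two kernel relations. By \<open>R_pullback\<close>
  three links suffice to connect two elements with the same restriction to the pullback, so the
  closure is the kernel relation of the diagonal.\<close>

lemma conormal_meet_eqv:
  assumes X: "X \<in> Obj C" and "conormal C eqf X S" "conormal C eqf X S'"
  shows "conormal C eqf X (S \<sqinter>\<^bsub>L X\<^esub> S')"
proof -
  obtain m where m: "m \<in> M" "m \<in> Hom C (Dom C m) X" "S = code X (ker_rel m)"
    using X assms(2) by (rule conormal_M)
  obtain m' where m': "m' \<in> M" "m' \<in> Hom C (Dom C m') X" "S' = code X (ker_rel m')"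
    using X assms(3) by (rule conormal_M)
  have cod: "Cod C m = Cod C m'" using hom_cod m m' by metis
  obtain p q where pb: "is_pullback C m m' p q" using M_pullbacks m(1) m'(1) cod by blast
  obtain P where P: "p \<in> Hom C P (Dom C m)" "q \<in> Hom C P (Dom C m')" "m \<cdot> p = m' \<cdot> q"
    using pb m(2) m'(2) by (rule is_pullbackE) blast
  have mp: "m \<cdot> p \<in> Hom C P X" using cmp_hom[OF P(1) m(2)] .
  have "ker_rel (m \<cdot> p) = (ker_rel m \<union> ker_rel m')\<^sup>+"
  proof
    show "(ker_rel m \<union> ker_rel m')\<^sup>+ \<subseteq> ker_rel (m \<cdot> p)"
    proof (rule trancl_Un_least[OF ker_rel_equiv[OF mp]])
      show "ker_rel m \<subseteq> ker_rel (m \<cdot> p)"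
        by (auto simp: ker_rel_def hom_cod[OF m(2)] hom_cod[OF mp] R_cmp[OF P(1) m(2)])
      show "ker_rel m' \<subseteq> ker_rel (m \<cdot> p)"
        unfolding P(3) using hom_cod[OF mp] P(3)
        by (auto simp: ker_rel_def hom_cod[OF m'(2)] R_cmp[OF P(2) m'(2)])
    qed
    show "ker_rel (m \<cdot> p) \<subseteq> (ker_rel m \<union> ker_rel m')\<^sup>+"
    proof (rule subrelI)
      fix x y assume "(x, y) \<in> ker_rel (m \<cdot> p)"
      then have xy: "x \<in> H X" "y \<in> H X" "R (m \<cdot> p) x = R (m \<cdot> p) y"
        by (auto simp: ker_rel_def hom_cod[OF mp])
      obtain z w where "z \<in> H X" "w \<in> H X" "R m x = R m z" "R m' z = R m' w" "R m w = R m y"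
        using R_pullback[OF m(1) m'(1) pb] xy hom_cod[OF m(2)] by metis
      then have "(x, z) \<in> ker_rel m" "(z, w) \<in> ker_rel m'" "(w, y) \<in> ker_rel m"
        using xy by (auto simp: ker_rel_def hom_cod[OF m(2)] hom_cod[OF m'(2)])
      then show "(x, y) \<in> (ker_rel m \<union> ker_rel m')\<^sup>+"
        by (meson UnI1 UnI2 r_into_trancl trancl_trans)
    qed
  qed
  then have "S \<sqinter>\<^bsub>L X\<^esub> S' = Im C eqf (m \<cdot> p)"
    using m(3) m'(3) meet_L[OF X ker_rel_equiv[OF m(2)] ker_rel_equiv[OF m'(2)]] Im_eqv[OF mp] by simp
  then show ?thesis using mp by (auto simp: conormal_def Hom_def)
qed

lemma noetherian_form_eqv: "noetherian_form C eqf"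
proof (intro noetherian_form.intro noetherian_form_axioms.intro orean_form_eqv)
  show "pull eqf f (push eqf f S) = S \<squnion>\<^bsub>L X\<^esub> Ker C eqf f"
    if f: "f \<in> Hom C X Y" and S: "S \<in> carrier (L X)" for f X Y S
    using S hom_objs[OF f] im_rel_equiv[OF f]
    by (auto simp: carrier_L push_L[OF f] pull_L[OF f] pre_rel_equiv[OF f] pull_push_L[OF f] join_L Ker_eqv[OF f])
  show "push eqf f (pull eqf f T) = T \<sqinter>\<^bsub>L Y\<^esub> Im C eqf f"
    if f: "f \<in> Hom C X Y" and T: "T \<in> carrier (L Y)" for f X Y T
    using T hom_objs[OF f] ker_rel_equiv[OF f]
    by (auto simp: carrier_L push_L[OF f] pull_L[OF f] gen_rel_equiv[OF f] push_pull_L[OF f] meet_L Im_eqv[OF f])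
  show "\<exists>e m. quotient_of C eqf X (Ker C eqf f) e \<and>
      embedding_of C eqf Y (Im C eqf f) m \<and> Cod C e = Dom C m \<and> f = m \<cdot> e"
    if f: "f \<in> Hom C X Y" for f X Y
  proof -
    obtain P e m where em: "e \<in> E" "m \<in> M" "e \<in> Hom C X P" "m \<in> Hom C P Y" "f = m \<cdot> e"
      using f by (rule factorizationE)
    then show ?thesis
      using E_quotient[OF em(1,3)] M_embedding[OF em(2,4)] Ker_factored[OF em(3,2,4)]
        Im_factored[OF em(1,3,4)] hom_cod[OF em(3)] hom_dom[OF em(4)] by metis
  qed
qed (fact normal_join_eqv conormal_meet_eqv)+

text \<open>A quotient \<pi> and its left factor have the same kernel, so the left factor is
  \<open>h \<cdot> \<pi>\<close>. Uniqueness of factorizations through \<pi> makes \<open>h\<close>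
  a right inverse of the right factor, which is a monomorphism and hence invertible.\<close>

lemma quotient_in_E:
  assumes q: "quotient_of C eqf X K \<pi>"
  shows "\<pi> \<in> E"
proof -
  define Y where "Y = Cod C \<pi>"
  have ph: "\<pi> \<in> Hom C X Y" using q by (auto simp: quotient_of_def Hom_def Y_def)
  obtain P e m where em: "e \<in> E" "m \<in> M" "e \<in> Hom C X P" "m \<in> Hom C P Y" "\<pi> = m \<cdot> e"
    using ph by (rule factorizationE)
  have K: "K = Ker C eqf e"
    using q Ker_factored[OF em(3,2,4)] em(5) by (simp add: quotient_of_def)
  have "K \<sqsubseteq>\<^bsub>L X\<^esub> Ker C eqf e" "K \<sqsubseteq>\<^bsub>L X\<^esub> Ker C eqf \<pi>"
    using K q Ker_eqv[OF em(3)] le_L im_rel_equiv[OF em(3)] hom_objs(1)[OF ph]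
    by (auto simp: quotient_of_def)
  then obtain h where h: "h \<in> Hom C Y P" "e = h \<cdot> \<pi>"
    and uniq: "\<And>k k'. k \<in> Hom C Y Y \<Longrightarrow> k' \<in> Hom C Y Y \<Longrightarrow> \<pi> = k \<cdot> \<pi> \<Longrightarrow> \<pi> = k' \<cdot> \<pi> \<Longrightarrow> k = k'"
    using q em(3) ph unfolding quotient_of_def Y_def by (metis (no_types, lifting) hom_arr hom_dom hom_cod)
  have "m \<cdot> h = Idn C Y"
  proof (rule uniq)
    show "m \<cdot> h \<in> Hom C Y Y" using cmp_hom[OF h(1) em(4)] .
    show "Idn C Y \<in> Hom C Y Y" using idn_hom hom_objs ph by blast
    show "\<pi> = (m \<cdot> h) \<cdot> \<pi>" by (simp only: cmp_assoc[OF ph h(1) em(4)] h(2)[symmetric] em(5)[symmetric])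
    show "\<pi> = Idn C Y \<cdot> \<pi>" using idn_left[OF ph] by simp
  qed
  then have "is_iso C m" using split_mono_epi_is_iso[OF M_mono[OF em(2)] em(4) h(1)] by simp
  then show ?thesis using iso_E E_cmp_hom[OF em(1) _ em(3,4)] em(5) by simp
qed

text \<open>Dual to \<open>quotient_in_E\<close>: the right factor of \<iota> has the same image, so
  it factors through \<iota>, and uniqueness splits the left factor.\<close>

lemma embedding_in_M:
  assumes q: "embedding_of C eqf Y S \<iota>"
  shows "\<iota> \<in> M"
proof -
  define X where "X = Dom C \<iota>"
  have ih: "\<iota> \<in> Hom C X Y" using q by (auto simp: embedding_of_def Hom_def X_def)
  obtain P e m where em: "e \<in> E" "m \<in> M" "e \<in> Hom C X P" "m \<in> Hom C P Y" "\<iota> = m \<cdot> e"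
    using ih by (rule factorizationE)
  have S: "S = Im C eqf m"
    using q Im_factored[OF em(1,3,4)] em(5) by (simp add: embedding_of_def)
  have "Im C eqf m \<sqsubseteq>\<^bsub>L Y\<^esub> S" "Im C eqf \<iota> \<sqsubseteq>\<^bsub>L Y\<^esub> S"
    using S q Im_eqv[OF em(4)] le_L ker_rel_equiv[OF em(4)] hom_objs(2)[OF ih]
    by (auto simp: embedding_of_def)
  then obtain h where h: "h \<in> Hom C P X" "m = \<iota> \<cdot> h"
    and uniq: "\<And>k k'. k \<in> Hom C X X \<Longrightarrow> k' \<in> Hom C X X \<Longrightarrow> \<iota> = \<iota> \<cdot> k \<Longrightarrow> \<iota> = \<iota> \<cdot> k' \<Longrightarrow> k = k'"
    using q em(4) ih unfolding embedding_of_def X_def by (metis (no_types, lifting) hom_arr hom_dom hom_cod)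
  have "h \<cdot> e = Idn C X"
  proof (rule uniq)
    show "h \<cdot> e \<in> Hom C X X" using cmp_hom[OF em(3) h(1)] .
    show "Idn C X \<in> Hom C X X" using idn_hom hom_objs ih by blast
    show "\<iota> = \<iota> \<cdot> (h \<cdot> e)" by (simp only: cmp_assoc[OF em(3) h(1) ih, symmetric] h(2)[symmetric] em(5)[symmetric])
    show "\<iota> = \<iota> \<cdot> Idn C X" using idn_right[OF ih] by simp
  qed
  then have "is_iso C e" using split_epi_mono_is_iso[OF E_epi[OF em(1)] em(3) h(1)] by simp
  then show ?thesis using iso_M M_cmp_hom[OF _ em(2,3,4)] em(5) by simp
qed

lemma induces_eqv: "induces C eqf E M"
  unfolding induces_def form_quotients_def form_embeddings_def
proof (intro conjI equalityI subsetI)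
  fix e assume "e \<in> E"
  then show "e \<in> {\<pi>. \<exists>X\<in>Obj C. \<exists>K. quotient_of C eqf X K \<pi>}"
    using E_quotient E_hom hom_objs by blast
next
  fix m assume "m \<in> M"
  then show "m \<in> {\<iota>. \<exists>X\<in>Obj C. \<exists>S. embedding_of C eqf X S \<iota>}"
    using M_embedding M_hom hom_objs by blast
qed (use quotient_in_E embedding_in_M in blast)+

end

section \<open>Topological spaces\<close>

abbreviation Top_cmp :: "'u top_arr \<Rightarrow> 'u top_arr \<Rightarrow> 'u top_arr"  (infixr "\<odot>" 70) where
  "g \<odot> f \<equiv> g \<cdot>\<^bsub>Top\<^esub> f"

lemma small_subset: "small U B \<Longrightarrow> A \<subseteq> B \<Longrightarrow> small U A"
  by (rule lesspoll_trans1[OF subset_imp_lepoll])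

lemma small_image: "small U A \<Longrightarrow> small U (f ` A)"
  by (rule lesspoll_trans1[OF image_lepoll])

lemma Top_simps [simp]:
  "Obj (Top :: ('u topology, 'u top_arr) cat) = {X. small TYPE('u) (topspace X)}"
  "Dom Top (X, f, Y) = X" "Cod Top (X, f, Y) = Y"
  "Idn Top X = (X, \<lambda>x\<in>topspace X. x, X)"
  "(Y', g, Z) \<odot> (X, f, Y) = (X, compose (topspace X) g f, Z)"
  for X Y Y' Z :: "'u topology"
  by (simp_all add: Top_def)

lemma Top_Arr:
  "(X, f, Y) \<in> Arr (Top :: ('u topology, 'u top_arr) cat) \<longleftrightarrow>
     small TYPE('u) (topspace X) \<and> small TYPE('u) (topspace Y) \<and>
     continuous_map X Y f \<and> f \<in> extensional (topspace X)"
  by (simp add: Top_def)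

lemma Top_Hom:
  "(X', f, Y') \<in> Hom (Top :: ('u topology, 'u top_arr) cat) X Y \<longleftrightarrow>
     X' = X \<and> Y' = Y \<and> small TYPE('u) (topspace X) \<and> small TYPE('u) (topspace Y) \<and>
     continuous_map X Y f \<and> f \<in> extensional (topspace X)"
  by (auto simp add: Hom_def Top_Arr)

lemma Top_HomE:
  assumes "h \<in> Hom (Top :: ('u topology, 'u top_arr) cat) X Y"
  obtains f where "h = (X, f, Y)" "small TYPE('u) (topspace X)" "small TYPE('u) (topspace Y)"
    "continuous_map X Y f" "f \<in> extensional (topspace X)" "f ` topspace X \<subseteq> topspace Y"
  using assms continuous_map_image_subset_topspace by (cases h) (fastforce simp: Top_Hom)

lemma Top_restrict_Hom:
  fixes X Y :: "'u topology"
  assumes "small TYPE('u) (topspace X)" "small TYPE('u) (topspace Y)" "continuous_map X Y f"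
  shows "(X, restrict f (topspace X), Y) \<in> Hom Top X Y"
  using assms continuous_map_eq[of X Y f "restrict f (topspace X)"] by (simp add: Top_Hom)

lemma Top_cmp_eq_iff:
  "compose A g f = compose A g' f' \<longleftrightarrow> (\<forall>x\<in>A. g (f x) = g' (f' x))"
  by (auto simp: compose_def restrict_def fun_eq_iff)

lemma category_Top: "category (Top :: ('u topology, 'u top_arr) cat)"
proof
  fix f :: "'u top_arr" and g h and X Y Z W :: "'u topology"
  show "f \<in> Arr Top \<Longrightarrow> Dom Top f \<in> Obj Top" "f \<in> Arr Top \<Longrightarrow> Cod Top f \<in> Obj Top"
    by (cases f; simp add: Top_Arr)+
  show "Idn Top X \<in> Hom Top X X" if "X \<in> Obj Top"
    using that Top_restrict_Hom[of X X "\<lambda>x. x"] by simp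
  show "g \<odot> f \<in> Hom Top X Z" if f: "f \<in> Hom Top X Y" and g: "g \<in> Hom Top Y Z"
  proof -
    obtain f' where f': "f = (X, f', Y)" "continuous_map X Y f'" "small TYPE('u) (topspace X)"
      using f by (rule Top_HomE)
    obtain g' where g': "g = (Y, g', Z)" "continuous_map Y Z g'" "small TYPE('u) (topspace Z)"
      using g by (rule Top_HomE)
    show ?thesis
      using Top_restrict_Hom[OF f'(3) g'(3) continuous_map_compose[OF f'(2) g'(2)]]
      by (simp add: f' g' compose_def o_def)
  qed
  show "f \<odot> Idn Top X = f" if f: "f \<in> Hom Top X Y"
    using f by (rule Top_HomE) (auto simp: compose_def restrict_def extensional_def fun_eq_iff)
  show "Idn Top Y \<odot> f = f" if f: "f \<in> Hom Top X Y"
    using f by (rule Top_HomE) (auto simp: compose_def restrict_def extensional_def fun_eq_iff)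
  show "(h \<odot> g) \<odot> f = h \<odot> (g \<odot> f)"
    if f: "f \<in> Hom Top W X" and g: "g \<in> Hom Top X Y" and h: "h \<in> Hom Top Y Z"
    using f
  proof (rule Top_HomE)
    fix f' assume f': "f = (W, f', X)" "f' ` topspace W \<subseteq> topspace X"
    obtain g' h' where "g = (X, g', Y)" "h = (Y, h', Z)" using g h by (metis Top_HomE)
    then show ?thesis using f' by (auto simp: compose_def restrict_def fun_eq_iff)
  qed
qed

interpretation Top: category "Top :: ('u topology, 'u top_arr) cat"
  by (rule category_Top)

lemma Top_is_iso_iff:
  assumes "(X, f, Y) \<in> Arr (Top :: ('u topology, 'u top_arr) cat)"
  shows "is_iso Top (X, f, Y) \<longleftrightarrow> homeomorphic_map X Y f"
proof
  assume "is_iso Top (X, f, Y)"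
  then obtain g' where g': "g' \<in> Hom Top Y X" "g' \<odot> (X, f, Y) = Idn Top X"
      "(X, f, Y) \<odot> g' = Idn Top Y"
    by (auto simp: is_iso_def)
  obtain g where g: "g' = (Y, g, X)" "continuous_map Y X g" using g'(1) by (rule Top_HomE)
  have "homeomorphic_maps X Y f g"
    using assms g g'(2,3)
    by (auto simp: homeomorphic_maps_def Top_Arr compose_def restrict_def fun_eq_iff; metis)
  then show "homeomorphic_map X Y f" by (rule homeomorphic_maps_imp_map)
next
  assume "homeomorphic_map X Y f"
  then obtain g where g: "homeomorphic_maps X Y f g" by (auto simp: homeomorphic_map_maps)
  then have cg: "continuous_map Y X g" and gf: "\<And>x. x \<in> topspace X \<Longrightarrow> g (f x) = x"
    and fg: "\<And>y. y \<in> topspace Y \<Longrightarrow> f (g y) = y"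
    by (auto simp: homeomorphic_maps_def)
  have f: "(X, f, Y) \<in> Hom Top X Y" using assms by (simp add: Hom_def)
  have im: "f ` topspace X \<subseteq> topspace Y" "g ` topspace Y \<subseteq> topspace X"
    using assms cg continuous_map_image_subset_topspace by (fastforce simp: Top_Arr)+
  show "is_iso Top (X, f, Y)"
  proof (rule Top.is_isoI[OF f])
    show "(Y, restrict g (topspace Y), X) \<in> Hom Top Y X"
      using assms cg by (intro Top_restrict_Hom) (auto simp: Top_Arr)
  qed (use im gf fg in \<open>auto simp: compose_def restrict_def fun_eq_iff\<close>)
qed

section \<open>Surjections and embeddings as a proper factorization system\<close>

lemma Top_surjections_iff:
  "(X, f, Y) \<in> Top_surjections \<longleftrightarrow> (X, f, Y) \<in> Arr Top \<and> f ` topspace X = topspace Y"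
  by (simp add: Top_surjections_def)

lemma Top_embeddings_iff:
  "(X, f, Y) \<in> Top_embeddings \<longleftrightarrow> (X, f, Y) \<in> Arr Top \<and> embedding_map X Y f"
  by (simp add: Top_embeddings_def)

lemma embedding_map_inverse:
  assumes "embedding_map X Y f"
  obtains g where "continuous_map (subtopology Y (f ` topspace X)) X g"
    "\<And>x. x \<in> topspace X \<Longrightarrow> g (f x) = x"
  using assms by (auto simp: embedding_map_def homeomorphic_map_maps homeomorphic_maps_def)

lemma embedding_map_inj: "embedding_map X Y f \<Longrightarrow> inj_on f (topspace X)"
  by (simp add: embedding_map_def homeomorphic_map_def)

lemma proper_factorization_system_Top:
  "proper_factorization_system (Top :: ('u topology, 'u top_arr) cat) Top_surjections Top_embeddings"
proof (intro proper_factorization_system.intro proper_factorization_system_axioms.intro category_Top)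
  show "Top_surjections \<subseteq> Arr (Top :: ('u topology, 'u top_arr) cat)"
    "Top_embeddings \<subseteq> Arr (Top :: ('u topology, 'u top_arr) cat)"
    by (auto simp: Top_surjections_def Top_embeddings_def)
  fix f g :: "'u top_arr"
  obtain X a Y where f: "f = (X, a, Y)" by (cases f)
  obtain Y' c Z where g: "g = (Y', c, Z)" by (cases g)
  show "f \<in> Top_surjections" if "is_iso Top f"
    using that Top_is_iso_iff[of X a Y] homeomorphic_imp_surjective_map[of X Y a]
    by (auto simp: f Top_surjections_iff is_iso_def)
  show "f \<in> Top_embeddings" if "is_iso Top f"
    using that Top_is_iso_iff[of X a Y] surjective_embedding_map[of X Y a]
    by (auto simp: f Top_embeddings_iff is_iso_def)
  show "g \<odot> f \<in> Top_surjections"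
    if "f \<in> Top_surjections" "g \<in> Top_surjections" "Cod Top f = Dom Top g"
  proof -
    have "g \<odot> f \<in> Hom Top X Z"
      using that by (intro Top.cmp_hom[of f X Y g Z]) (auto simp: f g Top_surjections_iff Hom_def)
    moreover have "compose (topspace X) c a ` topspace X = c ` a ` topspace X"
      by (auto simp: compose_def image_image)
    ultimately show ?thesis
      using that by (auto simp: f g Top_surjections_iff Hom_def)
  qed
  show "g \<odot> f \<in> Top_embeddings"
    if "f \<in> Top_embeddings" "g \<in> Top_embeddings" "Cod Top f = Dom Top g"
  proof -
    have "g \<odot> f \<in> Hom Top X Z"
      using that by (intro Top.cmp_hom[of f X Y g Z]) (auto simp: f g Top_embeddings_iff Hom_def)
    moreover have "embedding_map X Z (compose (topspace X) c a)"
      using that by (intro embedding_map_eq[OF embedding_map_compose[of X Y a Z c]])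
        (auto simp: f g Top_embeddings_iff compose_def)
    ultimately show ?thesis
      using that by (auto simp: f g Top_embeddings_iff Hom_def)
  qed
  show "\<exists>e\<in>Top_surjections. \<exists>m\<in>Top_embeddings. Cod Top e = Dom Top m \<and> f = m \<odot> e"
    if "f \<in> Arr Top"
  proof -
    have a: "small TYPE('u) (topspace X)" "small TYPE('u) (topspace Y)" "continuous_map X Y a"
      "a \<in> extensional (topspace X)"
      using that by (auto simp: f Top_Arr)
    have im: "a ` topspace X \<subseteq> topspace Y" by (rule continuous_map_image_subset_topspace[OF a(3)])
    \<comment> \<open>The image carries the topology induced from \<open>Y\<close>, not the quotient
      topology of \<open>X\<close>: the second factor has to be an embedding, the first only a
      surjection.\<close>
    define Q where "Q = subtopology Y (a ` topspace X)"
    have Q: "topspace Q = a ` topspace X" using im by (auto simp: Q_def)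
    have sQ: "small TYPE('u) (topspace Q)" unfolding Q by (rule small_image[OF a(1)])
    have "continuous_map X Q a"
      unfolding Q_def using a(3) by (simp add: continuous_map_in_subtopology image_subset_iff_funcset[symmetric])
    then have e: "(X, a, Q) \<in> Top_surjections"
      using a sQ Q by (simp add: Top_surjections_iff Top_Arr)
    have "subtopology Y (id ` topspace Q) = Q" unfolding Q by (simp add: Q_def)
    then have "embedding_map Q Y id" by (simp add: embedding_map_def)
    then have "embedding_map Q Y (restrict (\<lambda>x. x) (topspace Q))"
      by (rule embedding_map_eq) simp
    moreover have "continuous_map Q Y (\<lambda>x. x)"
      unfolding Q_def by (simp add: continuous_map_from_subtopology)
    ultimately have m: "(Q, restrict (\<lambda>x. x) (topspace Q), Y) \<in> Top_embeddings"
      using Top_restrict_Hom[OF sQ a(2), of "\<lambda>x. x"] by (simp add: Top_embeddings_iff Hom_def)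
    have "f = (Q, restrict (\<lambda>x. x) (topspace Q), Y) \<odot> (X, a, Q)"
      using a(4) Q by (auto simp: f compose_def restrict_def extensional_def fun_eq_iff)
    then show ?thesis using e m by (intro bexI[OF _ e] bexI[OF _ m]) simp
  qed
  show "is_epi Top f" if "f \<in> Top_surjections"
    unfolding is_epi_def
  proof (intro conjI ballI impI)
    fix W k l assume "k \<in> Hom Top (Cod Top f) W" "l \<in> Hom Top (Cod Top f) W"
      and eq: "k \<odot> f = l \<odot> f"
    then obtain k' l' where kl: "k = (Y, k', W)" "l = (Y, l', W)" "k' \<in> extensional (topspace Y)"
        "l' \<in> extensional (topspace Y)"
      by (auto simp: f elim!: Top_HomE)
    have surj: "a ` topspace X = topspace Y" using that by (simp add: f Top_surjections_iff)
    have "\<forall>y\<in>a ` topspace X. k' y = l' y" using eq by (simp add: kl f Top_cmp_eq_iff)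
    then have "k' = l'" unfolding surj by (intro extensionalityI[OF kl(3,4)]) blast
    then show "k = l" using kl by simp
  qed (use that in \<open>auto simp: Top_surjections_def\<close>)
  show "is_mono Top f" if "f \<in> Top_embeddings"
    unfolding is_mono_def
  proof (intro conjI ballI impI)
    fix W k l assume "k \<in> Hom Top W (Dom Top f)" "l \<in> Hom Top W (Dom Top f)"
      and eq: "f \<odot> k = f \<odot> l"
    then obtain k' l' where kl: "k = (W, k', X)" "l = (W, l', X)" "k' \<in> extensional (topspace W)"
        "l' \<in> extensional (topspace W)" "k' ` topspace W \<subseteq> topspace X" "l' ` topspace W \<subseteq> topspace X"
      by (auto simp: f elim!: Top_HomE)
    have "\<forall>x\<in>topspace W. a (k' x) = a (l' x)" using eq by (simp add: kl f Top_cmp_eq_iff)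
    then have "k' = l'"
      using kl(3-) that embedding_map_inj[of X Y a]
      by (intro extensionalityI) (auto simp: f Top_embeddings_iff inj_on_def image_subset_iff)
    then show "k = l" using kl by simp
  qed (use that in \<open>auto simp: Top_embeddings_def\<close>)
next
  fix e m u v :: "'u top_arr"
  assume e: "e \<in> Top_surjections" and m: "m \<in> Top_embeddings"
    and u: "u \<in> Hom Top (Dom Top e) (Dom Top m)" and v: "v \<in> Hom Top (Cod Top e) (Cod Top m)"
    and eq: "m \<odot> u = v \<odot> e"
  obtain A e' B where e': "e = (A, e', B)" by (cases e)
  obtain X m' Y where m': "m = (X, m', Y)" by (cases m)
  obtain u' where u': "u = (A, u', X)" "u' ` topspace A \<subseteq> topspace X" "u' \<in> extensional (topspace A)"
    using u by (auto simp: e' m' elim!: Top_HomE)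
  obtain v' where v': "v = (B, v', Y)" "continuous_map B Y v'" "v' \<in> extensional (topspace B)"
    using v by (auto simp: e' m' elim!: Top_HomE)
  have e'': "e' ` topspace A = topspace B" using e by (simp add: e' Top_surjections_iff)
  have em: "embedding_map X Y m'" using m by (simp add: m' Top_embeddings_iff)
  have sm: "small TYPE('u) (topspace B)" "small TYPE('u) (topspace X)"
    using e m by (auto simp: e' m' Top_surjections_iff Top_embeddings_iff Top_Arr)
  have sq: "m' (u' a) = v' (e' a)" if "a \<in> topspace A" for a
    using eq that by (simp add: e' m' u' v' Top_cmp_eq_iff)
  obtain g where g: "continuous_map (subtopology Y (m' ` topspace X)) X g"
      "\<And>x. x \<in> topspace X \<Longrightarrow> g (m' x) = x"
    using em by (rule embedding_map_inverse) blast
  \<comment> \<open>Since \<open>e'\<close> is onto, the square forces \<open>v'\<close> to land in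
    the image of the embedding, where the continuous inverse \<open>g\<close> is available.\<close>
  define d where "d = restrict (g \<circ> v') (topspace B)"
  have "v' ` topspace B \<subseteq> m' ` topspace X"
    unfolding e''[symmetric] using u'(2) by (auto simp: sq[symmetric])
  then have "continuous_map B (subtopology Y (m' ` topspace X)) v'"
    using v'(2) by (simp add: continuous_map_in_subtopology image_subset_iff_funcset)
  then have "continuous_map B X (g \<circ> v')" using g(1) by (rule continuous_map_compose)
  then have d: "(B, d, X) \<in> Hom Top B X" unfolding d_def using sm by (intro Top_restrict_Hom)
  have de: "d (e' a) = u' a" if "a \<in> topspace A" for a
    using that u'(2) e'' by (auto simp: d_def sq[symmetric] g(2) image_subset_iff)
  show "\<exists>!d. d \<in> Hom Top (Cod Top e) (Dom Top m) \<and> d \<odot> e = u \<and> m \<odot> d = v"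
  proof (intro ex1I conjI)
    show "(B, d, X) \<in> Hom Top (Cod Top e) (Dom Top m)" using d by (simp add: e' m')
    show "(B, d, X) \<odot> e = u"
      using de u'(3) by (auto simp: e' u'(1) compose_def restrict_def extensional_def fun_eq_iff)
    have "m' (d b) = v' b" if "b \<in> topspace B" for b
      using that unfolding e''[symmetric] by (auto simp: de sq)
    then show "m \<odot> (B, d, X) = v"
      using v'(3) by (auto simp: m' v'(1) compose_def restrict_def extensional_def fun_eq_iff)
  next
    fix k assume k: "k \<in> Hom Top (Cod Top e) (Dom Top m) \<and> k \<odot> e = u \<and> m \<odot> k = v"
    then obtain k' where k': "k = (B, k', X)" "k' \<in> extensional (topspace B)"
      by (auto simp: e' m' elim!: Top_HomE)
    have "k' (e' a) = u' a" if "a \<in> topspace A" for a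
      using k that by (auto simp: k'(1) e' u'(1) compose_def restrict_def fun_eq_iff; metis)
    then have "k' = d"
      using k'(2) de unfolding d_def
      by (intro extensionalityI[of _ "topspace B"]) (auto simp: e''[symmetric] d_def)
    then show "k = (B, d, X)" using k' by simp
  qed
qed

text \<open>The pullback is realized as a subspace of \<open>A\<close>, so no pairs of points have
  to be coded in the universe. The second leg comes from the continuous inverse of \<open>g'\<close>
  on its image.\<close>

lemma Top_pullback_exists:
  assumes f: "f \<in> Top_embeddings" and g: "g \<in> Top_embeddings" and cod: "Cod Top f = Cod Top g"
  shows "\<exists>p q. is_pullback (Top :: ('u topology, 'u top_arr) cat) f g p q"
proof -
  obtain A f' Z where f': "f = (A, f', Z)" by (cases f)
  then obtain B g' where g': "g = (B, g', Z)" using cod by (cases g) simp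
  have em: "embedding_map A Z f'" "embedding_map B Z g'"
    and arr: "f \<in> Arr Top" "g \<in> Arr Top"
    and sm: "small TYPE('u) (topspace A)" "small TYPE('u) (topspace B)"
    and cf: "continuous_map A Z f'"
    using f g by (auto simp: f' g' Top_embeddings_iff Top_Arr)
  obtain h where h: "continuous_map (subtopology Z (g' ` topspace B)) B h"
      "\<And>x. x \<in> topspace B \<Longrightarrow> h (g' x) = x"
    using em(2) by (rule embedding_map_inverse) blast
  define P where "P = subtopology A {a \<in> topspace A. f' a \<in> g' ` topspace B}"
  have P: "topspace P = {a \<in> topspace A. f' a \<in> g' ` topspace B}" by (auto simp: P_def)
  have sP: "small TYPE('u) (topspace P)" by (rule small_subset[OF sm(1)]) (auto simp: P)
  define p where "p = (P, restrict (\<lambda>x. x) (topspace P), A)"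
  define q where "q = (P, restrict (h \<circ> f') (topspace P), B)"
  have p: "p \<in> Hom Top P A"
    unfolding p_def P_def using sP sm by (intro Top_restrict_Hom) (auto simp: P_def continuous_map_from_subtopology)
  have "continuous_map P (subtopology Z (g' ` topspace B)) f'"
    using cf by (auto simp: continuous_map_in_subtopology P_def continuous_map_from_subtopology)
  then have q: "q \<in> Hom Top P B"
    unfolding q_def using sP sm continuous_map_compose[OF _ h(1)] by (intro Top_restrict_Hom) auto
  have fp: "f \<odot> p = g \<odot> q"
    using h(2) by (auto simp: f' g' p_def q_def Top_cmp_eq_iff P)
  have "\<exists>!k. k \<in> Hom Top W P \<and> p \<odot> k = a \<and> q \<odot> k = b"
    if a: "a \<in> Hom Top W A" and b: "b \<in> Hom Top W B" and ab: "f \<odot> a = g \<odot> b" for W a b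
  proof -
    obtain a' where a': "a = (W, a', A)" "small TYPE('u) (topspace W)" "continuous_map W A a'"
        "a' \<in> extensional (topspace W)" "a' ` topspace W \<subseteq> topspace A"
      using a by (rule Top_HomE) blast
    obtain b' where b': "b = (W, b', B)" "b' \<in> extensional (topspace W)" "b' ` topspace W \<subseteq> topspace B"
      using b by (rule Top_HomE) blast
    have sq: "f' (a' w) = g' (b' w)" if "w \<in> topspace W" for w
      using ab that by (simp add: f' g' a'(1) b'(1) Top_cmp_eq_iff)
    have aP: "a' w \<in> topspace P" if "w \<in> topspace W" for w
      using that a'(5) b'(3) by (auto simp: P sq)
    have k: "(W, a', P) \<in> Hom Top W P"
      using a' sP aP by (auto simp: Top_Hom P_def continuous_map_in_subtopology)
    show ?thesis
    proof (intro ex1I[of _ "(W, a', P)"] conjI)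
      show "(W, a', P) \<in> Hom Top W P" by (rule k)
      show "p \<odot> (W, a', P) = a"
        using a'(4) aP by (auto simp: p_def a'(1) compose_def restrict_def extensional_def fun_eq_iff)
      have "h (g' (b' w)) = b' w" if "w \<in> topspace W" for w
        using h(2) b'(3) that by blast
      then show "q \<odot> (W, a', P) = b"
        using b'(2) aP by (auto simp: q_def b'(1) compose_def restrict_def extensional_def fun_eq_iff sq)
      fix k assume k: "k \<in> Hom Top W P \<and> p \<odot> k = a \<and> q \<odot> k = b"
      then obtain k' where k': "k = (W, k', P)" "k' \<in> extensional (topspace W)" "k' ` topspace W \<subseteq> topspace P"
        by (blast elim: Top_HomE)
      have "compose (topspace W) (restrict (\<lambda>x. x) (topspace P)) k' = a'"
        using k by (simp add: k'(1) p_def a'(1))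
      then have "k' = a'"
        using k'(2,3) by (auto simp: compose_def restrict_def extensional_def fun_eq_iff image_subset_iff) metis
      then show "k = (W, a', P)" using k' by simp
    qed
  qed
  moreover have "f \<in> Hom Top A Z" "g \<in> Hom Top B Z" using arr by (simp_all add: f' g' Hom_def)
  ultimately have "is_pullback Top f g p q" using p q fp by (intro Top.is_pullbackI)
  then show ?thesis by blast
qed

text \<open>Points of the pushout have to be elements of \<open>'u\<close>, so equivalence classes
  are replaced by chosen representatives in \<open>X\<close>.\<close>

lemma Top_pushout_exists:
  assumes f: "f \<in> Top_surjections" and g: "g \<in> Top_surjections" and dom: "Dom Top f = Dom Top g"
  shows "\<exists>i j. is_pushout (Top :: ('u topology, 'u top_arr) cat) f g i j"
proof -
  obtain X f' A where f': "f = (X, f', A)" by (cases f)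
  then obtain g' B where g': "g = (X, g', B)" using dom by (cases g) simp
  have surj: "f' ` topspace X = topspace A" "g' ` topspace X = topspace B"
    and arr: "f \<in> Arr Top" "g \<in> Arr Top"
    and sm: "small TYPE('u) (topspace X)" "small TYPE('u) (topspace A)" "small TYPE('u) (topspace B)"
    using f g by (auto simp: f' g' Top_surjections_iff Top_Arr)
  define T where "T = topspace X"
  define kf where "kf = {(x, y) \<in> T \<times> T. f' x = f' y}"
  define kg where "kg = {(x, y) \<in> T \<times> T. g' x = g' y}"
  \<comment> \<open>The two maps are onto, so the pushout is a quotient of \<open>X\<close>: it
    makes exactly the identifications generated by the two kernels.\<close>
  define r where "r = (kf \<union> kg)\<^sup>+"
  have "equiv T kf" "equiv T kg"
    unfolding kf_def kg_def by (intro equivI refl_onI symI transI; auto)+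
  then have r: "equiv T r" unfolding r_def by (rule equiv_trancl_Un)
  define rep where "rep x = (SOME y. (x, y) \<in> r)" for x
  have rep: "(x, rep x) \<in> r" if "x \<in> T" for x
    unfolding rep_def by (rule someI[of _ x]) (rule equiv_reflD[OF r that])
  have rep_eq: "rep x = rep y" if "(x, y) \<in> r" for x y
  proof -
    have "(x, z) \<in> r \<longleftrightarrow> (y, z) \<in> r" for z
      using that equiv_symD[OF r] equiv_transD[OF r] by blast
    then show ?thesis by (simp add: rep_def)
  qed
  define i where "i a = rep (inv_into T f' a)" for a
  define j where "j b = rep (inv_into T g' b)" for b
  have i_rep: "i (f' x) = rep x" if "x \<in> T" for x
  proof -
    have "(inv_into T f' (f' x), x) \<in> kf"
      using that by (auto simp: kf_def f_inv_into_f inv_into_into)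
    then show ?thesis unfolding i_def by (intro rep_eq) (auto simp: r_def)
  qed
  have j_rep: "j (g' x) = rep x" if "x \<in> T" for x
  proof -
    have "(inv_into T g' (g' x), x) \<in> kg"
      using that by (auto simp: kg_def f_inv_into_f inv_into_into)
    then show ?thesis unfolding j_def by (intro rep_eq) (auto simp: r_def)
  qed
  have A: "topspace A = f' ` T" and B: "topspace B = g' ` T" using surj by (simp_all add: T_def)
  \<comment> \<open>The final topology for the maps \<open>i\<close> and \<open>j\<close>; this is
    what makes a map out of the pushout continuous as soon as its two components are.\<close>
  define opn where "opn V \<longleftrightarrow> V \<subseteq> rep ` T \<and> openin A {a \<in> topspace A. i a \<in> V} \<and>
    openin B {b \<in> topspace B. j b \<in> V}" for V
  define P where "P = topology opn"
  have "istopology opn"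
    unfolding istopology_def
  proof (intro conjI allI impI)
    fix V W assume "opn V" "opn W"
    moreover have "{a \<in> topspace A. i a \<in> V \<inter> W} = {a \<in> topspace A. i a \<in> V} \<inter> {a \<in> topspace A. i a \<in> W}"
      "{b \<in> topspace B. j b \<in> V \<inter> W} = {b \<in> topspace B. j b \<in> V} \<inter> {b \<in> topspace B. j b \<in> W}" by auto
    ultimately show "opn (V \<inter> W)" by (auto simp: opn_def)
  next
    fix K assume K: "\<forall>V\<in>K. opn V"
    have "{a \<in> topspace A. i a \<in> \<Union>K} = (\<Union>V\<in>K. {a \<in> topspace A. i a \<in> V})"
      "{b \<in> topspace B. j b \<in> \<Union>K} = (\<Union>V\<in>K. {b \<in> topspace B. j b \<in> V})" by auto
    moreover have "openin A (\<Union>V\<in>K. {a \<in> topspace A. i a \<in> V})" "openin B (\<Union>V\<in>K. {b \<in> topspace B. j b \<in> V})"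
      using K by (auto simp: opn_def)
    moreover have "\<Union>K \<subseteq> rep ` T" using K by (auto simp: opn_def)
    ultimately show "opn (\<Union>K)" unfolding opn_def by simp
  qed
  then have open_P: "openin P V \<longleftrightarrow> opn V" for V by (simp add: P_def topology_inverse')
  have iA: "i a \<in> rep ` T" if "a \<in> topspace A" for a using that i_rep by (auto simp: A)
  have jB: "j b \<in> rep ` T" if "b \<in> topspace B" for b using that j_rep by (auto simp: B)
  have "{a \<in> topspace A. i a \<in> rep ` T} = topspace A" "{b \<in> topspace B. j b \<in> rep ` T} = topspace B"
    using iA jB by auto
  then have "openin P (rep ` T)" by (simp add: open_P opn_def)
  then have P: "topspace P = rep ` T"
    using open_P[of "topspace P"] openin_subset by (fastforce simp: opn_def)
  have sP: "small TYPE('u) (topspace P)" unfolding P T_def by (rule small_image[OF sm(1)])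
  define p where "p = (A, restrict i (topspace A), P)"
  define q where "q = (B, restrict j (topspace B), P)"
  have p: "p \<in> Hom Top A P"
    unfolding p_def using sm sP iA
    by (intro Top_restrict_Hom) (auto simp: continuous_map_def P open_P opn_def)
  have q: "q \<in> Hom Top B P"
    unfolding q_def using sm sP jB
    by (intro Top_restrict_Hom) (auto simp: continuous_map_def P open_P opn_def)
  have sq: "p \<odot> f = q \<odot> g"
    unfolding p_def q_def f' g' using i_rep j_rep surj
    by (auto simp: Top_cmp_eq_iff T_def A B)
  have "\<exists>!k. k \<in> Hom Top P W \<and> k \<odot> p = a \<and> k \<odot> q = b"
    if a: "a \<in> Hom Top A W" and b: "b \<in> Hom Top B W" and ab: "a \<odot> f = b \<odot> g" for W a b
  proof -
    obtain a' where a': "a = (A, a', W)" "small TYPE('u) (topspace W)" "continuous_map A W a'"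
        "a' \<in> extensional (topspace A)" "a' ` topspace A \<subseteq> topspace W"
      using a by (rule Top_HomE) blast
    obtain b' where b': "b = (B, b', W)" "continuous_map B W b'" "b' \<in> extensional (topspace B)"
      using b by (rule Top_HomE) blast
    have ab': "a' (f' x) = b' (g' x)" if "x \<in> T" for x
      using ab that by (simp add: f' g' a'(1) b'(1) Top_cmp_eq_iff T_def)
    have "equiv T {(x, y) \<in> T \<times> T. a' (f' x) = a' (f' y)}"
      by (intro equivI refl_onI symI transI) auto
    then have "r \<subseteq> {(x, y) \<in> T \<times> T. a' (f' x) = a' (f' y)}"
      unfolding r_def by (rule trancl_Un_least) (auto simp: kf_def kg_def ab')
    then have r_a: "a' (f' x) = a' (f' y)" if "(x, y) \<in> r" for x y using that by auto
    define k where "k = restrict (a' \<circ> f') (topspace P)"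
    have repT: "rep x \<in> T" if "x \<in> T" for x using rep[OF that] equiv_subset[OF r] by auto
    have k_rep: "k (rep x) = a' (f' x)" if "x \<in> T" for x
      using that r_a[OF rep[OF that]] by (simp add: k_def P)
    have k_i: "k (i a) = a' a" if "a \<in> topspace A" for a using that i_rep k_rep by (auto simp: A)
    have k_j: "k (j b) = b' b" if "b \<in> topspace B" for b using that j_rep k_rep ab' by (auto simp: B)
    have "continuous_map P W k"
      unfolding continuous_map_def
    proof (intro conjI allI impI)
      show "k \<in> topspace P \<rightarrow> topspace W"
        using k_rep a'(5) by (auto simp: P A image_subset_iff)
      fix U assume U: "openin W U"
      have "{a \<in> topspace A. i a \<in> {y \<in> topspace P. k y \<in> U}} = {a \<in> topspace A. a' a \<in> U}"
        using iA by (auto simp: P k_i[symmetric])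
      moreover have "{b \<in> topspace B. j b \<in> {y \<in> topspace P. k y \<in> U}} = {b \<in> topspace B. b' b \<in> U}"
        using jB by (auto simp: P k_j[symmetric])
      ultimately show "openin P {y \<in> topspace P. k y \<in> U}"
        using a'(3) b'(2) U by (auto simp: open_P opn_def P continuous_map_def)
    qed
    then have k: "(P, k, W) \<in> Hom Top P W" using sP a'(2) by (simp add: Top_Hom k_def)
    show ?thesis
    proof (intro ex1I[of _ "(P, k, W)"] conjI)
      show "(P, k, W) \<in> Hom Top P W" by (rule k)
      show "(P, k, W) \<odot> p = a"
        using a'(4) k_i by (auto simp: p_def a'(1) compose_def restrict_def extensional_def fun_eq_iff)
      show "(P, k, W) \<odot> q = b"
        using b'(3) k_j by (auto simp: q_def b'(1) compose_def restrict_def extensional_def fun_eq_iff)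
      fix l assume l: "l \<in> Hom Top P W \<and> l \<odot> p = a \<and> l \<odot> q = b"
      then obtain l' where l': "l = (P, l', W)" "l' \<in> extensional (topspace P)"
        by (blast elim: Top_HomE)
      have eq: "compose (topspace A) l' (restrict i (topspace A)) = a'"
        using l by (simp add: l'(1) p_def a'(1))
      have "l' (rep x) = k (rep x)" if "x \<in> T" for x
        using fun_cong[OF eq, of "f' x"] that i_rep k_rep by (simp add: compose_def A)
      then have "l' = k"
        by (intro extensionalityI[OF l'(2), of k]) (auto simp: k_def P)
      then show "l = (P, k, W)" using l' by simp
    qed
  qed
  moreover have "f \<in> Hom Top X A" "g \<in> Hom Top X B" using arr by (simp_all add: f' g' Hom_def)
  ultimately have "is_pushout Top f g p q" using p q sq by (intro Top.is_pushoutI)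
  then show ?thesis by blast
qed

lemma pfs_category_Top:
  "pfs_category (Top :: ('u topology, 'u top_arr) cat) Top_surjections Top_embeddings"
  by (intro pfs_category.intro pfs_category_axioms.intro proper_factorization_system_Top
      Top_pullback_exists Top_pushout_exists)

section \<open>From a noetherian form to a transfer functor\<close>

locale inducing_form = noetherian_form C F + pfs_category C E M
  for C :: "('o, 'm) cat" (structure) and F :: "('o, 'm, 'u) form" and E M +
  assumes induced: "induces C F E M"
begin

abbreviation K :: "'o \<Rightarrow> 'u set" where
  "K X \<equiv> carrier (fib F X)"

abbreviation le_in :: "'u \<Rightarrow> 'o \<Rightarrow> 'u \<Rightarrow> bool"  ("_ \<sqsubseteq>[_] _" [51, 0, 51] 50) where
  "S \<sqsubseteq>[X] T \<equiv> S \<sqsubseteq>\<^bsub>fib F X\<^esub> T"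

section \<open>Order and adjunction in the fibres of a given form\<close>

lemma le_antisymF:
  assumes X: "X \<in> Obj C" and "S \<sqsubseteq>[X] T" "T \<sqsubseteq>[X] S" "S \<in> K X" "T \<in> K X"
  shows "S = T"
proof -
  interpret bounded_lattice "fib F X" by (rule fib_lattice[OF X])
  show ?thesis using assms(2-) by (rule le_antisym)
qed

lemma unit:
  assumes f: "f \<in> Hom C X Y" and S: "S \<in> K X"
  shows "S \<sqsubseteq>[X] pull F f (push F f S)"
proof -
  interpret bounded_lattice "fib F Y" by (rule fib_lattice[OF hom_objs(2)[OF f]])
  show ?thesis using adjunction[OF f S push_closed[OF f S]] push_closed[OF f S] by simp
qed

lemma counit:
  assumes f: "f \<in> Hom C X Y" and T: "T \<in> K Y"
  shows "push F f (pull F f T) \<sqsubseteq>[Y] T"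
proof -
  interpret bounded_lattice "fib F X" by (rule fib_lattice[OF hom_objs(1)[OF f]])
  show ?thesis using adjunction[OF f pull_closed[OF f T] T] pull_closed[OF f T] by simp
qed

lemma push_le:
  "f \<in> Hom C X Y \<Longrightarrow> S \<in> K X \<Longrightarrow> S' \<in> K X \<Longrightarrow> S \<sqsubseteq>[X] S' \<Longrightarrow> push F f S \<sqsubseteq>[Y] push F f S'"
  using push_mono use_iso2 by fast

lemma pull_le:
  "f \<in> Hom C X Y \<Longrightarrow> T \<in> K Y \<Longrightarrow> T' \<in> K Y \<Longrightarrow> T \<sqsubseteq>[Y] T' \<Longrightarrow> pull F f T \<sqsubseteq>[X] pull F f T'"
  using pull_mono use_iso2 by fast

lemma push_pull_push:
  assumes f: "f \<in> Hom C X Y" and S: "S \<in> K X"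
  shows "push F f (pull F f (push F f S)) = push F f S"
proof -
  note p = push_closed[OF f S] and q = pull_closed[OF f push_closed[OF f S]]
  show ?thesis
    using le_antisymF[OF hom_objs(2)[OF f] counit[OF f p] push_le[OF f S q unit[OF f S]]]
      push_closed[OF f q] p by blast
qed

lemma bot_closed: "X \<in> Obj C \<Longrightarrow> \<bottom>\<^bsub>fib F X\<^esub> \<in> K X"
  and bot_le: "X \<in> Obj C \<Longrightarrow> S \<in> K X \<Longrightarrow> \<bottom>\<^bsub>fib F X\<^esub> \<sqsubseteq>[X] S"
  and top_closed: "X \<in> Obj C \<Longrightarrow> \<top>\<^bsub>fib F X\<^esub> \<in> K X"
  and le_top: "X \<in> Obj C \<Longrightarrow> S \<in> K X \<Longrightarrow> S \<sqsubseteq>[X] \<top>\<^bsub>fib F X\<^esub>"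
proof -
  assume X: "X \<in> Obj C"
  interpret bounded_lattice "fib F X" by (rule fib_lattice[OF X])
  show "\<bottom>\<^bsub>fib F X\<^esub> \<in> K X" "\<top>\<^bsub>fib F X\<^esub> \<in> K X"
    "S \<in> K X \<Longrightarrow> \<bottom>\<^bsub>fib F X\<^esub> \<sqsubseteq>[X] S" "S \<in> K X \<Longrightarrow> S \<sqsubseteq>[X] \<top>\<^bsub>fib F X\<^esub>"
    by simp_all
qed

lemma Ker_closed: "f \<in> Hom C X Y \<Longrightarrow> Ker C F f \<in> K X"
  unfolding Ker_def using pull_closed bot_closed hom_objs hom_cod by metis

lemma Im_closed: "f \<in> Hom C X Y \<Longrightarrow> Im C F f \<in> K Y"
  unfolding Im_def using push_closed top_closed hom_objs hom_dom by metis

lemma Ker_cmp: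
  assumes f: "f \<in> Hom C X Y" and g: "g \<in> Hom C Y Z"
  shows "Ker C F f \<sqsubseteq>[X] Ker C F (g \<cdot> f)"
proof -
  have "Ker C F (g \<cdot> f) = pull F f (pull F g \<bottom>\<^bsub>fib F Z\<^esub>)"
    unfolding Ker_def hom_cod[OF cmp_hom[OF f g]] by (rule pull_cmp[OF f g bot_closed[OF hom_objs(2)[OF g]]])
  then show ?thesis
    unfolding Ker_def hom_cod[OF f]
    using pull_le[OF f] bot_le bot_closed pull_closed[OF g] hom_objs[OF g] by simp
qed

lemma Im_cmp:
  assumes f: "f \<in> Hom C X Y" and g: "g \<in> Hom C Y Z"
  shows "Im C F (g \<cdot> f) \<sqsubseteq>[Z] Im C F g"
proof -
  have "Im C F (g \<cdot> f) = push F g (push F f \<top>\<^bsub>fib F X\<^esub>)"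
    unfolding Im_def hom_dom[OF cmp_hom[OF f g]] by (rule push_cmp[OF f g top_closed[OF hom_objs(1)[OF f]]])
  then show ?thesis
    unfolding Im_def hom_dom[OF g]
    using push_le[OF g] le_top top_closed push_closed[OF f] hom_objs[OF f] by simp
qed

lemma Ker_idn: "X \<in> Obj C \<Longrightarrow> Ker C F (Idn C X) = \<bottom>\<^bsub>fib F X\<^esub>"
  unfolding Ker_def using hom_cod[OF idn_hom] pull_idn bot_closed by metis

lemma Im_idn: "X \<in> Obj C \<Longrightarrow> Im C F (Idn C X) = \<top>\<^bsub>fib F X\<^esub>"
  unfolding Im_def using hom_dom[OF idn_hom] push_idn top_closed by metis

section \<open>How left-class and right-class morphisms act on the fibres\<close>

lemma E_quotient:
  assumes "e \<in> E" "e \<in> Hom C X Q"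
  shows "quotient_of C F X (Ker C F e) e"
  using assms induced by (auto simp: induces_def form_quotients_def quotient_of_def Hom_def)

lemma M_embedding:
  assumes "m \<in> M" "m \<in> Hom C Q Y"
  shows "embedding_of C F Y (Im C F m) m"
  using assms induced by (auto simp: induces_def form_embeddings_def embedding_of_def Hom_def)

lemma quotientD:
  assumes q: "quotient_of C F X S e" and g: "g \<in> Hom C X Z" and le: "S \<sqsubseteq>[X] Ker C F g"
  obtains h where "h \<in> Hom C (Cod C e) Z" "g = h \<cdot> e"
  using q le hom_arr[OF g] hom_dom[OF g] hom_cod[OF g] unfolding quotient_of_def by blast

lemma embeddingD:
  assumes q: "embedding_of C F Y S m" and g: "g \<in> Hom C Z Y" and le: "Im C F g \<sqsubseteq>[Y] S"
  obtains h where "h \<in> Hom C Z (Dom C m)" "g = m \<cdot> h"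
  using q le hom_arr[OF g] hom_dom[OF g] hom_cod[OF g] unfolding embedding_of_def by blast

text \<open>Unlike \<open>factorizationE\<close>, this comes from (N2) and therefore also controls
  the kernel of the left factor and the image of the right factor; \<open>induced\<close> places the
  factors in \<open>E\<close> and \<open>M\<close>.\<close>

lemma form_factorizationE:
  assumes f: "f \<in> Hom C X Y"
  obtains Q e m where "e \<in> E" "m \<in> M" "e \<in> Hom C X Q" "m \<in> Hom C Q Y" "f = m \<cdot> e"
    "Ker C F e = Ker C F f" "Im C F m = Im C F f"
proof -
  obtain e m where em: "quotient_of C F X (Ker C F f) e" "embedding_of C F Y (Im C F f) m"
      "Cod C e = Dom C m" "f = m \<cdot> e"
    using form_factorization[OF f] by blast
  have "e \<in> E" "m \<in> M"
    using em hom_objs[OF f] induced by (auto simp: induces_def form_quotients_def form_embeddings_def)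
  then show ?thesis
    using that[of e m "Dom C m"] em by (auto simp: quotient_of_def embedding_of_def Hom_def)
qed

text \<open>In the factorization of (N2) the left factor of \<open>e\<close> has the kernel of
  \<open>e\<close>, so it is \<open>h \<cdot> e\<close>. As \<open>e\<close> is an epimorphism,
  \<open>m \<cdot> h\<close> is the identity, whose image is the top; hence so is that of
  \<open>m\<close>.\<close>

lemma E_Im:
  assumes e: "e \<in> E" "e \<in> Hom C X Q"
  shows "Im C F e = \<top>\<^bsub>fib F Q\<^esub>"
proof -
  obtain P e' m where em: "e' \<in> E" "m \<in> M" "e' \<in> Hom C X P" "m \<in> Hom C P Q" "e = m \<cdot> e'"
      "Ker C F e' = Ker C F e" "Im C F m = Im C F e"
    using e(2) by (rule form_factorizationE)
  have "Ker C F e \<sqsubseteq>[X] Ker C F e'"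
    using Ker_cmp[OF e(2) idn_hom[OF hom_objs(2)[OF e(2)]]] idn_left[OF e(2)] em(6) by simp
  then obtain h where h: "h \<in> Hom C Q P" "e' = h \<cdot> e"
    using quotientD[OF E_quotient[OF e] em(3)] hom_cod[OF e(2)] by auto
  have Q: "Q \<in> Obj C" using hom_objs[OF e(2)] by simp
  have "(m \<cdot> h) \<cdot> e = Idn C Q \<cdot> e"
    by (simp only: cmp_assoc[OF e(2) h(1) em(4)] h(2)[symmetric] em(5)[symmetric] idn_left[OF e(2)])
  then have "m \<cdot> h = Idn C Q"
    using epiD[OF E_epi[OF e(1)] e(2)] cmp_hom[OF h(1) em(4)] idn_hom[OF Q] by blast
  then have "\<top>\<^bsub>fib F Q\<^esub> \<sqsubseteq>[Q] Im C F e"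
    using Im_cmp[OF h(1) em(4)] Im_idn[OF Q] em(7) by simp
  then show ?thesis
    using le_antisymF[OF Q] le_top[OF Q Im_closed[OF e(2)]] Im_closed[OF e(2)] top_closed[OF Q] by blast
qed

text \<open>Dual to \<open>E_Im\<close>: the right factor of \<open>m\<close> has the image of
  \<open>m\<close>, so it factors through \<open>m\<close>, and the identity factors through the
  left factor.\<close>

lemma M_Ker:
  assumes m: "m \<in> M" "m \<in> Hom C Q Y"
  shows "Ker C F m = \<bottom>\<^bsub>fib F Q\<^esub>"
proof -
  obtain P e m' where em: "e \<in> E" "m' \<in> M" "e \<in> Hom C Q P" "m' \<in> Hom C P Y" "m = m' \<cdot> e"
      "Ker C F e = Ker C F m" "Im C F m' = Im C F m"
    using m(2) by (rule form_factorizationE)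
  have "Im C F m' \<sqsubseteq>[Y] Im C F m"
    using Im_cmp[OF idn_hom[OF hom_objs(1)[OF m(2)]] m(2)] idn_right[OF m(2)] em(7) by simp
  then obtain h where h: "h \<in> Hom C P Q" "m' = m \<cdot> h"
    using embeddingD[OF M_embedding[OF m] em(4)] hom_dom[OF m(2)] by auto
  have Q: "Q \<in> Obj C" using hom_objs[OF m(2)] by simp
  have "m \<cdot> (h \<cdot> e) = m \<cdot> Idn C Q"
    by (simp only: cmp_assoc[OF em(3) h(1) m(2), symmetric] h(2)[symmetric] em(5)[symmetric] idn_right[OF m(2)])
  then have "h \<cdot> e = Idn C Q"
    using monoD[OF M_mono[OF m(1)] m(2)] cmp_hom[OF em(3) h(1)] idn_hom[OF Q] by blast
  then have "Ker C F m \<sqsubseteq>[Q] \<bottom>\<^bsub>fib F Q\<^esub>"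
    using Ker_cmp[OF em(3) h(1)] Ker_idn[OF Q] em(6) by simp
  then show ?thesis
    using le_antisymF[OF Q] bot_le[OF Q Ker_closed[OF m(2)]] Ker_closed[OF m(2)] bot_closed[OF Q] by blast
qed

text \<open>The image of \<open>e\<close> is the top, so the meet in (N1) disappears. Thus
  \<open>pull F e\<close> is a section and \<open>push F e\<close> is onto.\<close>

lemma push_pull_E:
  assumes e: "e \<in> E" "e \<in> Hom C X Q" and T: "T \<in> K Q"
  shows "push F e (pull F e T) = T"
proof -
  interpret bounded_lattice "fib F Q" by (rule fib_lattice[OF hom_objs(2)[OF e(2)]])
  show ?thesis using push_pull[OF e(2) T] T unfolding E_Im[OF e] by (simp add: meet_eqI)
qed

text \<open>The kernel of \<open>m\<close> is the bottom, so the join in (N1) disappears and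
  \<open>push F m\<close> is injective.\<close>

lemma pull_push_M:
  assumes m: "m \<in> M" "m \<in> Hom C Q Y" and S: "S \<in> K Q"
  shows "pull F m (push F m S) = S"
proof -
  interpret bounded_lattice "fib F Q" by (rule fib_lattice[OF hom_objs(1)[OF m(2)]])
  show ?thesis using pull_push[OF m(2) S] S unfolding M_Ker[OF m] by (simp add: join_eqI)
qed

lemma push_M_inj:
  "m \<in> M \<Longrightarrow> m \<in> Hom C Q Y \<Longrightarrow> S \<in> K Q \<Longrightarrow> S' \<in> K Q \<Longrightarrow> push F m S = push F m S' \<Longrightarrow> S = S'"
  using pull_push_M by metis

text \<open>By (N3) the join is the kernel of some \<open>d\<close>. Being above both kernels, it
  makes \<open>d\<close> factor through \<open>e\<close> and \<open>e'\<close>, hence through the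
  pushout, which bounds \<open>Ker C F (i \<cdot> e)\<close> from above; the other bound holds since
  \<open>i \<cdot> e\<close> factors through both.\<close>

lemma Ker_pushout:
  assumes e: "e \<in> E" "e \<in> Hom C X A" and e': "e' \<in> E" "e' \<in> Hom C X B"
    and po: "is_pushout C e e' i j"
  shows "Ker C F (i \<cdot> e) = Ker C F e \<squnion>\<^bsub>fib F X\<^esub> Ker C F e'"
proof -
  have X: "X \<in> Obj C" using hom_objs e by blast
  interpret bounded_lattice "fib F X" by (rule fib_lattice[OF X])
  obtain P where P: "P \<in> Obj C" "i \<in> Hom C A P" "j \<in> Hom C B P" "i \<cdot> e = j \<cdot> e'"
    and univ: "\<And>W a b. a \<in> Hom C A W \<Longrightarrow> b \<in> Hom C B W \<Longrightarrow> a \<cdot> e = b \<cdot> e' \<Longrightarrow>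
       \<exists>!h. h \<in> Hom C P W \<and> h \<cdot> i = a \<and> h \<cdot> j = b"
    using po e(2) e'(2) by (rule is_pushoutE) blast
  note ker = Ker_closed[OF e(2)] Ker_closed[OF e'(2)]
  have "normal C F X (Ker C F e)" "normal C F X (Ker C F e')"
    using e(2) e'(2) by (auto simp: normal_def Hom_def)
  then have "normal C F X (Ker C F e \<squnion>\<^bsub>fib F X\<^esub> Ker C F e')" by (rule normal_join[OF X])
  then obtain d where d: "d \<in> Hom C X (Cod C d)" "Ker C F d = Ker C F e \<squnion>\<^bsub>fib F X\<^esub> Ker C F e'"
    by (auto simp: normal_def Hom_def)
  obtain u where u: "u \<in> Hom C A (Cod C d)" "d = u \<cdot> e"
    using quotientD[OF E_quotient[OF e] d(1)] d(2) join_left[OF ker] hom_cod[OF e(2)] by auto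
  obtain v where v: "v \<in> Hom C B (Cod C d)" "d = v \<cdot> e'"
    using quotientD[OF E_quotient[OF e'] d(1)] d(2) join_right[OF ker] hom_cod[OF e'(2)] by auto
  obtain h where h: "h \<in> Hom C P (Cod C d)" "h \<cdot> i = u"
    using univ[OF u(1) v(1)] u(2) v(2) by metis
  have ie: "i \<cdot> e \<in> Hom C X P" using cmp_hom[OF e(2) P(2)] .
  have "d = h \<cdot> (i \<cdot> e)" using cmp_assoc[OF e(2) P(2) h(1)] h(2) u(2) by simp
  then have "Ker C F (i \<cdot> e) \<sqsubseteq>[X] Ker C F d" using Ker_cmp[OF ie h(1)] by simp
  moreover have "Ker C F d \<sqsubseteq>[X] Ker C F (i \<cdot> e)"
    unfolding d(2) using Ker_cmp[OF e(2) P(2)] Ker_cmp[OF e'(2) P(3)] P(4) ker Ker_closed[OF ie]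
    by (simp add: join_le)
  ultimately show ?thesis
    using le_antisymF[OF X] Ker_closed[OF ie] Ker_closed[OF d(1)] d(2) by metis
qed

text \<open>By (N3) the meet is the image of some \<open>d\<close>, which then factors through
  \<open>m\<close> and \<open>m'\<close> and hence through the pullback.\<close>

lemma Im_pullback:
  assumes m: "m \<in> M" "m \<in> Hom C A X" and m': "m' \<in> M" "m' \<in> Hom C B X"
    and pb: "is_pullback C m m' p q"
  shows "Im C F m \<sqinter>\<^bsub>fib F X\<^esub> Im C F m' \<sqsubseteq>[X] Im C F (m \<cdot> p)"
proof -
  have X: "X \<in> Obj C" using hom_objs m by blast
  interpret bounded_lattice "fib F X" by (rule fib_lattice[OF X])
  obtain P where P: "P \<in> Obj C" "p \<in> Hom C P A" "q \<in> Hom C P B" "m \<cdot> p = m' \<cdot> q"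
    and univ: "\<And>W a b. a \<in> Hom C W A \<Longrightarrow> b \<in> Hom C W B \<Longrightarrow> m \<cdot> a = m' \<cdot> b \<Longrightarrow>
       \<exists>!h. h \<in> Hom C W P \<and> p \<cdot> h = a \<and> q \<cdot> h = b"
    using pb m(2) m'(2) by (rule is_pullbackE) blast
  note im = Im_closed[OF m(2)] Im_closed[OF m'(2)]
  have "conormal C F X (Im C F m)" "conormal C F X (Im C F m')"
    using m(2) m'(2) by (auto simp: conormal_def Hom_def)
  then have "conormal C F X (Im C F m \<sqinter>\<^bsub>fib F X\<^esub> Im C F m')" by (rule conormal_meet[OF X])
  then obtain d where d: "d \<in> Hom C (Dom C d) X" "Im C F d = Im C F m \<sqinter>\<^bsub>fib F X\<^esub> Im C F m'"
    by (auto simp: conormal_def Hom_def)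
  obtain u where u: "u \<in> Hom C (Dom C d) A" "d = m \<cdot> u"
    using embeddingD[OF M_embedding[OF m] d(1)] d(2) meet_left[OF im] hom_dom[OF m(2)] by auto
  obtain v where v: "v \<in> Hom C (Dom C d) B" "d = m' \<cdot> v"
    using embeddingD[OF M_embedding[OF m'] d(1)] d(2) meet_right[OF im] hom_dom[OF m'(2)] by auto
  obtain h where h: "h \<in> Hom C (Dom C d) P" "p \<cdot> h = u"
    using univ[OF u(1) v(1)] u(2) v(2) by metis
  have "d = (m \<cdot> p) \<cdot> h" using cmp_assoc[OF h(1) P(2) m(2)] h(2) u(2) by simp
  then show ?thesis using Im_cmp[OF h(1) cmp_hom[OF P(2) m(2)]] d(2) by simp
qed

section \<open>The functor to discrete spaces\<close>

definition fib_top :: "'o \<Rightarrow> 'u topology" where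
  "fib_top X = discrete_topology (K X)"

definition fib_map :: "'m \<Rightarrow> 'u top_arr" where
  "fib_map f = (fib_top (Dom C f), restrict (push F f) (K (Dom C f)), fib_top (Cod C f))"

lemma topspace_fibre [simp]: "topspace (fib_top X) = K X"
  by (simp add: fib_top_def)

lemma fib_map_eq:
  "f \<in> Hom C X Y \<Longrightarrow> fib_map f = (fib_top X, restrict (push F f) (K X), fib_top Y)"
  by (simp add: fib_map_def hom_dom hom_cod)

lemma fib_map_hom:
  assumes f: "f \<in> Hom C X Y"
  shows "fib_map f \<in> Hom Top (fib_top X) (fib_top Y)"
  using hom_objs[OF f] push_closed[OF f] fib_small
  by (auto simp: fib_map_eq[OF f] Top_Hom fib_top_def continuous_map_from_discrete_topology)

text \<open>Bijectivity of \<open>push F f\<close> makes both clusters trivial: it sends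
  \<open>Ker C F f\<close> and the bottom to the same cluster, so injectivity gives a bottom kernel,
  and surjectivity gives a top image. Identities then factor through both factors of
  \<open>f\<close>, which are therefore invertible.\<close>

lemma fibre_conservative:
  assumes f: "f \<in> Arr C" and iso: "is_iso Top (fib_map f)"
  shows "is_iso C f"
proof -
  define X Y where "X = Dom C f" and "Y = Cod C f"
  have fh: "f \<in> Hom C X Y" using f by (simp add: Hom_def X_def Y_def)
  note XY = hom_objs[OF fh]
  have "homeomorphic_map (fib_top X) (fib_top Y) (restrict (push F f) (K X))"
    using iso fib_map_hom[OF fh] Top_is_iso_iff unfolding fib_map_eq[OF fh] Hom_def by blast
  then have inj: "inj_on (push F f) (K X)" and surj: "push F f ` K X = K Y"
    using homeomorphic_imp_surjective_map homeomorphic_imp_injective_map by fastforce+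
  obtain Q e m where em: "e \<in> E" "m \<in> M" "e \<in> Hom C X Q" "m \<in> Hom C Q Y" "f = m \<cdot> e"
      "Ker C F e = Ker C F f" "Im C F m = Im C F f"
    using fh by (rule form_factorizationE)
  have bot: "\<bottom>\<^bsub>fib F X\<^esub> \<in> K X" "\<bottom>\<^bsub>fib F Y\<^esub> \<in> K Y" using XY bot_closed by auto
  have "push F f (Ker C F f) \<sqsubseteq>[Y] push F f \<bottom>\<^bsub>fib F X\<^esub>"
  proof -
    interpret bounded_lattice "fib F Y" by (rule fib_lattice[OF XY(2)])
    have "push F f (Ker C F f) \<sqsubseteq>[Y] \<bottom>\<^bsub>fib F Y\<^esub>"
      unfolding Ker_def hom_cod[OF fh] using counit[OF fh bot(2)] .
    moreover have "\<bottom>\<^bsub>fib F Y\<^esub> \<sqsubseteq>[Y] push F f \<bottom>\<^bsub>fib F X\<^esub>"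
      using bot_le[OF XY(2)] push_closed[OF fh bot(1)] by blast
    ultimately show ?thesis
      by (rule le_trans) (intro push_closed[OF fh] bot Ker_closed[OF fh])+
  qed
  then have "push F f (Ker C F f) = push F f \<bottom>\<^bsub>fib F X\<^esub>"
    using push_le[OF fh bot(1) Ker_closed[OF fh] bot_le[OF XY(1) Ker_closed[OF fh]]]
    by (rule le_antisymF[OF XY(2)]) (intro push_closed[OF fh] bot Ker_closed[OF fh])+
  then have ker: "Ker C F f = \<bottom>\<^bsub>fib F X\<^esub>"
    using inj bot Ker_closed[OF fh] by (auto simp: inj_on_def)
  obtain S where S: "S \<in> K X" "push F f S = \<top>\<^bsub>fib F Y\<^esub>"
    using surj top_closed[OF XY(2)] by (metis imageE)
  have "\<top>\<^bsub>fib F Y\<^esub> \<sqsubseteq>[Y] Im C F f"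
    unfolding Im_def hom_dom[OF fh] S(2)[symmetric]
    using push_le[OF fh S(1) top_closed[OF XY(1)] le_top[OF XY(1) S(1)]] .
  then have im: "Im C F f = \<top>\<^bsub>fib F Y\<^esub>"
    using le_antisymF[OF XY(2)] le_top[OF XY(2) Im_closed[OF fh]] Im_closed[OF fh] top_closed[OF XY(2)] by blast
  note iX = idn_hom[OF XY(1)] and iY = idn_hom[OF XY(2)]
  have "Ker C F e \<sqsubseteq>[X] Ker C F (Idn C X)"
    unfolding em(6) ker using bot_le[OF XY(1) Ker_closed[OF iX]] .
  then obtain h where h: "h \<in> Hom C Q X" "Idn C X = h \<cdot> e"
    using quotientD[OF E_quotient[OF em(1,3)] iX] hom_cod[OF em(3)] by auto
  have "Im C F (Idn C Y) \<sqsubseteq>[Y] Im C F m"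
    unfolding em(7) im using le_top[OF XY(2) Im_closed[OF iY]] .
  then obtain k where k: "k \<in> Hom C Y Q" "Idn C Y = m \<cdot> k"
    using embeddingD[OF M_embedding[OF em(2,4)] iY] hom_dom[OF em(4)] by auto
  show ?thesis
    unfolding em(5)
    using is_iso_cmp[OF split_epi_mono_is_iso[OF E_epi[OF em(1)] em(3) h(1) h(2)[symmetric]]
        split_mono_epi_is_iso[OF M_mono[OF em(2)] em(4) k(1) k(2)[symmetric]] em(3,4)] .
qed

lemma fibre_pullback:
  assumes f: "f \<in> M" and g: "g \<in> M" and pb: "is_pullback C f g p q"
  shows "is_pullback Top (fib_map f) (fib_map g) (fib_map p) (fib_map q)"
proof -
  define A B Z where "A = Dom C f" and "B = Dom C g" and "Z = Cod C f"
  have fh: "f \<in> Hom C A Z" and gh: "g \<in> Hom C B Z"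
    using pb by (auto simp: is_pullback_def Hom_def A_def B_def Z_def)
  obtain P where P: "P \<in> Obj C" "p \<in> Hom C P A" "q \<in> Hom C P B" "f \<cdot> p = g \<cdot> q"
    using pb fh gh by (rule is_pullbackE) blast
  have pM: "p \<in> M" using pullback_M[OF pb g] .
  define k where "k = f \<cdot> p"
  have kh: "k \<in> Hom C P Z" unfolding k_def using cmp_hom[OF P(2) fh] .
  have pk: "push F f (push F p S) = push F k S" "push F g (push F q S) = push F k S" if "S \<in> K P" for S
    using push_cmp[OF P(2) fh that] push_cmp[OF P(3) gh that] P(4) by (simp_all add: k_def)
  interpret Z: bounded_lattice "fib F Z" by (rule fib_lattice[OF hom_objs(2)[OF fh]])
  \<comment> \<open>The common cluster \<open>push F f S\<close> lies below both images, hence below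
    the image of the diagonal \<open>k\<close>. By (N1) it is then recovered from its pullback along
    \<open>k\<close>, and injectivity along \<open>f\<close> and \<open>g\<close> identifies the two
    components of that pullback.\<close>
  have lift: "push F p (pull F k (push F f S)) = S \<and> push F q (pull F k (push F f S)) = T"
    if S: "S \<in> K A" and T: "T \<in> K B" and eq: "push F f S = push F g T" for S T
  proof -
    let ?U = "push F f S"
    have U: "?U \<in> K Z" using push_closed[OF fh S] .
    have "?U \<sqsubseteq>[Z] Im C F f" "?U \<sqsubseteq>[Z] Im C F g"
      unfolding Im_def hom_dom[OF fh] hom_dom[OF gh]
      using push_le[OF fh S] push_le[OF gh T] le_top top_closed S T eq hom_objs(1)[OF fh] hom_objs(1)[OF gh]
      by auto
    then have "?U \<sqsubseteq>[Z] Im C F k"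
      using Im_pullback[OF f fh g gh pb] U Im_closed[OF fh] Im_closed[OF gh] Im_closed[OF kh]
      unfolding k_def[symmetric] by (meson Z.le_trans Z.meet_closed Z.meet_le)
    then have "push F k (pull F k ?U) = ?U"
      unfolding push_pull[OF kh U] using U Im_closed[OF kh] by (intro Z.meet_eqI) auto
    then have "push F f (push F p (pull F k ?U)) = push F f S" "push F g (push F q (pull F k ?U)) = push F g T"
      using pk[OF pull_closed[OF kh U]] eq by simp_all
    then show ?thesis
      using push_M_inj[OF f fh] push_M_inj[OF g gh] push_closed[OF P(2)] push_closed[OF P(3)]
        pull_closed[OF kh U] S T by blast
  qed
  show ?thesis
  proof (rule Top.is_pullbackI)
    show "fib_map f \<in> Hom Top (fib_top A) (fib_top Z)" using fib_map_hom[OF fh] .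
    show "fib_map g \<in> Hom Top (fib_top B) (fib_top Z)" using fib_map_hom[OF gh] .
    show "fib_map p \<in> Hom Top (fib_top P) (fib_top A)" using fib_map_hom[OF P(2)] .
    show "fib_map q \<in> Hom Top (fib_top P) (fib_top B)" using fib_map_hom[OF P(3)] .
    show "fib_map f \<odot> fib_map p = fib_map g \<odot> fib_map q"
      using pk push_closed[OF P(2)] push_closed[OF P(3)]
      by (simp add: fib_map_eq[OF fh] fib_map_eq[OF gh] fib_map_eq[OF P(2)] fib_map_eq[OF P(3)]
          Top_cmp_eq_iff)
    fix W a b assume a: "a \<in> Hom Top W (fib_top A)" and b: "b \<in> Hom Top W (fib_top B)"
      and ab: "fib_map f \<odot> a = fib_map g \<odot> b"
    obtain a' where a': "a = (W, a', fib_top A)" "small TYPE('u) (topspace W)"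
        "continuous_map W (fib_top A) a'" "a' \<in> extensional (topspace W)" "a' ` topspace W \<subseteq> K A"
      using a by (rule Top_HomE) simp
    obtain b' where b': "b = (W, b', fib_top B)" "b' \<in> extensional (topspace W)" "b' ` topspace W \<subseteq> K B"
      using b by (rule Top_HomE) simp
    have aw: "a' w \<in> K A" "b' w \<in> K B" if "w \<in> topspace W" for w using that a'(5) b'(3) by auto
    have sq: "push F f (a' w) = push F g (b' w)" if "w \<in> topspace W" for w
    proof -
      have "restrict (push F f) (K A) (a' w) = restrict (push F g) (K B) (b' w)"
        using ab that
        by (simp add: a'(1) b'(1) fib_map_eq[OF fh] fib_map_eq[OF gh] Top_cmp_eq_iff del: restrict_apply)
      then show ?thesis using aw[OF that] by simp
    qed
    define l where "l S = pull F k (push F f S)" for S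
    have lP: "l S \<in> K P" if "S \<in> K A" for S
      unfolding l_def using pull_closed[OF kh push_closed[OF fh that]] .
    define h where "h = restrict (l \<circ> a') (topspace W)"
    have "continuous_map (fib_top A) (fib_top P) l"
      using lP by (auto simp: fib_top_def continuous_map_from_discrete_topology)
    then have h: "(W, h, fib_top P) \<in> Hom Top W (fib_top P)"
      unfolding h_def using continuous_map_compose[OF a'(3)] a'(2) fib_small[OF P(1)]
      by (intro Top_restrict_Hom) auto
    have ph: "push F p (h w) = a' w \<and> push F q (h w) = b' w \<and> h w \<in> K P" if "w \<in> topspace W" for w
      using that lift[OF aw[OF that] sq[OF that]] lP[OF aw(1)[OF that]] by (simp add: h_def l_def)
    show "\<exists>!h. h \<in> Hom Top W (fib_top P) \<and> fib_map p \<odot> h = a \<and> fib_map q \<odot> h = b"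
    proof (intro ex1I[of _ "(W, h, fib_top P)"] conjI)
      show "(W, h, fib_top P) \<in> Hom Top W (fib_top P)" by (rule h)
      show "fib_map p \<odot> (W, h, fib_top P) = a"
        using ph a'(4)
        by (auto simp: fib_map_eq[OF P(2)] a'(1) compose_def restrict_def extensional_def fun_eq_iff)
      show "fib_map q \<odot> (W, h, fib_top P) = b"
        using ph b'(2)
        by (auto simp: fib_map_eq[OF P(3)] b'(1) compose_def restrict_def extensional_def fun_eq_iff)
      fix r assume r: "r \<in> Hom Top W (fib_top P) \<and> fib_map p \<odot> r = a \<and> fib_map q \<odot> r = b"
      then obtain r' where r': "r = (W, r', fib_top P)" "r' \<in> extensional (topspace W)" "r' ` topspace W \<subseteq> K P"
        by (auto elim: Top_HomE)
      have "compose (topspace W) (restrict (push F p) (K P)) r' = a'"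
        using r by (simp add: r'(1) fib_map_eq[OF P(2)] a'(1))
      then have "push F p (r' w) = a' w" if "w \<in> topspace W" for w
        using that r'(3) by (auto simp: compose_def restrict_def fun_eq_iff image_subset_iff; metis)
      then have "r' w = h w" if "w \<in> topspace W" for w
        using that ph push_M_inj[OF pM P(2)] r'(3) by (metis image_subset_iff)
      then have "r' = h" using r'(2) by (intro extensionalityI) (auto simp: h_def)
      then show "r = (W, h, fib_top P)" using r' by simp
    qed
  qed
qed

lemma fibre_pushout:
  assumes f: "f \<in> E" and g: "g \<in> E" and po: "is_pushout C f g i j"
  shows "is_pushout Top (fib_map f) (fib_map g) (fib_map i) (fib_map j)"
proof -
  define A B X where "A = Cod C f" and "B = Cod C g" and "X = Dom C f"
  have fh: "f \<in> Hom C X A" and gh: "g \<in> Hom C X B"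
    using po by (auto simp: is_pushout_def Hom_def A_def B_def X_def)
  obtain P where P: "P \<in> Obj C" "i \<in> Hom C A P" "j \<in> Hom C B P" "i \<cdot> f = j \<cdot> g"
    using po fh gh by (rule is_pushoutE) blast
  have iE: "i \<in> E" using pushout_E[OF po g] .
  define k where "k = i \<cdot> f"
  have kh: "k \<in> Hom C X P" unfolding k_def using cmp_hom[OF fh P(2)] .
  have pk: "push F i (push F f S) = push F k S" "push F j (push F g S) = push F k S" if "S \<in> K X" for S
    using push_cmp[OF fh P(2) that] push_cmp[OF gh P(3) that] P(4) by (simp_all add: k_def)
  interpret X: bounded_lattice "fib F X" by (rule fib_lattice[OF hom_objs(1)[OF fh]])
  note ker = Ker_closed[OF fh] Ker_closed[OF gh]
  show ?thesis
  proof (rule Top.is_pushoutI)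
    show "fib_map f \<in> Hom Top (fib_top X) (fib_top A)" using fib_map_hom[OF fh] .
    show "fib_map g \<in> Hom Top (fib_top X) (fib_top B)" using fib_map_hom[OF gh] .
    show "fib_map i \<in> Hom Top (fib_top A) (fib_top P)" using fib_map_hom[OF P(2)] .
    show "fib_map j \<in> Hom Top (fib_top B) (fib_top P)" using fib_map_hom[OF P(3)] .
    show "fib_map i \<odot> fib_map f = fib_map j \<odot> fib_map g"
      using pk push_closed[OF fh] push_closed[OF gh]
      by (simp add: fib_map_eq[OF fh] fib_map_eq[OF gh] fib_map_eq[OF P(2)] fib_map_eq[OF P(3)]
          Top_cmp_eq_iff)
    fix W a b assume a: "a \<in> Hom Top (fib_top A) W" and b: "b \<in> Hom Top (fib_top B) W"
      and ab: "a \<odot> fib_map f = b \<odot> fib_map g"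
    obtain a' where a': "a = (fib_top A, a', W)" "small TYPE('u) (topspace W)"
        "a' \<in> extensional (K A)" "a' ` K A \<subseteq> topspace W"
      using a by (rule Top_HomE) simp
    obtain b' where b': "b = (fib_top B, b', W)" "b' \<in> extensional (K B)"
      using b by (rule Top_HomE) simp
    have sq: "a' (push F f S) = b' (push F g S)" if "S \<in> K X" for S
      using ab that by (simp add: a'(1) b'(1) fib_map_eq[OF fh] fib_map_eq[OF gh] Top_cmp_eq_iff)
    \<comment> \<open>\<open>pull F k T\<close> serves as a chosen preimage of \<open>T\<close>
      along the diagonal; that every other preimage gives the same value is the content of
      \<open>h_push\<close>.\<close>
    define h where "h = restrict (\<lambda>T. a' (push F f (pull F k T))) (K P)"
    have "h T \<in> topspace W" if "T \<in> K P" for T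
      using that a'(4) push_closed[OF fh pull_closed[OF kh that]] by (auto simp: h_def)
    then have h: "(fib_top P, h, W) \<in> Hom Top (fib_top P) W"
      using a'(2) fib_small[OF P(1)]
      by (auto simp: Top_Hom fib_top_def continuous_map_from_discrete_topology h_def)
    text \<open>Joining with a kernel is invisible to \<open>a'\<close> and \<open>b'\<close>, and two such joins suffice.\<close>
    have h_push: "h (push F k S) = a' (push F f S)" if S: "S \<in> K X" for S
    proof -
      have absorb: "push F e (S' \<squnion>\<^bsub>fib F X\<^esub> Ker C F e) = push F e S'"
        if "S' \<in> K X" "e \<in> Hom C X Y" for e S' Y
        using push_pull_push[OF that(2,1)] pull_push[OF that(2,1)] by simp
      have "pull F k (push F k S) = (S \<squnion>\<^bsub>fib F X\<^esub> Ker C F g) \<squnion>\<^bsub>fib F X\<^esub> Ker C F f"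
        using pull_push[OF kh S] Ker_pushout[OF f fh g gh po]
          X.weak_join_assoc[OF S ker(2,1), unfolded X.eq_is_equal]
        by (simp add: k_def join_comm[of "fib F X" "Ker C F f"])
      then have "push F f (pull F k (push F k S)) = push F f (S \<squnion>\<^bsub>fib F X\<^esub> Ker C F g)"
        using absorb[OF X.join_closed[OF S ker(2)] fh] by simp
      then show ?thesis
        using sq[OF S] sq[OF X.join_closed[OF S ker(2)]] absorb[OF S gh] push_closed[OF kh S]
        by (simp add: h_def)
    qed
    have surj: "\<exists>S\<in>K X. push F e S = T" if "e \<in> E" "e \<in> Hom C X Y" "T \<in> K Y" for e Y T
      using push_pull_E[OF that] pull_closed[OF that(2,3)] by blast
    have hi: "h (push F i T) = a' T" if "T \<in> K A" for T
      using surj[OF f fh that] h_push pk by metis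
    have hj: "h (push F j T) = b' T" if "T \<in> K B" for T
      using surj[OF g gh that] h_push pk sq by metis
    show "\<exists>!h. h \<in> Hom Top (fib_top P) W \<and> h \<odot> fib_map i = a \<and> h \<odot> fib_map j = b"
    proof (intro ex1I[of _ "(fib_top P, h, W)"] conjI)
      show "(fib_top P, h, W) \<in> Hom Top (fib_top P) W" by (rule h)
      show "(fib_top P, h, W) \<odot> fib_map i = a"
        using hi a'(3)
        by (auto simp: fib_map_eq[OF P(2)] a'(1) compose_def restrict_def extensional_def fun_eq_iff)
      show "(fib_top P, h, W) \<odot> fib_map j = b"
        using hj b'(2)
        by (auto simp: fib_map_eq[OF P(3)] b'(1) compose_def restrict_def extensional_def fun_eq_iff)
      fix r assume r: "r \<in> Hom Top (fib_top P) W \<and> r \<odot> fib_map i = a \<and> r \<odot> fib_map j = b"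
      then obtain r' where r': "r = (fib_top P, r', W)" "r' \<in> extensional (K P)"
        by (auto elim: Top_HomE)
      have "compose (K A) r' (restrict (push F i) (K A)) = a'"
        using r by (simp add: r'(1) fib_map_eq[OF P(2)] a'(1))
      then have ri: "r' (push F i T) = a' T" if "T \<in> K A" for T
        using that by (auto simp: compose_def restrict_def fun_eq_iff; metis)
      have "r' U = h U" if "U \<in> K P" for U
        using ri hi push_pull_E[OF iE P(2) that] pull_closed[OF P(2) that] by metis
      then have "r' = h" using r'(2) by (intro extensionalityI) (auto simp: h_def)
      then show "r = (fib_top P, h, W)" using r' by simp
    qed
  qed
qed

lemma transfer_functor_fibre:
  "transfer_functor C E M Top Top_surjections Top_embeddings fib_top fib_map"
proof (intro transfer_functor.intro transfer_functor_axioms.intro pfs_category_axioms pfs_category_Top)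
  show "is_functor C Top fib_top fib_map"
    unfolding is_functor_def
  proof (intro conjI ballI impI)
    fix X assume X: "X \<in> Obj C"
    show "fib_top X \<in> Obj Top" using fib_small[OF X] by simp
    show "fib_map (Idn C X) = Idn Top (fib_top X)"
      using push_idn[OF X] by (auto simp: fib_map_eq[OF idn_hom[OF X]])
  next
    fix f assume "f \<in> Arr C"
    then show "fib_map f \<in> Hom Top (fib_top (Dom C f)) (fib_top (Cod C f))"
      using fib_map_hom arr_hom by blast
  next
    fix f g assume fg: "f \<in> Arr C" "g \<in> Arr C" "Cod C f = Dom C g"
    then have f: "f \<in> Hom C (Dom C f) (Dom C g)" and g: "g \<in> Hom C (Dom C g) (Cod C g)"
      by (simp_all add: Hom_def)
    show "fib_map (g \<cdot> f) = fib_map g \<odot> fib_map f"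
      using push_cmp[OF f g] push_closed[OF f]
      by (auto simp: fib_map_eq[OF f] fib_map_eq[OF g] fib_map_eq[OF cmp_hom[OF f g]]
          compose_def restrict_def fun_eq_iff)
  qed
  show "fib_map ` E \<subseteq> Top_surjections"
  proof
    fix u assume "u \<in> fib_map ` E"
    then obtain e where e: "e \<in> E" "u = fib_map e" by auto
    note eh = E_hom[OF e(1)]
    have "push F e ` K (Dom C e) = K (Cod C e)"
      using push_pull_E[OF e(1) eh] pull_closed[OF eh] push_closed[OF eh] by force
    then show "u \<in> Top_surjections"
      using fib_map_hom[OF eh] by (simp add: e(2) fib_map_eq[OF eh] Top_surjections_iff Hom_def)
  qed
  show "fib_map ` M \<subseteq> Top_embeddings"
  proof
    fix u assume "u \<in> fib_map ` M"
    then obtain m where m: "m \<in> M" "u = fib_map m" by auto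
    note mh = M_hom[OF m(1)]
    have "inj_on (push F m) (K (Dom C m))"
      using push_M_inj[OF m(1) mh] by (auto simp: inj_on_def)
    then have "embedding_map (fib_top (Dom C m)) (fib_top (Cod C m)) (restrict (push F m) (K (Dom C m)))"
      using push_closed[OF mh]
      by (intro injective_open_imp_embedding_map)
         (auto simp: fib_top_def continuous_map_from_discrete_topology open_map_def inj_on_def)
    then show "u \<in> Top_embeddings"
      using fib_map_hom[OF mh] by (simp add: m(2) fib_map_eq[OF mh] Top_embeddings_iff Hom_def)
  qed
qed (fact fibre_conservative fibre_pullback fibre_pushout)+

end

section \<open>A presheaf on topological spaces\<close>

text \<open>
  A quotient of a space is determined by the pieces that descend to it: the untagged ones give the
  underlying equivalence relation, the tagged ones the topology. The last condition of \<open>patchwork\<close>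
  makes sure that among the \<open>B\<close> with \<open>trace_on B0 ` \<kappa> B = \<kappa> B0\<close> there is a largest one, which yields
  the compatibility with pushouts of surjections.
\<close>

definition pieces :: "'a topology \<Rightarrow> 'a set \<Rightarrow> (bool \<times> 'a set) set" where
  "pieces X B = {(t, U). U \<subseteq> B \<and> (t \<longrightarrow> openin (subtopology X B) U)}"

definition trace_on :: "'a set \<Rightarrow> bool \<times> 'a set \<Rightarrow> bool \<times> 'a set" where
  "trace_on B v = (fst v, snd v \<inter> B)"

definition piece_pull :: "('a \<Rightarrow> 'b) \<Rightarrow> 'a set \<Rightarrow> bool \<times> 'b set \<Rightarrow> bool \<times> 'a set" where
  "piece_pull f B v = (fst v, {x \<in> B. f x \<in> snd v})"

definition patchwork :: "'a topology \<Rightarrow> ('a set \<Rightarrow> (bool \<times> 'a set) set) set" where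
  "patchwork X = {\<kappa>.
     (\<forall>B. B \<subseteq> topspace X \<longrightarrow> \<kappa> B \<subseteq> pieces X B) \<and>
     (\<forall>B. \<not> B \<subseteq> topspace X \<longrightarrow> \<kappa> B = {}) \<and>
     (\<forall>B' B. B' \<subseteq> B \<and> B \<subseteq> topspace X \<longrightarrow> \<kappa> B' \<subseteq> trace_on B' ` \<kappa> B) \<and>
     (\<forall>B0 \<B>. \<B> \<noteq> {} \<and> (\<forall>B\<in>\<B>. B0 \<subseteq> B \<and> B \<subseteq> topspace X \<and> trace_on B0 ` \<kappa> B \<subseteq> \<kappa> B0) \<longrightarrow>
        trace_on B0 ` \<kappa> (\<Union>\<B>) \<subseteq> \<kappa> B0)}"

definition patch_pull ::
  "'a topology \<Rightarrow> ('a \<Rightarrow> 'b) \<Rightarrow> ('b set \<Rightarrow> (bool \<times> 'b set) set) \<Rightarrow> 'a set \<Rightarrow> (bool \<times> 'a set) set"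
where
  "patch_pull X f \<kappa> = (\<lambda>B. if B \<subseteq> topspace X then piece_pull f B ` \<kappa> (f ` B) else {})"

text \<open>Off \<open>A\<close> every piece is allowed. Allowing none would violate the condition
  that the pieces of a subspace extend to every larger subspace.\<close>

definition patch_ext ::
  "'a topology \<Rightarrow> 'a set \<Rightarrow> ('a set \<Rightarrow> (bool \<times> 'a set) set) \<Rightarrow> 'a set \<Rightarrow> (bool \<times> 'a set) set"
where
  "patch_ext X A \<kappa> = (\<lambda>B. if B \<subseteq> A then \<kappa> B else if B \<subseteq> topspace X then pieces X B else {})"

lemma patchworkI:
  assumes "\<And>B. B \<subseteq> topspace X \<Longrightarrow> \<kappa> B \<subseteq> pieces X B"
    and "\<And>B. \<not> B \<subseteq> topspace X \<Longrightarrow> \<kappa> B = {}"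
    and "\<And>B' B. B' \<subseteq> B \<Longrightarrow> B \<subseteq> topspace X \<Longrightarrow> \<kappa> B' \<subseteq> trace_on B' ` \<kappa> B"
    and "\<And>B0 \<B>. \<B> \<noteq> {} \<Longrightarrow> (\<And>B. B \<in> \<B> \<Longrightarrow> B0 \<subseteq> B) \<Longrightarrow> (\<And>B. B \<in> \<B> \<Longrightarrow> B \<subseteq> topspace X) \<Longrightarrow>
          (\<And>B. B \<in> \<B> \<Longrightarrow> trace_on B0 ` \<kappa> B \<subseteq> \<kappa> B0) \<Longrightarrow> trace_on B0 ` \<kappa> (\<Union>\<B>) \<subseteq> \<kappa> B0"
  shows "\<kappa> \<in> patchwork X"
  unfolding patchwork_def
proof (intro CollectI conjI allI impI)
  fix B0 \<B>
  assume "\<B> \<noteq> {} \<and> (\<forall>B\<in>\<B>. B0 \<subseteq> B \<and> B \<subseteq> topspace X \<and> trace_on B0 ` \<kappa> B \<subseteq> \<kappa> B0)"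
  then show "trace_on B0 ` \<kappa> (\<Union>\<B>) \<subseteq> \<kappa> B0" by (intro assms(4)) simp_all
qed (simp_all add: assms(1-3))

lemma patchworkD:
  assumes "\<kappa> \<in> patchwork X"
  shows "B \<subseteq> topspace X \<Longrightarrow> \<kappa> B \<subseteq> pieces X B"
    and "\<not> B \<subseteq> topspace X \<Longrightarrow> \<kappa> B = {}"
    and "B' \<subseteq> B \<Longrightarrow> B \<subseteq> topspace X \<Longrightarrow> \<kappa> B' \<subseteq> trace_on B' ` \<kappa> B"
    and "\<B> \<noteq> {} \<Longrightarrow> (\<And>B. B \<in> \<B> \<Longrightarrow> B0 \<subseteq> B) \<Longrightarrow> (\<And>B. B \<in> \<B> \<Longrightarrow> B \<subseteq> topspace X) \<Longrightarrow>
          (\<And>B. B \<in> \<B> \<Longrightarrow> trace_on B0 ` \<kappa> B \<subseteq> \<kappa> B0) \<Longrightarrow> trace_on B0 ` \<kappa> (\<Union>\<B>) \<subseteq> \<kappa> B0"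
proof -
  note D = assms[unfolded patchwork_def mem_Collect_eq]
  show "B \<subseteq> topspace X \<Longrightarrow> \<kappa> B \<subseteq> pieces X B"
    and "\<not> B \<subseteq> topspace X \<Longrightarrow> \<kappa> B = {}"
    and "B' \<subseteq> B \<Longrightarrow> B \<subseteq> topspace X \<Longrightarrow> \<kappa> B' \<subseteq> trace_on B' ` \<kappa> B"
    using D by simp_all
  show "\<B> \<noteq> {} \<Longrightarrow> (\<And>B. B \<in> \<B> \<Longrightarrow> B0 \<subseteq> B) \<Longrightarrow> (\<And>B. B \<in> \<B> \<Longrightarrow> B \<subseteq> topspace X) \<Longrightarrow>
          (\<And>B. B \<in> \<B> \<Longrightarrow> trace_on B0 ` \<kappa> B \<subseteq> \<kappa> B0) \<Longrightarrow> trace_on B0 ` \<kappa> (\<Union>\<B>) \<subseteq> \<kappa> B0"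
    by (rule D[THEN conjunct2, THEN conjunct2, THEN conjunct2, rule_format]) blast
qed

section \<open>Traces and preimages of single pieces\<close>

lemma piece_subset: "\<kappa> \<in> patchwork X \<Longrightarrow> v \<in> \<kappa> B \<Longrightarrow> snd v \<subseteq> B"
  using patchworkD(1,2)[of \<kappa> X B] by (fastforce simp: pieces_def)

lemma trace_id: "snd v \<subseteq> B \<Longrightarrow> trace_on B v = v"
  by (auto simp: trace_on_def prod_eq_iff)

lemma trace_trace: "B' \<subseteq> B \<Longrightarrow> trace_on B' (trace_on B v) = trace_on B' v"
  by (auto simp: trace_on_def)

lemma trace_piece_pull: "B' \<subseteq> B \<Longrightarrow> trace_on B' (piece_pull f B v) = piece_pull f B' (trace_on (f ` B') v)"
  by (auto simp: trace_on_def piece_pull_def)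

lemma piece_pull_trace: "B' \<subseteq> B \<Longrightarrow> trace_on B' (piece_pull f B v) = piece_pull f B' v"
  by (auto simp: trace_on_def piece_pull_def)

lemma piece_pull_inj:
  "piece_pull f B v = piece_pull f B w \<Longrightarrow> snd v \<subseteq> f ` B \<Longrightarrow> snd w \<subseteq> f ` B \<Longrightarrow> v = w"
  by (auto simp: piece_pull_def prod_eq_iff set_eq_iff subset_iff image_iff; metis)

lemma piece_pull_pull:
  "piece_pull f B (piece_pull g (f ` B) v) = piece_pull (g \<circ> f) B v"
  by (auto simp: piece_pull_def)

lemma piece_pull_cong: "(\<And>x. x \<in> B \<Longrightarrow> f x = g x) \<Longrightarrow> piece_pull f B v = piece_pull g B v"
  by (auto simp: piece_pull_def)

lemma piece_pull_ident: "(\<And>x. x \<in> B \<Longrightarrow> f x = x) \<Longrightarrow> snd v \<subseteq> B \<Longrightarrow> piece_pull f B v = v"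
  by (auto simp: piece_pull_def prod_eq_iff)

text \<open>A tagged piece extends because open sets of a subspace are traces of open sets; an
  untagged one extends by itself. This makes the families of all pieces satisfy the extension
  condition.\<close>

lemma pieces_trace:
  assumes "B' \<subseteq> B" shows "trace_on B' ` pieces X B = pieces X B'"
proof (intro equalityI subsetI)
  fix v assume "v \<in> trace_on B' ` pieces X B"
  then obtain t U where U: "v = (t, U \<inter> B')" "U \<subseteq> B" "t \<longrightarrow> openin (subtopology X B) U"
    by (auto simp: pieces_def trace_on_def)
  have "openin (subtopology X B') (U \<inter> B')" if "openin (subtopology X B) U"
    using that assms by (auto simp: openin_subtopology)
  then show "v \<in> pieces X B'" using U by (auto simp: pieces_def)
next
  fix v assume "v \<in> pieces X B'"
  then obtain t U where U: "v = (t, U)" "U \<subseteq> B'" "t \<longrightarrow> openin (subtopology X B') U"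
    by (auto simp: pieces_def)
  show "v \<in> trace_on B' ` pieces X B"
  proof (cases t)
    case True
    then obtain T where T: "openin X T" "U = T \<inter> B'" using U by (auto simp: openin_subtopology)
    then have "(t, T \<inter> B) \<in> pieces X B" by (auto simp: pieces_def openin_subtopology)
    moreover have "v = trace_on B' (t, T \<inter> B)" using T U assms by (auto simp: trace_on_def)
    ultimately show ?thesis by blast
  next
    case False
    then have "v \<in> pieces X B" "v = trace_on B' v" using U assms by (auto simp: pieces_def trace_on_def)
    then show ?thesis by blast
  qed
qed

lemma pieces_subtopology: "B \<subseteq> A \<Longrightarrow> pieces (subtopology X A) B = pieces X B"
  by (simp add: pieces_def subtopology_subtopology Int_absorb1)

section \<open>Functoriality of patchworks\<close>

lemma patch_pull_closed:
  assumes f: "continuous_map X Y f" and \<kappa>: "\<kappa> \<in> patchwork Y"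
  shows "patch_pull X f \<kappa> \<in> patchwork X"
proof (rule patchworkI)
  have im: "f ` B \<subseteq> topspace Y" if "B \<subseteq> topspace X" for B
    using that continuous_map_image_subset_topspace[OF f] by blast
  show "patch_pull X f \<kappa> B \<subseteq> pieces X B" if B: "B \<subseteq> topspace X" for B
  proof
    fix v assume "v \<in> patch_pull X f \<kappa> B"
    then obtain w where w: "w \<in> \<kappa> (f ` B)" "v = piece_pull f B w" using B by (auto simp: patch_pull_def)
    have "w \<in> pieces Y (f ` B)" using w(1) patchworkD(1)[OF \<kappa> im[OF B]] by blast
    then obtain t U where U: "w = (t, U)" "t \<longrightarrow> openin (subtopology Y (f ` B)) U" by (auto simp: pieces_def)
    have "openin (subtopology X B) {x \<in> B. f x \<in> U}" if t: t
    proof -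
      obtain T where T: "openin Y T" "U = T \<inter> f ` B" using U(2) t by (auto simp: openin_subtopology)
      have "{x \<in> B. f x \<in> U} = {x \<in> topspace X. f x \<in> T} \<inter> B" using B T(2) by auto
      then show ?thesis
        using openin_continuous_map_preimage[OF f T(1)] by (auto simp: openin_subtopology)
    qed
    then show "v \<in> pieces X B" by (auto simp: w(2) U(1) pieces_def piece_pull_def)
  qed
  show "patch_pull X f \<kappa> B = {}" if "\<not> B \<subseteq> topspace X" for B
    using that by (simp add: patch_pull_def)
  show "patch_pull X f \<kappa> B' \<subseteq> trace_on B' ` patch_pull X f \<kappa> B"
    if B: "B' \<subseteq> B" "B \<subseteq> topspace X" for B B'
  proof -
    have "\<kappa> (f ` B') \<subseteq> trace_on (f ` B') ` \<kappa> (f ` B)"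
      by (rule patchworkD(3)[OF \<kappa> image_mono[OF B(1)] im[OF B(2)]])
    then have "piece_pull f B' ` \<kappa> (f ` B') \<subseteq> trace_on B' ` piece_pull f B ` \<kappa> (f ` B)"
      using B(1) by (fastforce simp: image_image trace_piece_pull)
    then show ?thesis using B by (simp add: patch_pull_def)
  qed
  fix B0 \<B>
  assume ne: "\<B> \<noteq> {}" and B0: "\<And>B. B \<in> \<B> \<Longrightarrow> B0 \<subseteq> B" and BX: "\<And>B. B \<in> \<B> \<Longrightarrow> B \<subseteq> topspace X"
    and tr: "\<And>B. B \<in> \<B> \<Longrightarrow> trace_on B0 ` patch_pull X f \<kappa> B \<subseteq> patch_pull X f \<kappa> B0"
  have B0X: "B0 \<subseteq> topspace X" using ne B0 BX by blast
  have "trace_on (f ` B0) ` \<kappa> (\<Union>((`) f ` \<B>)) \<subseteq> \<kappa> (f ` B0)"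
  proof (rule patchworkD(4)[OF \<kappa>])
    show "(`) f ` \<B> \<noteq> {}" using ne by simp
    fix D assume "D \<in> (`) f ` \<B>"
    then obtain B where B: "B \<in> \<B>" "D = f ` B" by auto
    show "f ` B0 \<subseteq> D" "D \<subseteq> topspace Y" using B B0 im[OF BX] by auto
    show "trace_on (f ` B0) ` \<kappa> D \<subseteq> \<kappa> (f ` B0)"
    proof
      fix v assume "v \<in> trace_on (f ` B0) ` \<kappa> D"
      then obtain w where w: "w \<in> \<kappa> (f ` B)" "v = trace_on (f ` B0) w" using B by auto
      have "trace_on B0 (piece_pull f B w) \<in> patch_pull X f \<kappa> B0"
        using w(1) BX[OF B(1)] by (intro subsetD[OF tr[OF B(1)]] imageI) (simp add: patch_pull_def)
      then obtain u where u: "u \<in> \<kappa> (f ` B0)" "trace_on B0 (piece_pull f B w) = piece_pull f B0 u"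
        using B0X by (auto simp: patch_pull_def)
      have "v = u"
      proof (rule piece_pull_inj)
        show "piece_pull f B0 v = piece_pull f B0 u"
          using u(2) trace_piece_pull[OF B0[OF B(1)]] w(2) by metis
        show "snd v \<subseteq> f ` B0" by (simp add: w(2) trace_on_def)
        show "snd u \<subseteq> f ` B0" by (rule piece_subset[OF \<kappa> u(1)])
      qed
      then show "v \<in> \<kappa> (f ` B0)" using u(1) by simp
    qed
  qed
  then have "trace_on (f ` B0) ` \<kappa> (f ` \<Union>\<B>) \<subseteq> \<kappa> (f ` B0)" by (simp add: image_Union)
  moreover have "B0 \<subseteq> \<Union>\<B>" using ne B0 by blast
  ultimately have "trace_on B0 ` piece_pull f (\<Union>\<B>) ` \<kappa> (f ` \<Union>\<B>) \<subseteq> piece_pull f B0 ` \<kappa> (f ` B0)"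
    by (auto simp: trace_piece_pull)
  moreover have "\<Union>\<B> \<subseteq> topspace X" using BX by blast
  ultimately show "trace_on B0 ` patch_pull X f \<kappa> (\<Union>\<B>) \<subseteq> patch_pull X f \<kappa> B0"
    using B0X by (simp add: patch_pull_def)
qed

lemma patch_pull_ident:
  assumes "\<kappa> \<in> patchwork X" "\<And>x. x \<in> topspace X \<Longrightarrow> f x = x"
  shows "patch_pull X f \<kappa> = \<kappa>"
proof
  fix B
  show "patch_pull X f \<kappa> B = \<kappa> B"
  proof (cases "B \<subseteq> topspace X")
    case True
    then have fB: "f ` B = B" using assms(2) by force
    have "piece_pull f B v = v" if "v \<in> \<kappa> B" for v
      using piece_subset[OF assms(1) that] assms(2) True by (intro piece_pull_ident) auto
    then show ?thesis using True by (simp add: patch_pull_def fB)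
  qed (simp add: patch_pull_def patchworkD(2)[OF assms(1)])
qed

lemma patch_pull_compose:
  assumes "f ` topspace X \<subseteq> topspace Y" "\<And>x. x \<in> topspace X \<Longrightarrow> h x = g (f x)"
  shows "patch_pull X h \<kappa> = patch_pull X f (patch_pull Y g \<kappa>)"
proof
  fix B
  show "patch_pull X h \<kappa> B = patch_pull X f (patch_pull Y g \<kappa>) B"
  proof (cases "B \<subseteq> topspace X")
    case True
    then have "f ` B \<subseteq> topspace Y" "h ` B = g ` f ` B"
      using assms by (auto simp: image_image intro!: image_cong)
    moreover have "piece_pull h B v = piece_pull f B (piece_pull g (f ` B) v)" for v
      unfolding piece_pull_pull using True assms(2) by (intro piece_pull_cong) auto
    ultimately show ?thesis using True by (simp add: patch_pull_def image_image)
  qed (simp add: patch_pull_def)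
qed

lemma patch_pull_empty: "patch_pull X f (\<lambda>_. {}) = (\<lambda>_. {})"
  by (simp add: patch_pull_def fun_eq_iff)

lemma patchwork_empty: "(\<lambda>_. {}) \<in> patchwork X"
  by (rule patchworkI) auto

text \<open>A subset of the image is the image of its own preimage, and pieces on it are determined
  by their preimages. Consequently surjections act injectively, and two patchworks agree along an
  embedding exactly when they agree on all subspaces of its image.\<close>

lemma patch_pull_eq_iff:
  assumes \<kappa>: "\<kappa> \<in> patchwork Y" "\<kappa>' \<in> patchwork Y"
  shows "patch_pull X f \<kappa> = patch_pull X f \<kappa>' \<longleftrightarrow> (\<forall>B. B \<subseteq> f ` topspace X \<longrightarrow> \<kappa> B = \<kappa>' B)"
proof (intro iffI allI impI)
  fix B assume eq: "patch_pull X f \<kappa> = patch_pull X f \<kappa>'" and B: "B \<subseteq> f ` topspace X"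
  define A where "A = {x \<in> topspace X. f x \<in> B}"
  have A: "A \<subseteq> topspace X" "f ` A = B" using B by (auto simp: A_def)
  have im: "piece_pull f A ` \<kappa> B = piece_pull f A ` \<kappa>' B"
    using fun_cong[OF eq, of A] A by (simp add: patch_pull_def)
  have inj: "v = w" if "piece_pull f A v = piece_pull f A w" "v \<in> \<kappa> B \<union> \<kappa>' B" "w \<in> \<kappa> B \<union> \<kappa>' B" for v w
    using that piece_subset[OF \<kappa>(1)] piece_subset[OF \<kappa>(2)] A(2)
    by (intro piece_pull_inj[of f A]) blast+
  show "\<kappa> B = \<kappa>' B"
  proof (intro equalityI subsetI)
    fix v assume v: "v \<in> \<kappa> B"
    then obtain w where "w \<in> \<kappa>' B" "piece_pull f A v = piece_pull f A w" using im by blast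
    then show "v \<in> \<kappa>' B" using inj[of v w] v by simp
  next
    fix v assume v: "v \<in> \<kappa>' B"
    then obtain w where "w \<in> \<kappa> B" "piece_pull f A w = piece_pull f A v" using im by (metis imageE imageI)
    then show "v \<in> \<kappa> B" using inj[of w v] v by simp
  qed
next
  assume eq: "\<forall>B. B \<subseteq> f ` topspace X \<longrightarrow> \<kappa> B = \<kappa>' B"
  show "patch_pull X f \<kappa> = patch_pull X f \<kappa>'"
    using eq by (auto simp: patch_pull_def fun_eq_iff image_mono)
qed

text \<open>The delicate condition is the one on unions. If the union leaves \<open>A\<close>, then
  so does some member; that member carries all its pieces, and its trace condition forces
  \<open>B0\<close> to carry all of its own.\<close>

lemma patch_ext_closed:
  assumes \<kappa>: "\<kappa> \<in> patchwork (subtopology X A)" and A: "A \<subseteq> topspace X"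
  shows "patch_ext X A \<kappa> \<in> patchwork X"
proof (rule patchworkI)
  have tA: "topspace (subtopology X A) = A" using A by auto
  have \<kappa>_pieces: "\<kappa> B \<subseteq> pieces X B" if "B \<subseteq> A" for B
    using patchworkD(1)[OF \<kappa>, of B, unfolded tA] that by (simp add: pieces_subtopology)
  show le: "patch_ext X A \<kappa> B \<subseteq> pieces X B" if "B \<subseteq> topspace X" for B
    using that \<kappa>_pieces[of B] by (auto simp: patch_ext_def)
  show "patch_ext X A \<kappa> B = {}" if "\<not> B \<subseteq> topspace X" for B
    using that A by (auto simp: patch_ext_def)
  show "patch_ext X A \<kappa> B' \<subseteq> trace_on B' ` patch_ext X A \<kappa> B"
    if B: "B' \<subseteq> B" "B \<subseteq> topspace X" for B B'
  proof (cases "B \<subseteq> A")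
    case True
    then show ?thesis using patchworkD(3)[OF \<kappa> B(1), unfolded tA] order_trans[OF B(1) True]
      by (simp add: patch_ext_def)
  next
    case False
    have "patch_ext X A \<kappa> B' \<subseteq> pieces X B'" using B by (intro le) simp
    then show ?thesis using False B pieces_trace[OF B(1), of X] by (simp add: patch_ext_def)
  qed
  fix B0 \<B>
  assume ne: "\<B> \<noteq> {}" and B0: "\<And>B. B \<in> \<B> \<Longrightarrow> B0 \<subseteq> B" and BX: "\<And>B. B \<in> \<B> \<Longrightarrow> B \<subseteq> topspace X"
    and tr: "\<And>B. B \<in> \<B> \<Longrightarrow> trace_on B0 ` patch_ext X A \<kappa> B \<subseteq> patch_ext X A \<kappa> B0"
  have U: "\<Union>\<B> \<subseteq> topspace X" "B0 \<subseteq> \<Union>\<B>" using ne B0 BX by blast+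
  show "trace_on B0 ` patch_ext X A \<kappa> (\<Union>\<B>) \<subseteq> patch_ext X A \<kappa> B0"
  proof (cases "\<Union>\<B> \<subseteq> A")
    case True
    have BA: "B \<subseteq> A" if "B \<in> \<B>" for B using that True by blast
    have B0A: "B0 \<subseteq> A" using True U by blast
    have "trace_on B0 ` \<kappa> (\<Union>\<B>) \<subseteq> \<kappa> B0"
    proof (rule patchworkD(4)[OF \<kappa> ne B0])
      fix B assume B: "B \<in> \<B>"
      show "B \<subseteq> topspace (subtopology X A)" unfolding tA by (rule BA[OF B])
      show "trace_on B0 ` \<kappa> B \<subseteq> \<kappa> B0"
        using tr[OF B] BA[OF B] B0A by (simp add: patch_ext_def)
    qed
    then show ?thesis using True B0A by (simp add: patch_ext_def)
  next
    case False
    then obtain B where B: "B \<in> \<B>" "\<not> B \<subseteq> A" by blast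
    have "pieces X B0 \<subseteq> patch_ext X A \<kappa> B0"
      using tr[OF B(1)] B(2) BX[OF B(1)] pieces_trace[OF B0[OF B(1)], of X] by (simp add: patch_ext_def)
    moreover have "trace_on B0 ` patch_ext X A \<kappa> (\<Union>\<B>) \<subseteq> trace_on B0 ` pieces X (\<Union>\<B>)"
      by (rule image_mono[OF le[OF U(1)]])
    ultimately show ?thesis using pieces_trace[OF U(2), of X] by simp
  qed
qed

lemma patch_ext_patchwork:
  assumes \<kappa>: "\<kappa> \<in> patchwork X" and A: "A \<subseteq> topspace X"
  shows "patch_ext X A \<kappa> \<in> patchwork X"
proof -
  let ?\<kappa> = "patch_pull (subtopology X A) id \<kappa>"
  have "?\<kappa> \<in> patchwork (subtopology X A)"
    using \<kappa> by (intro patch_pull_closed) (simp_all add: continuous_map_from_subtopology)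
  moreover have "?\<kappa> B = \<kappa> B" if "B \<subseteq> A" for B
    using that A piece_subset[OF \<kappa>] piece_pull_ident[of B id]
    by (auto simp: patch_pull_def cong: image_cong_simp)
  then have "patch_ext X A ?\<kappa> = patch_ext X A \<kappa>" by (auto simp: patch_ext_def fun_eq_iff)
  ultimately show ?thesis using patch_ext_closed[OF _ A] by metis
qed

section \<open>Surjectivity along embeddings, and detection of subspaces and quotient maps\<close>

definition patch_full :: "'a topology \<Rightarrow> 'a set \<Rightarrow> (bool \<times> 'a set) set" where
  "patch_full X = (\<lambda>B. if B \<subseteq> topspace X then pieces X B else {})"

lemma patch_full_closed: "patch_full X \<in> patchwork X"
proof (rule patchworkI)
  fix B0 \<B>
  assume "\<B> \<noteq> {}" and B0: "\<And>B. B \<in> \<B> \<Longrightarrow> B0 \<subseteq> B" and BX: "\<And>B. B \<in> \<B> \<Longrightarrow> B \<subseteq> topspace X"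
  then have "\<Union>\<B> \<subseteq> topspace X" "B0 \<subseteq> \<Union>\<B>" by blast+
  then show "trace_on B0 ` patch_full X (\<Union>\<B>) \<subseteq> patch_full X B0"
    using pieces_trace[of B0 "\<Union>\<B>" X] order_trans[of B0 "\<Union>\<B>" "topspace X"]
    by (simp add: patch_full_def)
qed (auto simp: patch_full_def pieces_trace)

text \<open>Transport \<kappa> to the image of \<open>m\<close> by the continuous inverse of
  \<open>m\<close>, and allow all pieces elsewhere.\<close>

lemma patch_pull_embedding_surj:
  assumes m: "embedding_map A X m" and \<kappa>: "\<kappa> \<in> patchwork A" and im: "m ` topspace A \<subseteq> topspace X"
  shows "\<kappa> \<in> patch_pull A m ` patchwork X"
proof -
  let ?D = "m ` topspace A"
  obtain g where g: "continuous_map (subtopology X ?D) A g" "\<And>x. x \<in> topspace A \<Longrightarrow> g (m x) = x"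
    using m by (rule embedding_map_inverse) blast
  define \<nu> where "\<nu> = patch_ext X ?D (patch_pull (subtopology X ?D) g \<kappa>)"
  have "\<nu> \<in> patchwork X"
    unfolding \<nu>_def by (rule patch_ext_closed[OF patch_pull_closed[OF g(1) \<kappa>] im])
  moreover have "patch_pull A m \<nu> = \<kappa>"
  proof
    fix B
    show "patch_pull A m \<nu> B = \<kappa> B"
    proof (cases "B \<subseteq> topspace A")
      case True
      then have mB: "m ` B \<subseteq> ?D" "m ` B \<subseteq> topspace X" "g ` m ` B = B"
        using im g(2) by (auto simp: image_image cong: image_cong_simp) (metis g(2) image_eqI subsetD)
      have "patch_pull A m \<nu> B = piece_pull m B ` piece_pull g (m ` B) ` \<kappa> B"
        using True mB by (simp add: patch_pull_def \<nu>_def patch_ext_def)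
      also have "\<dots> = \<kappa> B"
      proof -
        have "piece_pull m B (piece_pull g (m ` B) v) = v" if "v \<in> \<kappa> B" for v
          unfolding piece_pull_pull using True g(2) piece_subset[OF \<kappa> that]
          by (intro piece_pull_ident) auto
        then show ?thesis by (simp add: image_image)
      qed
      finally show ?thesis .
    qed (simp add: patch_pull_def patchworkD(2)[OF \<kappa>])
  qed
  ultimately show ?thesis by blast
qed

text \<open>The test pair consists of the empty patchwork and the one with all pieces off
  \<open>A\<close>. They agree on every subset of \<open>A\<close>, but differ at any subspace
  outside it, since even the empty set, untagged, is a piece.\<close>

lemma patch_detect_subset:
  assumes A: "A \<subseteq> topspace X" "A' \<subseteq> topspace X"
    and eq: "\<And>\<kappa> \<kappa>'. \<kappa> \<in> patchwork X \<Longrightarrow> \<kappa>' \<in> patchwork X \<Longrightarrow> (\<forall>B. B \<subseteq> A \<longrightarrow> \<kappa> B = \<kappa>' B) \<Longrightarrow> \<kappa> A' = \<kappa>' A'"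
  shows "A' \<subseteq> A"
proof (rule ccontr)
  assume "\<not> A' \<subseteq> A"
  moreover have "patch_ext X A (\<lambda>_. {}) A' = {}"
    using eq[OF patch_ext_patchwork[OF patchwork_empty A(1)] patchwork_empty] by (simp add: patch_ext_def)
  moreover have "(False, {}) \<in> pieces X A'" by (simp add: pieces_def)
  ultimately show False using A(2) by (simp add: patch_ext_def)
qed

text \<open>The full patchwork of \<open>Q'\<close>, evaluated at the whole space, carries all the
  information needed: its untagged singletons show that \<open>e'\<close> is constant on the fibres
  of \<open>e\<close>, and its tagged open sets show that the induced map is continuous.\<close>

lemma patch_detect_map:
  assumes e: "continuous_map X Q e" "e ` topspace X = topspace Q"
    and e': "continuous_map X Q' e'" "e' ` topspace X = topspace Q'"
    and sub: "patch_pull X e' ` patchwork Q' \<subseteq> patch_pull X e ` patchwork Q"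
  obtains d where "continuous_map Q Q' d" "\<And>x. x \<in> topspace X \<Longrightarrow> d (e x) = e' x"
proof -
  obtain \<kappa> where \<kappa>: "\<kappa> \<in> patchwork Q" "patch_pull X e' (patch_full Q') = patch_pull X e \<kappa>"
    using sub patch_full_closed by blast
  have ex: "\<exists>V'. V' \<subseteq> topspace Q \<and> {x \<in> topspace X. e' x \<in> V} = {x \<in> topspace X. e x \<in> V'} \<and>
      (t \<longrightarrow> openin Q V')" if V: "V \<subseteq> topspace Q'" "t \<longrightarrow> openin Q' V" for V t
  proof -
    have "(t, V) \<in> patch_full Q' (topspace Q')" using V by (simp add: patch_full_def pieces_def)
    then have "piece_pull e' (topspace X) (t, V) \<in> patch_pull X e' (patch_full Q') (topspace X)"
      using e'(2) by (simp add: patch_pull_def)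
    then obtain w where w: "w \<in> \<kappa> (topspace Q)" "piece_pull e' (topspace X) (t, V) = piece_pull e (topspace X) w"
      unfolding \<kappa>(2) using e(2) by (auto simp: patch_pull_def)
    have "w \<in> pieces Q (topspace Q)" using w(1) patchworkD(1)[OF \<kappa>(1) order_refl] by blast
    then obtain V' where V': "V' \<subseteq> topspace Q" "fst w \<longrightarrow> openin Q V'" "snd w = V'"
      by (auto simp: pieces_def)
    then show ?thesis using w(2) by (intro exI[of _ V']) (simp add: piece_pull_def)
  qed
  define d where "d q = e' (inv_into (topspace X) e q)" for q
  have e_eq: "e' x = e' y" if xy: "x \<in> topspace X" "y \<in> topspace X" "e x = e y" for x y
  proof -
    have "{e' x} \<subseteq> topspace Q'" using xy(1) e'(2) by blast
    then obtain V' where V': "{z \<in> topspace X. e' z \<in> {e' x}} = {z \<in> topspace X. e z \<in> V'}"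
      using ex[of "{e' x}" False] by blast
    then have "e x \<in> V'" using xy(1) by blast
    then have "y \<in> {z \<in> topspace X. e' z \<in> {e' x}}" unfolding V' using xy by simp
    then show ?thesis by simp
  qed
  have de: "d (e x) = e' x" if "x \<in> topspace X" for x
    unfolding d_def using that by (intro e_eq) (auto simp: inv_into_into f_inv_into_f)
  have "continuous_map Q Q' d"
    unfolding continuous_map_def
  proof (intro conjI allI impI)
    show "d \<in> topspace Q \<rightarrow> topspace Q'" unfolding e(2)[symmetric] e'(2)[symmetric] using de by auto
    fix V assume V: "openin Q' V"
    then obtain V' where V': "V' \<subseteq> topspace Q" "{x \<in> topspace X. e' x \<in> V} = {x \<in> topspace X. e x \<in> V'}" "openin Q V'"
      using ex[of V True] openin_subset by blast
    have "{q \<in> topspace Q. d q \<in> V} = V'"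
    proof (intro equalityI subsetI)
      fix q assume "q \<in> {q \<in> topspace Q. d q \<in> V}"
      then obtain x where "x \<in> topspace X" "q = e x" "e' x \<in> V" using de by (auto simp: e(2)[symmetric])
      then show "q \<in> V'" using V'(2) by blast
    next
      fix q assume q: "q \<in> V'"
      then obtain x where "x \<in> topspace X" "q = e x" using V'(1) by (auto simp: e(2)[symmetric])
      moreover from this have "e' x \<in> V" using q V'(2) by blast
      ultimately show "q \<in> {q \<in> topspace Q. d q \<in> V}" using q V'(1) de by auto
    qed
    then show "openin Q {q \<in> topspace Q. d q \<in> V}" using V'(3) by simp
  qed
  then show ?thesis using de by (rule that)
qed

text \<open>The hypothesis \<open>desc\<close> isolates what is used of a pushout: matching sets on
  \<open>Q1\<close> and \<open>Q2\<close> come from \<open>P\<close>, matching open sets from open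
  ones. This settles the pieces on the whole space and, by taking traces, the shape of the pieces on
  every subspace. What remains is that \<kappa> at \<open>B\<close> is determined by \<kappa> at the
  saturation of \<open>B\<close> for \<open>k\<close>, the fact \<open>sat\<close>.\<close>

lemma patch_descend:
  fixes X P Q1 Q2 :: "'a topology"
  assumes k: "k ` topspace X = topspace P"
    and surj: "e1 ` topspace X = topspace Q1" "e2 ` topspace X = topspace Q2"
    and \<kappa>: "\<kappa> \<in> patchwork X" "\<kappa> \<in> patch_pull X e1 ` patchwork Q1" "\<kappa> \<in> patch_pull X e2 ` patchwork Q2"
    and desc: "\<And>t V1 V2. {x \<in> topspace X. e1 x \<in> V1} = {x \<in> topspace X. e2 x \<in> V2} \<Longrightarrow>
      V1 \<subseteq> topspace Q1 \<Longrightarrow> V2 \<subseteq> topspace Q2 \<Longrightarrow> t \<longrightarrow> openin Q1 V1 \<and> openin Q2 V2 \<Longrightarrow>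
      \<exists>V. V \<subseteq> topspace P \<and> {x \<in> topspace X. e1 x \<in> V1} = {x \<in> topspace X. k x \<in> V} \<and> (t \<longrightarrow> openin P V)"
  shows "\<kappa> \<in> patch_pull X k ` patchwork P"
proof -
  define kinv where "kinv C = {x \<in> topspace X. k x \<in> C}" for C
  have kinv_X: "kinv C \<subseteq> topspace X" for C by (auto simp: kinv_def)
  have image_kinv: "k ` kinv U = U" if "U \<subseteq> topspace P" for U
    using that unfolding k[symmetric] by (auto simp: kinv_def)
  have kinv_inj: "U = V" if "kinv U = kinv V" "U \<subseteq> topspace P" "V \<subseteq> topspace P" for U V
    by (rule box_equals[OF arg_cong[OF that(1), of "image k"] image_kinv[OF that(2)] image_kinv[OF that(3)]])
  have kinv_Int: "kinv (U \<inter> V) = kinv U \<inter> kinv V" for U V by (auto simp: kinv_def)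
  obtain \<kappa>1 where \<kappa>1: "\<kappa>1 \<in> patchwork Q1" "\<kappa> = patch_pull X e1 \<kappa>1" using \<kappa>(2) by blast
  obtain \<kappa>2 where \<kappa>2: "\<kappa>2 \<in> patchwork Q2" "\<kappa> = patch_pull X e2 \<kappa>2" using \<kappa>(3) by blast
  have whole: "\<exists>V. V \<subseteq> topspace Q \<and> U = {x \<in> topspace X. e x \<in> V} \<and> (t \<longrightarrow> openin Q V)"
    if hyps: "e ` topspace X = topspace Q" "\<nu> \<in> patchwork Q" "\<kappa> = patch_pull X e \<nu>" "(t, U) \<in> \<kappa> (topspace X)"
    for e \<nu> t U and Q :: "'a topology"
  proof -
    obtain w where w: "w \<in> \<nu> (topspace Q)" "(t, U) = piece_pull e (topspace X) w"
      using hyps(4) unfolding hyps(3) by (auto simp: patch_pull_def hyps(1))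
    have "w \<in> pieces Q (topspace Q)" using w(1) patchworkD(1)[OF hyps(2) order_refl] by blast
    then obtain V where V: "V \<subseteq> topspace Q" "fst w \<longrightarrow> openin Q V" "snd w = V"
      by (auto simp: pieces_def)
    then show ?thesis using w(2) by (intro exI[of _ V]) (simp add: piece_pull_def)
  qed
  have wholeP: "\<exists>V. V \<subseteq> topspace P \<and> U = kinv V \<and> (t \<longrightarrow> openin P V)" if tU: "(t, U) \<in> \<kappa> (topspace X)" for t U
  proof -
    obtain V1 where V1: "V1 \<subseteq> topspace Q1" "U = {x \<in> topspace X. e1 x \<in> V1}" "t \<longrightarrow> openin Q1 V1"
      using whole[OF surj(1) \<kappa>1 tU] by blast
    obtain V2 where V2: "V2 \<subseteq> topspace Q2" "U = {x \<in> topspace X. e2 x \<in> V2}" "t \<longrightarrow> openin Q2 V2"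
      using whole[OF surj(2) \<kappa>2 tU] by blast
    show ?thesis using desc[of V1 V2 t] V1 V2 by (auto simp: kinv_def)
  qed
  have part: "\<exists>V. V \<subseteq> topspace P \<and> U = kinv V \<inter> B \<and> (t \<longrightarrow> openin P V)"
    if tU: "(t, U) \<in> \<kappa> B" and B: "B \<subseteq> topspace X" for t U B
  proof -
    have "\<kappa> B \<subseteq> trace_on B ` \<kappa> (topspace X)" using patchworkD(3)[OF \<kappa>(1) B] by simp
    then obtain U' where U': "(t, U') \<in> \<kappa> (topspace X)" "U = U' \<inter> B" using tU by (auto simp: trace_on_def)
    then show ?thesis using wholeP[OF U'(1)] by auto
  qed
  have part_kinv: "\<exists>V. V \<subseteq> C \<and> U = kinv V" if tU: "(t, U) \<in> \<kappa> (kinv C)" and C: "C \<subseteq> topspace P" for t U C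
  proof -
    obtain V where "U = kinv V \<inter> kinv C" using part[OF tU kinv_X] by blast
    then have "U = kinv (V \<inter> C)" by (simp add: kinv_Int)
    then show ?thesis by blast
  qed
  text \<open>The largest subspace with the pieces of \<open>B\<close> is saturated for \<open>e1\<close> and \<open>e2\<close>, hence for \<open>k\<close>.\<close>
  have sat: "trace_on B ` \<kappa> (kinv (k ` B)) \<subseteq> \<kappa> B" if B: "B \<subseteq> topspace X" for B
  proof -
    define \<B> where "\<B> = {B'. B \<subseteq> B' \<and> B' \<subseteq> topspace X \<and> trace_on B ` \<kappa> B' \<subseteq> \<kappa> B}"
    define S where "S = \<Union>\<B>"
    have "trace_on B v = v" if "v \<in> \<kappa> B" for v using piece_subset[OF \<kappa>(1) that] by (rule trace_id)
    then have "B \<in> \<B>" using B by (auto simp: \<B>_def)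
    then have BS: "B \<subseteq> S" and "\<B> \<noteq> {}" by (auto simp: S_def)
    have SX: "S \<subseteq> topspace X" by (auto simp: S_def \<B>_def)
    have SB: "trace_on B ` \<kappa> S \<subseteq> \<kappa> B"
      unfolding S_def by (rule patchworkD(4)[OF \<kappa>(1) \<open>\<B> \<noteq> {}\<close>]) (auto simp: \<B>_def)
    have satS: "{x \<in> topspace X. e x \<in> e ` S} = S" if "\<kappa> = patch_pull X e \<nu>" for e :: "'a \<Rightarrow> 'a" and \<nu>
    proof -
      define S' where "S' = {x \<in> topspace X. e x \<in> e ` S}"
      have S': "S \<subseteq> S'" "S' \<subseteq> topspace X" "e ` S' = e ` S" using SX by (auto simp: S'_def)
      \<comment> \<open>Saturating for \<open>e\<close> does not change the image under
        \<open>e\<close>, so \<open>S'\<close> has the same pieces as \<open>S\<close> up to trace;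
        maximality of \<open>S\<close> then gives equality.\<close>
      have "\<kappa> S = piece_pull e S ` \<nu> (e ` S)" "\<kappa> S' = piece_pull e S' ` \<nu> (e ` S)"
        using that SX S' by (simp_all add: patch_pull_def)
      then have "trace_on S ` \<kappa> S' = \<kappa> S" by (simp add: image_image piece_pull_trace[OF S'(1)])
      then have "trace_on B ` \<kappa> S' \<subseteq> \<kappa> B"
        using SB trace_trace[OF BS] by (metis image_image image_cong)
      then have "S' \<in> \<B>" using S' BS by (auto simp: \<B>_def)
      then show ?thesis using S' by (auto simp: S_def S'_def)
    qed
    have "e1 ` S \<subseteq> topspace Q1" "e2 ` S \<subseteq> topspace Q2" using SX surj by blast+
    then obtain V where V: "S = kinv V"
      using desc[of "e1 ` S" "e2 ` S" False] satS[OF \<kappa>1(2)] satS[OF \<kappa>2(2)] by (auto simp: kinv_def)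
    have sub: "B \<subseteq> kinv (k ` B)" "kinv (k ` B) \<subseteq> S"
      using B BS unfolding V by (auto simp: kinv_def)
    have "\<kappa> (kinv (k ` B)) \<subseteq> trace_on (kinv (k ` B)) ` \<kappa> S" by (rule patchworkD(3)[OF \<kappa>(1) sub(2) SX])
    then have "trace_on B ` \<kappa> (kinv (k ` B)) \<subseteq> trace_on B ` trace_on (kinv (k ` B)) ` \<kappa> S" by (rule image_mono)
    also have "\<dots> = trace_on B ` \<kappa> S" by (simp add: image_image trace_trace[OF sub(1)])
    finally show ?thesis using SB by blast
  qed
  \<comment> \<open>The pieces over \<open>C\<close> are read off at the full preimage of
    \<open>C\<close>, where \<open>part_kinv\<close> makes every piece of \<kappa> the preimage of a
    set.\<close>
  define \<mu> where "\<mu> C = (if C \<subseteq> topspace P then {(t, U). U \<subseteq> C \<and> (t, kinv U) \<in> \<kappa> (kinv C)} else {})" for C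
  have "\<mu> \<in> patchwork P"
  proof (rule patchworkI)
    show "\<mu> C \<subseteq> pieces P C" if C: "C \<subseteq> topspace P" for C
    proof
      fix v assume "v \<in> \<mu> C"
      then obtain t U where U: "v = (t, U)" "U \<subseteq> C" "(t, kinv U) \<in> \<kappa> (kinv C)" using C by (auto simp: \<mu>_def)
      obtain V where V: "V \<subseteq> topspace P" "kinv U = kinv V \<inter> kinv C" "t \<longrightarrow> openin P V"
        using part[OF U(3) kinv_X] by blast
      have "U = V \<inter> C"
      proof (rule kinv_inj)
        show "kinv U = kinv (V \<inter> C)" unfolding kinv_Int by (rule V(2))
      qed (use U(2) V(1) C in blast)+
      then show "v \<in> pieces P C" using V(3) unfolding U(1) by (auto simp: pieces_def openin_subtopology)
    qed
    show "\<mu> C = {}" if "\<not> C \<subseteq> topspace P" for C using that by (simp add: \<mu>_def)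
    have \<mu>I: "(t, V) \<in> \<mu> C" if "V \<subseteq> C" "C \<subseteq> topspace P" "(t, kinv V) \<in> \<kappa> (kinv C)" for t V C
      using that by (simp add: \<mu>_def)
    show "\<mu> C' \<subseteq> trace_on C' ` \<mu> C" if C: "C' \<subseteq> C" "C \<subseteq> topspace P" for C C'
    proof
      fix v assume "v \<in> \<mu> C'"
      then obtain t U where U: "v = (t, U)" "U \<subseteq> C'" "(t, kinv U) \<in> \<kappa> (kinv C')"
        using order_trans[OF C] by (auto simp: \<mu>_def)
      have "kinv C' \<subseteq> kinv C" using C by (auto simp: kinv_def)
      then have "\<kappa> (kinv C') \<subseteq> trace_on (kinv C') ` \<kappa> (kinv C)" using kinv_X by (rule patchworkD(3)[OF \<kappa>(1)])
      then obtain U' where U': "(t, U') \<in> \<kappa> (kinv C)" "kinv U = U' \<inter> kinv C'"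
        using U(3) by (auto simp: trace_on_def)
      obtain V where V: "V \<subseteq> C" "U' = kinv V" using part_kinv[OF U'(1) C(2)] by blast
      have "U = V \<inter> C'"
      proof (rule kinv_inj)
        show "kinv U = kinv (V \<inter> C')" unfolding kinv_Int using U'(2) V(2) by simp
      qed (use U(2) V(1) C in blast)+
      then have "v = trace_on C' (t, V)" by (simp add: U(1) trace_on_def)
      moreover have "(t, V) \<in> \<mu> C" using \<mu>I[OF V(1) C(2)] U'(1) V(2) by simp
      ultimately show "v \<in> trace_on C' ` \<mu> C" by blast
    qed
    fix C0 \<C>
    assume ne: "\<C> \<noteq> {}" and C0: "\<And>C. C \<in> \<C> \<Longrightarrow> C0 \<subseteq> C" and CP: "\<And>C. C \<in> \<C> \<Longrightarrow> C \<subseteq> topspace P"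
      and tr: "\<And>C. C \<in> \<C> \<Longrightarrow> trace_on C0 ` \<mu> C \<subseteq> \<mu> C0"
    have C0P: "C0 \<subseteq> topspace P" and UP: "\<Union>\<C> \<subseteq> topspace P" using ne C0 CP by blast+
    have "trace_on (kinv C0) ` \<kappa> (\<Union>(kinv ` \<C>)) \<subseteq> \<kappa> (kinv C0)"
    proof (rule patchworkD(4)[OF \<kappa>(1)])
      show "kinv ` \<C> \<noteq> {}" using ne by simp
      fix D assume "D \<in> kinv ` \<C>"
      then obtain C where C: "C \<in> \<C>" "D = kinv C" by auto
      show "kinv C0 \<subseteq> D" "D \<subseteq> topspace X" using C C0[OF C(1)] by (auto simp: kinv_def)
      show "trace_on (kinv C0) ` \<kappa> D \<subseteq> \<kappa> (kinv C0)"
      proof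
        fix v assume "v \<in> trace_on (kinv C0) ` \<kappa> D"
        then obtain t U where U: "(t, U) \<in> \<kappa> (kinv C)" "v = (t, U \<inter> kinv C0)"
          using C by (auto simp: trace_on_def)
        obtain V where V: "V \<subseteq> C" "U = kinv V" using part_kinv[OF U(1) CP[OF C(1)]] by blast
        have "trace_on C0 (t, V) \<in> \<mu> C0"
          using \<mu>I[OF V(1) CP[OF C(1)]] U(1) V(2) by (intro subsetD[OF tr[OF C(1)]] imageI) simp
        then show "v \<in> \<kappa> (kinv C0)"
          using C0P by (simp add: U(2) V(2) \<mu>_def trace_on_def kinv_Int)
      qed
    qed
    moreover have "\<Union>(kinv ` \<C>) = kinv (\<Union>\<C>)" by (auto simp: kinv_def)
    ultimately have *: "trace_on (kinv C0) ` \<kappa> (kinv (\<Union>\<C>)) \<subseteq> \<kappa> (kinv C0)" by simp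
    show "trace_on C0 ` \<mu> (\<Union>\<C>) \<subseteq> \<mu> C0"
    proof
      fix v assume "v \<in> trace_on C0 ` \<mu> (\<Union>\<C>)"
      then obtain t U where U: "(t, U) \<in> \<mu> (\<Union>\<C>)" "v = (t, U \<inter> C0)" by (auto simp: trace_on_def)
      then have "(t, kinv U) \<in> \<kappa> (kinv (\<Union>\<C>))" using UP by (simp add: \<mu>_def)
      then have "trace_on (kinv C0) (t, kinv U) \<in> \<kappa> (kinv C0)" using * by blast
      then show "v \<in> \<mu> C0"
        unfolding U(2) by (intro \<mu>I C0P) (simp_all add: trace_on_def kinv_Int)
    qed
  qed
  moreover have "patch_pull X k \<mu> = \<kappa>"
  proof
    fix B
    show "patch_pull X k \<mu> B = \<kappa> B"
    proof (cases "B \<subseteq> topspace X")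
      case True
      have kB: "k ` B \<subseteq> topspace P" using True k by blast
      have sub: "B \<subseteq> kinv (k ` B)" using True by (auto simp: kinv_def)
      have pull: "piece_pull k B (t, U) = trace_on B (t, kinv U)" for t U
        using True by (auto simp: piece_pull_def trace_on_def kinv_def)
      have "piece_pull k B ` \<mu> (k ` B) \<subseteq> \<kappa> B"
        using sat[OF True] kB by (auto simp: \<mu>_def pull)
      moreover have "\<kappa> B \<subseteq> piece_pull k B ` \<mu> (k ` B)"
      proof
        fix v assume v: "v \<in> \<kappa> B"
        have "\<kappa> B \<subseteq> trace_on B ` \<kappa> (kinv (k ` B))" using sub kinv_X by (rule patchworkD(3)[OF \<kappa>(1)])
        then obtain t U where U: "(t, U) \<in> \<kappa> (kinv (k ` B))" "v = trace_on B (t, U)" using v by auto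
        obtain V where V: "V \<subseteq> k ` B" "U = kinv V" using part_kinv[OF U(1) kB] by blast
        have "(t, V) \<in> \<mu> (k ` B)" using V U(1) kB by (simp add: \<mu>_def)
        moreover have "v = piece_pull k B (t, V)" by (simp add: U(2) V(2) pull)
        ultimately show "v \<in> piece_pull k B ` \<mu> (k ` B)" by blast
      qed
      ultimately show ?thesis using True by (simp add: patch_pull_def)
    qed (simp add: patch_pull_def patchworkD(2)[OF \<kappa>(1)])
  qed
  ultimately show ?thesis by blast
qed

text \<open>The two-point test spaces are the Sierpinski space and the indiscrete space.\<close>

lemma Top_pushout_descend:
  fixes X Q1 Q2 P :: "'u topology"
  assumes univ: "set_universe TYPE('u)"
    and po: "is_pushout (Top :: ('u topology, 'u top_arr) cat) (X, e1, Q1) (X, e2, Q2) (Q1, i, P) (Q2, j, P)"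
    and V: "{x \<in> topspace X. e1 x \<in> V1} = {x \<in> topspace X. e2 x \<in> V2}"
      "V1 \<subseteq> topspace Q1" "V2 \<subseteq> topspace Q2" "t \<longrightarrow> openin Q1 V1 \<and> openin Q2 V2"
  shows "\<exists>V. V \<subseteq> topspace P \<and> {x \<in> topspace X. e1 x \<in> V1} = {x \<in> topspace X. i (e1 x) \<in> V} \<and>
    (t \<longrightarrow> openin P V)"
proof -
  obtain a b :: 'u where ab: "a \<noteq> b"
    using univ unfolding set_universe_def by (metis finite.emptyI finite_insert UNIV_I finite_subset insertCI subsetI)
  define W where "W = topology_generated_by (if t then {{a}, {a, b}} else {{a, b}})"
  have W: "topspace W = {a, b}" by (auto simp: W_def)
  have sW: "small TYPE('u) (topspace W)"
    unfolding W using univ by (intro finite_lesspoll_infinite) (auto simp: set_universe_def)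
  have cont: "continuous_map Q W (\<lambda>x. if x \<in> V then a else b)"
    if "V \<subseteq> topspace Q" "t \<longrightarrow> openin Q V" for Q and V :: "'u set"
  proof -
    have "(\<lambda>x. if x \<in> V then a else b) -` {a, b} \<inter> topspace Q = topspace Q"
      "(\<lambda>x. if x \<in> V then a else b) -` {a} \<inter> topspace Q = V" using that(1) ab by auto
    then show ?thesis
      unfolding W_def using that(2) by (intro continuous_on_generated_topo) (auto split: if_splits)
  qed
  have hom: "(X, e1, Q1) \<in> Hom Top X Q1" "(X, e2, Q2) \<in> Hom Top X Q2"
    using po by (auto simp: is_pushout_def Hom_def)
  obtain P' where P': "(Q1, i, P) \<in> Hom Top Q1 P'"
    and uni: "\<And>W a b. a \<in> Hom Top Q1 W \<Longrightarrow> b \<in> Hom Top Q2 W \<Longrightarrow>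
       a \<odot> (X, e1, Q1) = b \<odot> (X, e2, Q2) \<Longrightarrow>
       \<exists>!h. h \<in> Hom Top P' W \<and> h \<odot> (Q1, i, P) = a \<and> h \<odot> (Q2, j, P) = b"
    using po hom by (rule Top.is_pushoutE) blast
  have P'P: "P' = P" and sm: "small TYPE('u) (topspace Q1)" "small TYPE('u) (topspace Q2)"
    and im: "e1 ` topspace X \<subseteq> topspace Q1" "e2 ` topspace X \<subseteq> topspace Q2" "i ` topspace Q1 \<subseteq> topspace P"
    using P' hom continuous_map_image_subset_topspace by (auto simp: Top_Hom; blast)+
  \<comment> \<open>\<open>V1\<close> and \<open>V2\<close> become characteristic maps into the test
    space; having the same preimage in \<open>X\<close> makes them a cocone.\<close>
  define f1 where "f1 = (Q1, restrict (\<lambda>x. if x \<in> V1 then a else b) (topspace Q1), W)"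
  define f2 where "f2 = (Q2, restrict (\<lambda>x. if x \<in> V2 then a else b) (topspace Q2), W)"
  have f: "f1 \<in> Hom Top Q1 W" "f2 \<in> Hom Top Q2 W"
    unfolding f1_def f2_def using V(2-4) sm sW by (auto intro!: Top_restrict_Hom cont)
  have "f1 \<odot> (X, e1, Q1) = f2 \<odot> (X, e2, Q2)"
    using V(1) im by (auto simp: f1_def f2_def Top_cmp_eq_iff set_eq_iff)
  then obtain h' where h': "h' \<in> Hom Top P W" "h' \<odot> (Q1, i, P) = f1"
    using uni[OF f] unfolding P'P by blast
  obtain h where h: "h' = (P, h, W)" "continuous_map P W h" using h'(1) by (rule Top_HomE)
  have "compose (topspace Q1) h i = restrict (\<lambda>x. if x \<in> V1 then a else b) (topspace Q1)"
    using h'(2) by (simp add: h(1) f1_def)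
  then have hi: "h (i q) = (if q \<in> V1 then a else b)" if "q \<in> topspace Q1" for q
    using that by (auto simp: compose_def restrict_def fun_eq_iff; metis)
  \<comment> \<open>The descended set is the fibre over \<open>a\<close>, which is the open point of
    the test space when \<open>t\<close> holds.\<close>
  define V where "V = {y \<in> topspace P. h y \<in> {a}}"
  have "openin W {a}" if t using that by (auto simp: W_def intro: topology_generated_by_Basis)
  then have "openin P V" if t unfolding V_def using openin_continuous_map_preimage[OF h(2)] that by blast
  moreover have "e1 x \<in> V1 \<longleftrightarrow> i (e1 x) \<in> V" if "x \<in> topspace X" for x
  proof -
    have "e1 x \<in> topspace Q1" "i (e1 x) \<in> topspace P" using that im by blast+
    then show ?thesis using hi[of "e1 x"] ab by (simp add: V_def)
  qed
  then have "{x \<in> topspace X. e1 x \<in> V1} = {x \<in> topspace X. i (e1 x) \<in> V}" by blast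
  moreover have "V \<subseteq> topspace P" by (auto simp: V_def)
  ultimately show ?thesis by blast
qed

section \<open>Sizes\<close>

lemma small_Pow:
  assumes "set_universe TYPE('u)" "small TYPE('u) A" shows "small TYPE('u) (Pow A)"
proof -
  obtain f :: "_ \<Rightarrow> 'u" where f: "inj_on f A" using lesspoll_imp_lepoll[OF assms(2)] by (auto simp: lepoll_def)
  have "small TYPE('u) (Pow (f ` A))"
    using assms(1) small_image[OF assms(2), of f] by (simp add: set_universe_def)
  moreover have "inj_on ((`) f) (Pow A)" using f by (rule inj_on_image_Pow)
  then have "Pow A \<lesssim> Pow (f ` A)" by (auto simp: lepoll_def)
  ultimately show ?thesis by (rule lesspoll_trans1[rotated])
qed

lemma small_UN:
  fixes I :: "'u set" and A :: "'u \<Rightarrow> 'u set"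
  assumes "set_universe TYPE('u)" "small TYPE('u) I" "\<And>i. i \<in> I \<Longrightarrow> small TYPE('u) (A i)"
  shows "small TYPE('u) (\<Union>i\<in>I. A i)"
  using assms unfolding set_universe_def by simp

text \<open>The product is a union, indexed by \<open>A\<close>, of copies of \<open>B\<close>, so
  closure under small unions applies once pairs are coded in \<open>'u\<close>; an infinite type
  admits such a coding.\<close>

lemma small_Times:
  assumes U: "set_universe TYPE('u)" and A: "small TYPE('u) A" and B: "small TYPE('u) B"
  shows "small TYPE('u) (A \<times> B)"
proof -
  obtain f :: "_ \<Rightarrow> 'u" where f: "inj_on f A" using lesspoll_imp_lepoll[OF A] by (auto simp: lepoll_def)
  obtain g :: "_ \<Rightarrow> 'u" where g: "inj_on g B" using lesspoll_imp_lepoll[OF B] by (auto simp: lepoll_def)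
  have "(UNIV :: 'u set) \<times> (UNIV :: 'u set) \<approx> (UNIV :: 'u set)"
    using U card_of_Times_same_infinite unfolding eqpoll_iff_card_of_ordIso set_universe_def by blast
  then obtain p :: "'u \<times> 'u \<Rightarrow> 'u" where p: "inj p"
    by (auto simp: eqpoll_def bij_betw_def)
  have "small TYPE('u) (\<Union>a\<in>f ` A. (\<lambda>b. p (a, b)) ` g ` B)"
    by (rule small_UN[OF U small_image[OF A] small_image[OF small_image[OF B]]])
  moreover have "inj_on (\<lambda>(a, b). p (f a, g b)) (A \<times> B)"
    by (intro inj_onI) (auto dest!: injD[OF p] dest: inj_onD[OF f] inj_onD[OF g])
  then have "A \<times> B \<lesssim> (\<Union>a\<in>f ` A. (\<lambda>b. p (a, b)) ` g ` B)"
    unfolding lepoll_def by (intro exI[of _ "\<lambda>(a, b). p (f a, g b)"]) auto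
  ultimately show ?thesis by (rule lesspoll_trans1[rotated])
qed

text \<open>A patchwork is determined by its graph, a set of triples of a subspace, a tag and a
  subset.\<close>

lemma small_patchwork:
  assumes U: "set_universe TYPE('u)" and X: "small TYPE('u) (topspace X)"
  shows "small TYPE('u) (patchwork X)"
proof -
  let ?S = "Pow (topspace X) \<times> (UNIV :: bool set) \<times> Pow (topspace X)"
  have "small TYPE('u) (UNIV :: bool set)"
    using U by (intro finite_lesspoll_infinite) (auto simp: set_universe_def)
  then have S: "small TYPE('u) (Pow ?S)" by (intro small_Pow small_Times U X)
  define g where "g \<kappa> = {(B, v). v \<in> \<kappa> B}" for \<kappa> :: "'a set \<Rightarrow> (bool \<times> 'a set) set"
  have "inj g" unfolding g_def by (rule injI) (auto simp: fun_eq_iff set_eq_iff)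
  then have "inj_on g (patchwork X)" by (rule inj_on_subset) simp
  moreover have "g ` patchwork X \<subseteq> Pow ?S"
  proof (intro image_subsetI PowI subsetI)
    fix \<kappa> z assume \<kappa>: "\<kappa> \<in> patchwork X" and "z \<in> g \<kappa>"
    then obtain B t U where z: "z = (B, t, U)" "(t, U) \<in> \<kappa> B" by (auto simp: g_def)
    moreover have "B \<subseteq> topspace X" using patchworkD(2)[OF \<kappa>, of B] z by blast
    ultimately show "z \<in> ?S" using piece_subset[OF \<kappa> z(2)] by auto
  qed
  ultimately have "patchwork X \<lesssim> Pow ?S" unfolding lepoll_def by blast
  then show ?thesis using S by (rule lesspoll_trans1)
qed

section \<open>From a transfer functor to a noetherian form\<close>

locale transfer_to_Top =
  transfer_functor C E M "Top :: ('u topology, 'u top_arr) cat" Top_surjections Top_embeddings To Ta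
  for C :: "('o, 'm) cat" (structure) and E M and To :: "'o \<Rightarrow> 'u topology" and Ta +
  assumes universe: "set_universe TYPE('u)"
begin

section \<open>The presheaf of patchworks along the functor\<close>

abbreviation pts :: "'o \<Rightarrow> 'u set" where
  "pts X \<equiv> topspace (To X)"

definition Tm :: "'m \<Rightarrow> 'u \<Rightarrow> 'u" where
  "Tm f = fst (snd (Ta f))"

definition patch_arr :: "'m \<Rightarrow> ('u set \<Rightarrow> (bool \<times> 'u set) set) \<Rightarrow> 'u set \<Rightarrow> (bool \<times> 'u set) set" where
  "patch_arr f = patch_pull (fst (Ta f)) (Tm f)"

definition patch_obj :: "'o \<Rightarrow> ('u set \<Rightarrow> (bool \<times> 'u set) set) set" where
  "patch_obj X = patchwork (To X)"

text \<open>An arbitrary injection into \<open>'u\<close>; it exists because the equivalence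
  relations on a small set form a small set.\<close>

definition patch_code :: "'o \<Rightarrow> (('u set \<Rightarrow> (bool \<times> 'u set) set) \<times> ('u set \<Rightarrow> (bool \<times> 'u set) set)) set \<Rightarrow> 'u" where
  "patch_code X = (SOME c. inj_on c {r. equiv (patch_obj X) r})"

lemma Ta_hom: "f \<in> Hom C X Y \<Longrightarrow> Ta f \<in> Hom Top (To X) (To Y)"
  using is_functor by (auto simp: is_functor_def Hom_def)

lemma Ta_cmp: "f \<in> Hom C X Y \<Longrightarrow> g \<in> Hom C Y Z \<Longrightarrow> Ta (g \<cdot> f) = Ta g \<odot> Ta f"
  using is_functor by (auto simp: is_functor_def Hom_def)

lemma Ta_eq: "f \<in> Hom C X Y \<Longrightarrow> Ta f = (To X, Tm f, To Y)"
  using Ta_hom[of f X Y] by (auto simp: Tm_def elim!: Top_HomE)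

lemma Tm:
  assumes "f \<in> Hom C X Y"
  shows "continuous_map (To X) (To Y) (Tm f)"
    and "Tm f ` pts X \<subseteq> pts Y"
  using Ta_hom[OF assms] continuous_map_image_subset_topspace
  unfolding Ta_eq[OF assms] by (auto simp: Top_Hom; blast)+

lemma To_small: "X \<in> Obj C \<Longrightarrow> small TYPE('u) (pts X)"
  using is_functor by (simp add: is_functor_def)

lemma Tm_cmp:
  assumes f: "f \<in> Hom C X Y" and g: "g \<in> Hom C Y Z" and x: "x \<in> pts X"
  shows "Tm (g \<cdot> f) x = Tm g (Tm f x)"
proof -
  have "Tm (g \<cdot> f) = compose (pts X) (Tm g) (Tm f)"
    using Ta_cmp[OF f g] unfolding Ta_eq[OF f] Ta_eq[OF g] Ta_eq[OF src.cmp_hom[OF f g]] by simp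
  then show ?thesis using x by (simp add: compose_def)
qed

lemma Tm_idn:
  assumes X: "X \<in> Obj C" and x: "x \<in> pts X"
  shows "Tm (Idn C X) x = x"
proof -
  have "Ta (Idn C X) = Idn Top (To X)" using is_functor X by (simp add: is_functor_def)
  then have "Tm (Idn C X) = (\<lambda>x\<in>pts X. x)" by (simp add: Tm_def)
  then show ?thesis using x by simp
qed

lemma patch_arr_eq: "f \<in> Hom C X Y \<Longrightarrow> patch_arr f = patch_pull (To X) (Tm f)"
  by (simp add: patch_arr_def Ta_eq)

lemma map_of_E:
  assumes "e \<in> E" "e \<in> Hom C X Y"
  shows "Tm e ` pts X = pts Y"
  using E_preserved assms Ta_eq[OF assms(2)] by (force simp: Top_surjections_iff)

lemma map_of_M:
  assumes "m \<in> M" "m \<in> Hom C X Y"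
  shows "embedding_map (To X) (To Y) (Tm m)"
  using M_preserved assms Ta_eq[OF assms(2)] by (force simp: Top_embeddings_iff)

lemma patch_arr_eq_iff:
  assumes "f \<in> Hom C X Y" "x \<in> patch_obj Y" "y \<in> patch_obj Y"
  shows "patch_arr f x = patch_arr f y \<longleftrightarrow> (\<forall>B. B \<subseteq> Tm f ` pts X \<longrightarrow> x B = y B)"
  using assms(2,3) unfolding patch_arr_eq[OF assms(1)] patch_obj_def by (rule patch_pull_eq_iff)

text \<open>A point common to both images is a cone with a one-point vertex over the preserved
  pullback of spaces, and the mediating map picks a point above it.\<close>

lemma map_of_pullback:
  assumes m: "m \<in> M" "m \<in> Hom C A X" and m': "m' \<in> M" "m' \<in> Hom C B X"
    and pb: "is_pullback C m m' p q" and p: "p \<in> Hom C P A"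
  shows "Tm m ` pts A \<inter> Tm m' ` pts B \<subseteq>
    Tm (m \<cdot> p) ` pts P"
proof
  fix x assume "x \<in> Tm m ` pts A \<inter> Tm m' ` pts B"
  then obtain a b where ab: "a \<in> pts A" "b \<in> pts B" "x = Tm m a" "x = Tm m' b"
    by auto
  have pbT: "is_pullback Top (Ta m) (Ta m') (Ta p) (Ta q)" by (rule pullback_preserved[OF m(1) m'(1) pb])
  obtain P' where P': "Ta p \<in> Hom Top P' (To A)"
    and univ: "\<And>W a b. a \<in> Hom Top W (To A) \<Longrightarrow> b \<in> Hom Top W (To B) \<Longrightarrow>
       Ta m \<odot> a = Ta m' \<odot> b \<Longrightarrow>
       \<exists>!h. h \<in> Hom Top W P' \<and> Ta p \<odot> h = a \<and> Ta q \<odot> h = b"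
    using pbT Ta_hom[OF m(2)] Ta_hom[OF m'(2)] by (rule Top.is_pullbackE) blast
  have P'P: "P' = To P" using P' Ta_eq[OF p] by (simp add: Top_Hom)
  define W where "W = discrete_topology {x}"
  have sW: "small TYPE('u) (topspace W)"
    unfolding W_def using universe by (intro finite_lesspoll_infinite) (auto simp: set_universe_def)
  define u where "u = (W, restrict (\<lambda>_. a) (topspace W), To A)"
  define v where "v = (W, restrict (\<lambda>_. b) (topspace W), To B)"
  have u: "u \<in> Hom Top W (To A)" and v: "v \<in> Hom Top W (To B)"
    unfolding u_def v_def using ab sW To_small src.hom_objs(1)[OF m(2)] src.hom_objs(1)[OF m'(2)]
    by (auto intro!: Top_restrict_Hom)
  have "Ta m \<odot> u = Ta m' \<odot> v"
    using ab by (simp add: u_def v_def Ta_eq[OF m(2)] Ta_eq[OF m'(2)] Top_cmp_eq_iff)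
  then obtain h' where h': "h' \<in> Hom Top W (To P)" "Ta p \<odot> h' = u"
    using univ[OF u v] unfolding P'P by blast
  obtain h where h: "h' = (W, h, To P)" "h ` topspace W \<subseteq> pts P" using h'(1) by (rule Top_HomE)
  have "compose (topspace W) (Tm p) h = restrict (\<lambda>_. a) (topspace W)"
    using h'(2) by (simp add: h(1) u_def Ta_eq[OF p])
  then have "Tm p (h x) = a"
    by (auto simp: compose_def W_def restrict_def fun_eq_iff; metis)
  moreover have hx: "h x \<in> pts P" using h(2) by (auto simp: W_def)
  ultimately have "x = Tm (m \<cdot> p) (h x)"
    using Tm_cmp[OF p m(2) hx] ab(3) by simp
  then show "x \<in> Tm (m \<cdot> p) ` pts P" using hx by blast
qed

lemma patch_pushout:
  assumes e: "e \<in> E" "e \<in> Hom C X A" and e': "e' \<in> E" "e' \<in> Hom C X B"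
    and po: "is_pushout C e e' i j"
  shows "patch_arr e ` patch_obj A \<inter> patch_arr e' ` patch_obj B \<subseteq> patch_arr (i \<cdot> e) ` patch_obj (Cod C i)"
proof
  fix \<kappa> assume \<kappa>: "\<kappa> \<in> patch_arr e ` patch_obj A \<inter> patch_arr e' ` patch_obj B"
  obtain P where P: "i \<in> Hom C A P" "j \<in> Hom C B P" "i \<cdot> e = j \<cdot> e'"
    using po e(2) e'(2) by (rule src.is_pushoutE) blast
  have ie: "i \<cdot> e \<in> Hom C X P" using src.cmp_hom[OF e(2) P(1)] .
  \<comment> \<open>Left-class morphisms are stable under pushout and composition, so the diagonal
    is sent to a surjection, as \<open>patch_descend\<close> demands.\<close>
  have ieE: "i \<cdot> e \<in> E"
    using src.E_cmp_hom[OF e(1) src.pushout_E[OF po e'(1)] e(2) P(1)] .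
  have poT: "is_pushout Top (To X, Tm e, To A) (To X, Tm e', To B)
      (To A, Tm i, To P) (To B, Tm j, To P)"
    using pushout_preserved[OF e(1) e'(1) po]
    by (simp add: Ta_eq[OF e(2)] Ta_eq[OF e'(2)] Ta_eq[OF P(1)] Ta_eq[OF P(2)])
  have cmp: "{x \<in> pts X. Tm i (Tm e x) \<in> V} =
      {x \<in> pts X. Tm (i \<cdot> e) x \<in> V}" for V
    using Tm_cmp[OF e(2) P(1)] by auto
  have "\<kappa> \<in> patchwork (To X)"
    using \<kappa> patch_pull_closed[OF Tm(1)[OF e(2)]]
    by (auto simp: patch_obj_def patch_arr_eq[OF e(2)])
  then have "\<kappa> \<in> patch_pull (To X) (Tm (i \<cdot> e)) ` patchwork (To P)"
    using map_of_E[OF ieE ie] map_of_E[OF e] map_of_E[OF e'] \<kappa> Top_pushout_descend[OF universe poT, unfolded cmp]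
    by (intro patch_descend[of "Tm (i \<cdot> e)" "To X" "To P" "Tm e" "To A" "Tm e'" "To B"])
       (simp_all add: patch_obj_def patch_arr_eq[OF e(2)] patch_arr_eq[OF e'(2)])
  then show "\<kappa> \<in> patch_arr (i \<cdot> e) ` patch_obj (Cod C i)"
    by (simp add: patch_arr_eq[OF ie] patch_obj_def src.hom_cod[OF P(1)])
qed

text \<open>The links are \<open>x\<close> and \<open>y\<close>, altered off the image
  \<open>D\<close> of \<open>m\<close> to allow all pieces. A subspace of the image of
  \<open>m'\<close> either lies in \<open>D\<close>, hence in the image of the pullback where
  \<open>x\<close> and \<open>y\<close> agree, or carries all pieces in both links.\<close>

lemma patch_pullback:
  assumes m: "m \<in> M" "m \<in> Hom C A X" and m': "m' \<in> M" "m' \<in> Hom C B X"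
    and pb: "is_pullback C m m' p q"
    and xy: "x \<in> patch_obj X" "y \<in> patch_obj X" "patch_arr (m \<cdot> p) x = patch_arr (m \<cdot> p) y"
  shows "\<exists>z\<in>patch_obj X. \<exists>w\<in>patch_obj X.
    patch_arr m x = patch_arr m z \<and> patch_arr m' z = patch_arr m' w \<and> patch_arr m w = patch_arr m y"
proof -
  obtain P where P: "p \<in> Hom C P A" using pb m(2) m'(2) by (rule src.is_pullbackE) blast
  define D where "D = Tm m ` pts A"
  define z where "z = patch_ext (To X) D x"
  define w where "w = patch_ext (To X) D y"
  have D: "D \<subseteq> pts X" unfolding D_def by (rule Tm(2)[OF m(2)])
  have zw: "z \<in> patch_obj X" "w \<in> patch_obj X"
    unfolding z_def w_def patch_obj_def using xy(1,2) D by (auto simp: patch_obj_def intro: patch_ext_patchwork)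
  have agree: "x U = y U" if "U \<subseteq> D" "U \<subseteq> Tm m' ` pts B" for U
    using xy(3) that map_of_pullback[OF m m' pb P] unfolding D_def
      patch_arr_eq_iff[OF src.cmp_hom[OF P m(2)] xy(1,2)] by (meson Int_greatest subset_trans)
  have "patch_arr m x = patch_arr m z" "patch_arr m w = patch_arr m y"
    using patch_arr_eq_iff[OF m(2) xy(1) zw(1)] patch_arr_eq_iff[OF m(2) zw(2) xy(2)]
    by (simp_all add: z_def w_def patch_ext_def D_def)
  moreover have "patch_arr m' z = patch_arr m' w"
    using patch_arr_eq_iff[OF m'(2) zw] agree by (simp add: z_def w_def patch_ext_def)
  ultimately show ?thesis using zw by blast
qed

text \<open>The continuous factor \<open>d\<close> need not be the image of a morphism of
  \<open>C\<close>. It does make \<open>Ta j\<close> invertible in the preserved pushout, so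
  conservativity makes \<open>j\<close> invertible, and the inverse of \<open>j\<close> after
  \<open>i\<close> is the factor in \<open>C\<close>.\<close>

lemma patch_detect_E:
  assumes e: "e \<in> E" "e \<in> Hom C X Q" and e': "e' \<in> E" "e' \<in> Hom C X Q'"
    and sub: "patch_arr e' ` patch_obj Q' \<subseteq> patch_arr e ` patch_obj Q"
  shows "\<exists>d\<in>Hom C Q Q'. e' = d \<cdot> e"
proof -
  obtain d where d: "continuous_map (To Q) (To Q') d"
      "\<And>x. x \<in> pts X \<Longrightarrow> d (Tm e x) = Tm e' x"
    using Tm(1)[OF e(2)] map_of_E[OF e] Tm(1)[OF e'(2)] map_of_E[OF e']
      sub[unfolded patch_arr_eq[OF e(2)] patch_arr_eq[OF e'(2)] patch_obj_def]
    by (rule patch_detect_map) blast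
  let ?d = "(To Q, restrict d (pts Q), To Q')"
  have dh: "?d \<in> Hom Top (To Q) (To Q')"
    using To_small src.hom_objs(2)[OF e(2)] src.hom_objs(2)[OF e'(2)] d(1) by (intro Top_restrict_Hom)
  have ext: "Tm e' \<in> extensional (pts X)"
    using Ta_hom[OF e'(2)] unfolding Ta_eq[OF e'(2)] by (simp add: Top_Hom)
  have "Tm e x \<in> pts Q" if "x \<in> pts X" for x
    using that Tm(2)[OF e(2)] by blast
  then have "compose (pts X) (restrict d (pts Q)) (Tm e) = Tm e'"
    using d(2) by (intro extensionalityI[OF _ ext]) (auto simp: compose_def)
  then have fac: "Ta e' = ?d \<odot> Ta e"
    by (simp add: Ta_eq[OF e(2)] Ta_eq[OF e'(2)])
  obtain i j where po: "is_pushout C e e' i j"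
    using src.E_pushouts e e' by (metis src.hom_dom)
  obtain P where P: "i \<in> Hom C Q P" "j \<in> Hom C Q' P" "i \<cdot> e = j \<cdot> e'"
    using po e(2) e'(2) by (rule src.is_pushoutE) blast
  have "is_epi Top (Ta e)" using E_preserved e(1) tgt.E_epi by blast
  then have "is_iso Top (Ta j)"
    using Top.is_pushout_iso[OF pushout_preserved[OF e(1) e'(1) po] Ta_hom[OF e(2)] Ta_hom[OF e'(2)] _ dh fac] by blast
  then have "is_iso C j" by (rule conservative[OF src.hom_arr[OF P(2)]])
  then obtain k where k: "k \<in> Hom C P Q'" "k \<cdot> j = Idn C Q'" using P(2) by (rule src.is_isoE)
  have "(k \<cdot> i) \<cdot> e = (k \<cdot> j) \<cdot> e'"
    using src.cmp_assoc[OF e(2) P(1) k(1)] src.cmp_assoc[OF e'(2) P(2) k(1)] P(3) by simp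
  then show ?thesis using src.cmp_hom[OF P(1) k(1)] k(2) src.idn_left[OF e'(2)] by auto
qed

text \<open>The presheaf yields an inclusion of images, and the continuous inverse of an embedding
  turns it into a factorization between spaces. As for \<open>patch_detect_E\<close>, the preserved
  pullback and conservativity bring it back to \<open>C\<close>.\<close>

lemma patch_detect_M:
  assumes m: "m \<in> M" "m \<in> Hom C A X" and m': "m' \<in> M" "m' \<in> Hom C B X"
    and sub: "\<And>x y. x \<in> patch_obj X \<Longrightarrow> y \<in> patch_obj X \<Longrightarrow> patch_arr m x = patch_arr m y \<Longrightarrow>
      patch_arr m' x = patch_arr m' y"
  shows "\<exists>d\<in>Hom C B A. m' = m \<cdot> d"
proof -
  have im: "Tm m' ` pts B \<subseteq> Tm m ` pts A"
  proof (rule patch_detect_subset[OF Tm(2)[OF m(2)] Tm(2)[OF m'(2)]])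
    fix \<kappa> \<kappa>' assume \<kappa>: "\<kappa> \<in> patchwork (To X)" "\<kappa>' \<in> patchwork (To X)"
      and "\<forall>U. U \<subseteq> Tm m ` pts A \<longrightarrow> \<kappa> U = \<kappa>' U"
    then have "patch_arr m' \<kappa> = patch_arr m' \<kappa>'"
      using patch_arr_eq_iff[OF m(2)] by (intro sub) (simp_all add: patch_obj_def)
    then show "\<kappa> (Tm m' ` pts B) = \<kappa>' (Tm m' ` pts B)"
      using patch_arr_eq_iff[OF m'(2)] \<kappa> by (simp add: patch_obj_def)
  qed
  obtain g where g: "continuous_map (subtopology (To X) (Tm m ` pts A)) (To A) g"
      "\<And>a. a \<in> pts A \<Longrightarrow> g (Tm m a) = a"
    using map_of_M[OF m] by (rule embedding_map_inverse) blast
  have "continuous_map (To B) (subtopology (To X) (Tm m ` pts A)) (Tm m')"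
    using Tm(1)[OF m'(2)] im by (simp add: continuous_map_in_subtopology image_subset_iff_funcset[symmetric])
  then have c: "continuous_map (To B) (To A) (g \<circ> Tm m')" using g(1) by (rule continuous_map_compose)
  let ?d = "(To B, restrict (g \<circ> Tm m') (pts B), To A)"
  have dh: "?d \<in> Hom Top (To B) (To A)"
    using To_small src.hom_objs(1)[OF m(2)] src.hom_objs(1)[OF m'(2)] c by (intro Top_restrict_Hom)
  have ext: "Tm m' \<in> extensional (pts B)"
    using Ta_hom[OF m'(2)] unfolding Ta_eq[OF m'(2)] by (simp add: Top_Hom)
  have "Tm m (g (Tm m' b)) = Tm m' b" if b: "b \<in> pts B" for b
  proof -
    obtain a where "a \<in> pts A" "Tm m' b = Tm m a" using im b by blast
    then show ?thesis using g(2) by simp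
  qed
  then have "compose (pts B) (Tm m) (restrict (g \<circ> Tm m') (pts B)) = Tm m'"
    by (intro extensionalityI[OF _ ext]) (auto simp: compose_def)
  then have fac: "Ta m' = Ta m \<odot> ?d"
    by (simp add: Ta_eq[OF m(2)] Ta_eq[OF m'(2)])
  obtain p q where pb: "is_pullback C m m' p q"
    using src.M_pullbacks m m' by (metis src.hom_cod)
  obtain P where P: "p \<in> Hom C P A" "q \<in> Hom C P B" "m \<cdot> p = m' \<cdot> q"
    using pb m(2) m'(2) by (rule src.is_pullbackE) blast
  have "is_mono Top (Ta m)" using M_preserved m(1) tgt.M_mono by blast
  then have "is_iso Top (Ta q)"
    using Top.is_pullback_iso[OF pullback_preserved[OF m(1) m'(1) pb] Ta_hom[OF m(2)] Ta_hom[OF m'(2)] _ dh fac] by blast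
  then have "is_iso C q" by (rule conservative[OF src.hom_arr[OF P(2)]])
  then obtain k where k: "k \<in> Hom C B P" "q \<cdot> k = Idn C B" using P(2) by (rule src.is_isoE)
  have "m \<cdot> (p \<cdot> k) = m' \<cdot> (q \<cdot> k)"
    using src.cmp_assoc[OF k(1) P(1) m(2)] src.cmp_assoc[OF k(1) P(2) m'(2)] P(3) by simp
  then show ?thesis using src.cmp_hom[OF k(1) P(1)] k(2) src.idn_right[OF m'(2)] by auto
qed

section \<open>Coding of the equivalence relations and the assembled presheaf\<close>

lemma small_equivs:
  assumes X: "X \<in> Obj C"
  shows "small TYPE('u) {r. equiv (patch_obj X) r}"
proof (rule small_subset)
  show "small TYPE('u) (Pow (patch_obj X \<times> patch_obj X))"
    unfolding patch_obj_def
    by (intro small_Pow small_Times small_patchwork universe To_small X)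
  show "{r. equiv (patch_obj X) r} \<subseteq> Pow (patch_obj X \<times> patch_obj X)" by (auto dest: equiv_subset)
qed

lemma patch_code_inj:
  assumes X: "X \<in> Obj C"
  shows "inj_on (patch_code X) {r. equiv (patch_obj X) r}"
proof -
  obtain c :: "_ \<Rightarrow> 'u" where "inj_on c {r. equiv (patch_obj X) r}"
    using lesspoll_imp_lepoll[OF small_equivs[OF X]] by (auto simp: lepoll_def)
  then show ?thesis
    unfolding patch_code_def by (rule someI[where P = "\<lambda>c. inj_on c {r. equiv (patch_obj X) r}"])
qed

text \<open>The base point is the patchwork without pieces: it lives on every space and is preserved
  by every pullback.\<close>

lemma detecting_presheaf_patch:
  "detecting_presheaf C E M patch_obj patch_arr (\<lambda>_. {}) patch_code"
proof (intro detecting_presheaf.intro detecting_presheaf_axioms.intro src.pfs_category_axioms)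
  show "patch_arr f x \<in> patch_obj X" if f: "f \<in> Hom C X Y" and x: "x \<in> patch_obj Y" for f X Y x
    using x patch_pull_closed[OF Tm(1)[OF f]] by (simp add: patch_arr_eq[OF f] patch_obj_def)
  show "patch_arr (Idn C X) x = x" if X: "X \<in> Obj C" and x: "x \<in> patch_obj X" for X x
    unfolding patch_arr_eq[OF src.idn_hom[OF X]]
    using x Tm_idn[OF X] by (intro patch_pull_ident) (simp_all add: patch_obj_def)
  show "patch_arr (g \<cdot> f) x = patch_arr f (patch_arr g x)"
    if f: "f \<in> Hom C X Y" and g: "g \<in> Hom C Y Z" and x: "x \<in> patch_obj Z" for f g X Y Z x
    unfolding patch_arr_eq[OF f] patch_arr_eq[OF g] patch_arr_eq[OF src.cmp_hom[OF f g]]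
    using Tm(2)[OF f] Tm_cmp[OF f g] by (rule patch_pull_compose)
  show "(\<lambda>_. {}) \<in> patch_obj X" if "X \<in> Obj C" for X
    by (simp add: patch_obj_def patchwork_empty)
  show "patch_arr f (\<lambda>_. {}) = (\<lambda>_. {})" if "f \<in> Hom C X Y" for f X Y
    by (simp add: patch_arr_def patch_pull_empty)
  show "inj_on (patch_arr e) (patch_obj (Cod C e))" if e: "e \<in> E" for e
  proof (rule inj_onI)
    note eh = src.E_hom[OF e]
    fix x y assume xy: "x \<in> patch_obj (Cod C e)" "y \<in> patch_obj (Cod C e)" and "patch_arr e x = patch_arr e y"
    then have "\<forall>B. B \<subseteq> topspace (To (Cod C e)) \<longrightarrow> x B = y B"
      using patch_arr_eq_iff[OF eh xy] map_of_E[OF e eh] by simp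
    moreover have "x B = y B" if "\<not> B \<subseteq> topspace (To (Cod C e))" for B
      using that xy patchworkD(2) by (metis patch_obj_def)
    ultimately show "x = y" by blast
  qed
  show "patch_obj (Dom C m) \<subseteq> patch_arr m ` patch_obj (Cod C m)" if m: "m \<in> M" for m
    using patch_pull_embedding_surj[OF map_of_M[OF m src.M_hom[OF m]] _ Tm(2)[OF src.M_hom[OF m]]]
    unfolding patch_arr_eq[OF src.M_hom[OF m]] patch_obj_def by blast
  show "patch_arr e ` patch_obj (Cod C e) \<inter> patch_arr e' ` patch_obj (Cod C e')
      \<subseteq> patch_arr (i \<cdot> e) ` patch_obj (Cod C i)"
    if e: "e \<in> E" and e': "e' \<in> E" and po: "is_pushout C e e' i j" for e e' i j
  proof (rule patch_pushout[OF e src.E_hom[OF e] e' _ po])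
    show "e' \<in> Hom C (Dom C e) (Cod C e')"
      using src.E_hom[OF e'] po by (simp add: is_pushout_def)
  qed
  show "\<exists>z\<in>patch_obj (Cod C m). \<exists>w\<in>patch_obj (Cod C m).
      patch_arr m x = patch_arr m z \<and> patch_arr m' z = patch_arr m' w \<and> patch_arr m w = patch_arr m y"
    if m: "m \<in> M" and m': "m' \<in> M" and pb: "is_pullback C m m' p q"
      and xy: "x \<in> patch_obj (Cod C m)" "y \<in> patch_obj (Cod C m)"
        "patch_arr (m \<cdot> p) x = patch_arr (m \<cdot> p) y" for m m' p q x y
  proof (rule patch_pullback[OF m src.M_hom[OF m] m' _ pb xy])
    show "m' \<in> Hom C (Dom C m') (Cod C m)"
      using src.M_hom[OF m'] pb by (simp add: is_pullback_def)
  qed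
  show "\<exists>d\<in>Hom C (Cod C e) (Cod C e'). e' = d \<cdot> e"
    if e: "e \<in> E" and e': "e' \<in> E" and dom: "Dom C e = Dom C e'"
      and sub: "patch_arr e' ` patch_obj (Cod C e') \<subseteq> patch_arr e ` patch_obj (Cod C e)" for e e'
  proof (rule patch_detect_E[OF e src.E_hom[OF e] e' _ sub])
    show "e' \<in> Hom C (Dom C e) (Cod C e')" unfolding dom by (rule src.E_hom[OF e'])
  qed
  show "\<exists>d\<in>Hom C (Dom C m') (Dom C m). m' = m \<cdot> d"
    if m: "m \<in> M" and m': "m' \<in> M" and cod: "Cod C m = Cod C m'"
      and sub: "\<And>x y. x \<in> patch_obj (Cod C m) \<Longrightarrow> y \<in> patch_obj (Cod C m) \<Longrightarrow>
        patch_arr m x = patch_arr m y \<Longrightarrow> patch_arr m' x = patch_arr m' y" for m m'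
  proof (rule patch_detect_M[OF m src.M_hom[OF m] m' _ sub])
    show "m' \<in> Hom C (Dom C m') (Cod C m)" unfolding cod by (rule src.M_hom[OF m'])
  qed
  show "inj_on (patch_code X) {r. equiv (patch_obj X) r}" if "X \<in> Obj C" for X
    using that by (rule patch_code_inj)
  show "small TYPE('u) (patch_code X ` {r. equiv (patch_obj X) r})" if "X \<in> Obj C" for X
    by (rule small_image[OF small_equivs[OF that]])
qed

end

theorem corollary4p18:
  fixes C :: "('o, 'm) cat" and E M :: "'m set"
  assumes "set_universe TYPE('u)"
    and "locally_small TYPE('u) C"
    and "pfs_category C E M"
  shows "(\<exists>F :: ('o, 'm, 'u) form. noetherian_form C F \<and> induces C F E M) \<longleftrightarrow>
         (\<exists>To Ta. transfer_functor C E M (Top :: ('u topology, 'u top_arr) cat)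
                     Top_surjections Top_embeddings To Ta)"
proof
  assume "\<exists>F :: ('o, 'm, 'u) form. noetherian_form C F \<and> induces C F E M"
  then obtain F :: "('o, 'm, 'u) form" where "noetherian_form C F" "induces C F E M" by blast
  then interpret inducing_form C F E M
    using assms(3) by (intro inducing_form.intro inducing_form_axioms.intro)
  show "\<exists>To Ta. transfer_functor C E M (Top :: ('u topology, 'u top_arr) cat)
                     Top_surjections Top_embeddings To Ta"
    using transfer_functor_fibre by blast
next
  assume "\<exists>To Ta. transfer_functor C E M (Top :: ('u topology, 'u top_arr) cat)
                     Top_surjections Top_embeddings To Ta"
  then obtain To Ta where "transfer_functor C E M (Top :: ('u topology, 'u top_arr) cat)
                     Top_surjections Top_embeddings To Ta" by blast
  then interpret transfer_to_Top C E M To Ta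
    using assms(1) by (intro transfer_to_Top.intro transfer_to_Top_axioms.intro)
  interpret detecting_presheaf C E M patch_obj patch_arr "\<lambda>_. {}" patch_code
    by (rule detecting_presheaf_patch)
  show "\<exists>F :: ('o, 'm, 'u) form. noetherian_form C F \<and> induces C F E M"
    using noetherian_form_eqv induces_eqv by blast
qed

end
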